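(* Let $r,s,n$ be positive integers. There exists a $\mathbb{C}(q)$-linear map $$\Upsilon:\bar{\mathsf{A}}_{s,n}\otimes\mathsf{A}_{r,n}\longrightarrow\mathsf{A}_{r,n}\otimes\bar{\mathsf{A}}_{s,n}$$ such that, with $\mathrm{mul}$ denoting the multiplication maps, $$\Upsilon\circ(1\otimes\mathrm{mul})=(\mathrm{mul}\otimes1)\circ(1\otimes\Upsilon)\circ(\Upsilon\otimes1)\quad\text{on }\bar{\mathsf{A}}_{s,n}\otimes\mathsf{A}_{r,n}\otimes\mathsf{A}_{r,n},$$ $$\Upsilon\circ(\mathrm{mul}\otimes1)=(1\otimes\mathrm{mul})\circ(\Upsilon\otimes1)\circ(1\otimes\Upsilon)\quad\text{on }\bar{\mathsf{A}}_{s,n}\otimes\bar{\mathsf{A}}_{s,n}\otimes\mathsf{A}_{r,n},$$ $$\Upsilon(1\otimes f)=f\otimes1,\qquad\Upsilon(\bar g\otimes1)=1\otimes\bar g\qquad(f\in\mathsf{A}_{r,n},\ \bar g\in\bar{\mathsf{A}}_{s,n}),$$ and $$\Upsilon\left(\bar T^{1[3]}T_+^{2[4]}\right)=T_+^{2[3]}\left(S^{-1}\right)^{12}\bar T^{1[4]},$$ where $\Upsilon$ acts on the entries (algebra slots $[3],[4]$).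
   Context: The ground field is $\mathbb{C}(q)$, $q$ an indeterminate; $\xi=q-q^{-1}$. For $N\ge1$ let $I_{N|N}=\{-N,\ldots,-1,1,\ldots,N\}$, $|i|=\bar0$ for $i>0$, $|i|=\bar1$ for $i<0$. $V_N$ is the superspace with basis $v_i$ ($i\in I_{N|N}$) of parity $|i|$; $E_{ij}$ denotes a (possibly rectangular) matrix unit, of parity $|i|+|j|$. Tensor products of superalgebras follow the rule $(x\otimes y)(x'\otimes y')=(-1)^{|y||x'|}xx'\otimes yy'$. Put $\varphi(i,j)=(-1)^{|j|}(\delta_{i,j}+\delta_{i,-j})$ and $$S=\sum_{i,j\in I_{N|N}}q^{\varphi(i,j)}E_{ii}\otimes E_{jj}+\xi\sum_{i<j}(-1)^{|i|}(E_{ji}+E_{-j,-i})\otimes E_{ij}\in\mathrm{End}(V_N)^{\otimes2},$$ an invertible element; the same letter $S$ is used for every $N$, the size being determined by the formula in which it occurs (in the formula for $\Upsilon$ in the claim, $N=n$). For $X=\sum E_{ij}\otimes x_{ij}$ with entries in a superalgebra, $X^{k[l]}$ means that $E_{ij}$ is placed in tensor slot $k$ and $x_{ij}$ in slot $l$, with identities (of the size making products defined) elsewhere; $S^{kl}$ is $S$ placed in matrix slots $k,l$. $\mathsf{A}_{r,n}$ is the unital superalgebra with generators $t_{ia}$ of parity $|i|+|a|$ ($i\in I_{r|r}$, $a\in I_{n|n}$) and relations $t_{ia}=t_{-i,-a}$, $S^{12}T^{1[3]}T^{2[3]}=T^{2[3]}T^{1[3]}S^{12}$ with $T=\sum_{i\in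 I_{r|r},a\in I_{n|n}}E_{ia}\otimes t_{ia}$ (the $S$ on the left has $N=r$, the one on the right has $N=n$). Put $T_+=\sum_{i=1}^r\sum_{a\in I_{n|n}}E_{ia}\otimes t_{ia}$. $\bar{\mathsf{A}}_{s,n}$ is the unital superalgebra with generators $\bar t_{\alpha b}$ of parity $|\alpha|+|b|$ ($\alpha\in I_{s|s}$, $b\in I_{n|n}$) and relations $\bar t_{\alpha,b}=(-1)^{|\alpha|+|b|}\bar t_{-\alpha,-b}$, $\bar T^{1[3]}\bar T^{2[3]}S^{12}=S^{12}\bar T^{2[3]}\bar T^{1[3]}$ with $\bar T=\sum_{\alpha\in I_{s|s},b\in I_{n|n}}(-1)^{|b|(|\alpha|+|b|)}E_{b\alpha}\otimes\bar t_{\alpha b}$. In components, the last displayed condition in the claim reads, for $1\le i\le r$, $a,b\in I_{n|n}$, $\alpha\in I_{s|s}$: $$\Upsilon(\bar t_{\alpha b}\otimes t_{ia})=(-1)^{|a|(|\alpha|+|b|)}q^{-\varphi(b,a)}t_{ia}\otimes\bar t_{\alpha b}-(-1)^{|a||\alpha|}\xi\sum_{p<a}t_{ip}\otimes(\delta_{ab}\bar t_{\alpha p}+(-1)^{|p|}\delta_{a,-b}\bar t_{\alpha,-p}).$$ *)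

theory Defs
  imports
    Complex_Main
    "HOL-Library.Poly_Mapping"
    "HOL-Library.Z2"
    "HOL-Library.Cardinality"
    "HOL-Computational_Algebra.Polynomial"
    "HOL-Computational_Algebra.Fraction_Field"
begin

section \<open>Superalgebras over the field of rational functions\<close>

declare add_bit_eq_xor [simp del] mult_bit_eq_and [simp del]

lemma bit_disj: "(p::bit) = 0 \<or> p = 1"
  by (cases p) auto

lemma bit_add_self [simp]: "(d::bit) + d = 0" "d + (d + e) = e"
  using bit_disj[of d] bit_disj[of e] by (auto simp: add_bit_eq_xor)

type_synonym Cq = "complex poly fract"

definition qvar :: Cq where "qvar = Fract [:0, 1:] 1"

definition qxi :: Cq where "qxi = qvar - inverse qvar"

text \<open>Parities live in \<^typ>\<open>bit\<close>, the field with two elements; \<open>sgn_pow d\<close> is $(-1)^d$.\<close>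

definition sgn_pow :: "bit \<Rightarrow> 'a::{ring,monoid_mult}" where
  "sgn_pow d = (if d = 0 then 1 else - 1)"

class Cq_space = ab_group_add +
  fixes scaleq :: "Cq \<Rightarrow> 'a \<Rightarrow> 'a"  (infixr "*\<^sub>q" 75)
  assumes scaleq_add_right: "c *\<^sub>q (x + y) = c *\<^sub>q x + c *\<^sub>q y"
    and scaleq_add_left: "(c + d) *\<^sub>q x = c *\<^sub>q x + d *\<^sub>q x"
    and scaleq_scaleq: "c *\<^sub>q d *\<^sub>q x = (c * d) *\<^sub>q x"
    and scaleq_one: "1 *\<^sub>q x = x"

interpretation Cq_space: vector_space "scaleq :: Cq \<Rightarrow> 'a::Cq_space \<Rightarrow> 'a"
  by unfold_locales (fact scaleq_add_right scaleq_add_left scaleq_scaleq scaleq_one)+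

abbreviation Cq_linear :: "('a::Cq_space \<Rightarrow> 'b::Cq_space) \<Rightarrow> bool" where
  "Cq_linear \<equiv> Vector_Spaces.linear (*\<^sub>q) (*\<^sub>q)"

text \<open>A $\mathbb{Z}/2$-grading is given by its projections: \<open>hpart p x\<close> is the homogeneous
  component of \<open>x\<close> of parity \<open>p\<close>.\<close>

class graded_group = ab_group_add +
  fixes hpart :: "bit \<Rightarrow> 'a \<Rightarrow> 'a"
  assumes hpart_add: "hpart p (x + y) = hpart p x + hpart p y"
    and hpart_hpart: "hpart p (hpart p' x) = (if p = p' then hpart p x else 0)"
    and hpart_sum: "hpart 0 x + hpart 1 x = x"

class super_ring = ring + monoid_mult + graded_group +
  assumes hpart_one: "hpart 0 1 = 1"
    and hpart_mult: "hpart (p + p') (hpart p x * hpart p' y) = hpart p x * hpart p' y"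

class superspace = Cq_space + graded_group +
  assumes hpart_scaleq: "hpart p (c *\<^sub>q x) = c *\<^sub>q hpart p x"

class superalgebra = superspace + super_ring +
  assumes scaleq_mult_left: "(c *\<^sub>q x) * y = c *\<^sub>q (x * y)"
    and scaleq_mult_right: "x * (c *\<^sub>q y) = c *\<^sub>q (x * y)"

text \<open>The parity operator twisted by \<open>d\<close>: a homogeneous \<open>x\<close> goes to $(-1)^{|x| d}\,x$.\<close>

definition twist :: "bit \<Rightarrow> 'a::super_ring \<Rightarrow> 'a" where
  "twist d x = hpart 0 x + sgn_pow d * hpart 1 x"

text \<open>The ground field itself is purely even.\<close>

instantiation fract :: (idom) super_ring
begin

definition hpart_fract :: "bit \<Rightarrow> 'a fract \<Rightarrow> 'a fract" where
  "hpart_fract p x = (if p = 0 then x else 0)"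

instance
  by standard (auto simp: hpart_fract_def)

end

lemma hpart_zero [simp]: "hpart p (0::'a::graded_group) = 0"
  using hpart_add[of p "0::'a" 0] by simp

lemma hpart_uminus: "hpart p (- x :: 'a::graded_group) = - hpart p x"
  using hpart_add[of p x "- x"] by (simp add: eq_neg_iff_add_eq_0 add.commute)

lemma hpart_diff: "hpart p (x - y :: 'a::graded_group) = hpart p x - hpart p y"
  using hpart_add[of p x "- y"] by (simp add: hpart_uminus)

lemma hpart_setsum: "hpart p (sum f A :: 'a::graded_group) = (\<Sum>a\<in>A. hpart p (f a))"
  by (induction A rule: infinite_finite_induct) (auto simp: hpart_add)

lemma hpart_sgn_pow: "hpart p (sgn_pow d * x :: 'a::super_ring) = sgn_pow d * hpart p x"
  by (simp add: sgn_pow_def hpart_uminus)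

lemma homogeneous_unique:
  fixes x :: "'a::graded_group"
  assumes "hpart p x = x" "p' \<noteq> p"
  shows "hpart p' x = 0"
  using assms hpart_hpart[of p' p x] by simp

lemma twist_homogeneous:
  fixes x :: "'a::super_ring"
  assumes "hpart p x = x"
  shows "twist d x = sgn_pow (p * d) * x"
proof -
  have "hpart (p + 1) x = 0"
    by (rule homogeneous_unique[OF assms]) (use bit_disj[of p] in auto)
  then show ?thesis
    using bit_disj[of p] assms by (auto simp: twist_def sgn_pow_def)
qed

lemma homogeneous_mult:
  fixes x y :: "'a::super_ring"
  assumes "hpart p x = x" "hpart p' y = y"
  shows "hpart (p + p') (x * y) = x * y"
  using hpart_mult[of p p' x y] assms by simp

section \<open>Index sets\<close>

class indexed_parity =
  fixes par :: "'a \<Rightarrow> bit"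

text \<open>For \<open>N = CARD('n)\<close> the type \<open>'n sidx\<close> is $I_{N|N}$; only the cardinality of \<open>'n\<close> matters.\<close>

typedef (overloaded) ('n::finite) sidx = "{i::int. i \<noteq> 0 \<and> \<bar>i\<bar> \<le> int CARD('n)}"
  by (rule exI[of _ 1]) (simp add: Suc_leI)

setup_lifting type_definition_sidx

instantiation sidx :: (finite) "{finite, linorder, uminus, indexed_parity}"
begin

lift_definition less_eq_sidx :: "'a sidx \<Rightarrow> 'a sidx \<Rightarrow> bool" is "(\<le>)" .
lift_definition less_sidx :: "'a sidx \<Rightarrow> 'a sidx \<Rightarrow> bool" is "(<)" .
lift_definition uminus_sidx :: "'a sidx \<Rightarrow> 'a sidx" is uminus by simp
lift_definition par_sidx :: "'a sidx \<Rightarrow> bit" is "\<lambda>i. if i > 0 then 0 else 1" .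

instance
proof
  have "finite {i::int. i \<noteq> 0 \<and> \<bar>i\<bar> \<le> int CARD('a)}"
    by (rule finite_subset[of _ "{- int CARD('a)..int CARD('a)}"]) auto
  then show "finite (UNIV :: 'a sidx set)"
    by (simp add: type_definition.univ[OF type_definition_sidx])
qed (transfer; auto)+

end

definition sidx_pos :: "'n::finite sidx \<Rightarrow> bool" where
  "sidx_pos i \<longleftrightarrow> 0 < Rep_sidx i"

lemma par_uminus_sidx: "par (- i :: 'n::finite sidx) = par i + 1"
  by transfer auto

section \<open>Matrices in two tensor slots\<close>

text \<open>An array \<open>X\<close> stands for
  $\sum E_{ij}\otimes E_{kl}\otimes X_{ijkl}$, the last factor being an element of \<open>'b\<close>.\<close>

type_synonym ('i, 'j, 'k, 'l, 'b) mat2 = "'i \<Rightarrow> 'j \<Rightarrow> 'k \<Rightarrow> 'l \<Rightarrow> 'b"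

text \<open>In $(E_{ij}\otimes E_{kl}\otimes x)(E_{jm}\otimes E_{lp}\otimes y)$ the factor $E_{kl}$ moves
  past $E_{jm}$, and $x$ moves past $E_{jm}\otimes E_{lp}$.\<close>

definition mat2_mult ::
  "('i, 'j::{finite,indexed_parity}, 'k::indexed_parity, 'l::{finite,indexed_parity}, 'b::super_ring) mat2
   \<Rightarrow> ('j, 'm::indexed_parity, 'l, 'p::indexed_parity, 'b) mat2
   \<Rightarrow> ('i, 'm, 'k, 'p, 'b) mat2"  (infixl "\<odot>" 70) where
  "(X \<odot> Y) i m k p =
     (\<Sum>j\<in>UNIV. \<Sum>l\<in>UNIV. sgn_pow ((par k + par l) * (par j + par m)) *
        (twist (par j + par m + par l + par p) (X i j k l) * Y j m l p))"

definition mat2_one :: "('i, 'i, 'k, 'k, 'b::super_ring) mat2" where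
  "mat2_one i j k l = (if i = j \<and> k = l then 1 else 0)"

text \<open>\<open>slot1 X\<close> and \<open>slot2 X\<close> are $X^{1[\cdot]}$ and $X^{2[\cdot]}$: when the coefficients lie in
  a tensor product of two algebras, the algebra slot is chosen by writing the entries of \<open>X\<close> as
  \<open>x \<otimes> 1\<close> or \<open>1 \<otimes> x\<close>.\<close>

definition slot1 :: "('i \<Rightarrow> 'j \<Rightarrow> 'b::zero) \<Rightarrow> ('i, 'j, 'k, 'k, 'b) mat2" where
  "slot1 X i j k l = (if k = l then X i j else 0)"

definition slot2 :: "('k \<Rightarrow> 'l \<Rightarrow> 'b::zero) \<Rightarrow> ('i, 'i, 'k, 'l, 'b) mat2" where
  "slot2 X i j k l = (if i = j then X k l else 0)"

definition mat2_scalar :: "('i, 'j, 'k, 'l, Cq) mat2 \<Rightarrow> ('i, 'j, 'k, 'l, 'b::superalgebra) mat2" where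
  "mat2_scalar X i j k l = X i j k l *\<^sub>q 1"

definition mat2_map :: "('a \<Rightarrow> 'b) \<Rightarrow> ('i, 'j, 'k, 'l, 'a) mat2 \<Rightarrow> ('i, 'j, 'k, 'l, 'b) mat2" where
  "mat2_map f X i j k l = f (X i j k l)"

definition mat_unit2 :: "'i \<Rightarrow> 'j \<Rightarrow> 'k \<Rightarrow> 'l \<Rightarrow> ('i, 'j, 'k, 'l, Cq) mat2" where
  "mat_unit2 i j k l i' j' k' l' = (if i' = i \<and> j' = j \<and> k' = k \<and> l' = l then 1 else 0)"

definition phi :: "'n::finite sidx \<Rightarrow> 'n sidx \<Rightarrow> int" where
  "phi i j = sgn_pow (par j) * ((if i = j then 1 else 0) + (if i = - j then 1 else 0))"

definition S_mat :: "('n::finite sidx, 'n sidx, 'n sidx, 'n sidx, Cq) mat2" where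
  "S_mat i' j' k' l' =
     (\<Sum>i\<in>UNIV. \<Sum>j\<in>UNIV. qvar powi phi i j * mat_unit2 i i j j i' j' k' l') +
     qxi * (\<Sum>i\<in>UNIV. \<Sum>j\<in>{j. i < j}. sgn_pow (par i) *
        (mat_unit2 j i i j i' j' k' l' + mat_unit2 (- j) (- i) i j i' j' k' l'))"

definition S_inv :: "('n::finite sidx, 'n sidx, 'n sidx, 'n sidx, Cq) mat2" where
  "S_inv = (THE X. S_mat \<odot> X = mat2_one \<and> X \<odot> S_mat = mat2_one)"

section \<open>Free superalgebras\<close>

text \<open>The free algebra is the monoid algebra of the free monoid of words.\<close>

instantiation list :: (type) monoid_add
begin

definition zero_list :: "'a list" where "0 = []"
definition plus_list :: "'a list \<Rightarrow> 'a list \<Rightarrow> 'a list" where "xs + ys = xs @ ys"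

instance
  by standard (simp_all add: zero_list_def plus_list_def)

end

definition word_par :: "'g::indexed_parity list \<Rightarrow> bit" where
  "word_par w = sum_list (map par w)"

lemma word_par_add: "word_par (v + w) = word_par v + word_par w"
  by (simp add: word_par_def plus_list_def)

lemma word_par_zero [simp]: "word_par 0 = 0"
  by (simp add: word_par_def zero_list_def)

lemma poly_mapping_additive_induct [case_names single add]:
  fixes x :: "'a \<Rightarrow>\<^sub>0 'b::comm_monoid_add"
  assumes "\<And>w c. P (Poly_Mapping.single w c)" "\<And>x y. P x \<Longrightarrow> P y \<Longrightarrow> P (x + y)"
  shows "P x"
proof (induction x rule: update_induct)
  case const
  show ?case using assms(1)[of undefined 0] by simp
next
  case (update f a b)
  have "Poly_Mapping.update a b f = Poly_Mapping.single a b + f"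
    using update by (intro poly_mapping_eqI)
      (auto simp: lookup_update lookup_add lookup_single in_keys_iff when_def)
  then show ?case using assms update by simp
qed

definition mon_hpart :: "bit \<Rightarrow> ('g::indexed_parity list \<Rightarrow>\<^sub>0 Cq) \<Rightarrow> ('g list \<Rightarrow>\<^sub>0 Cq)" where
  "mon_hpart p = Poly_Mapping.mapp (\<lambda>w c. if word_par w = p then c else 0)"

lemma lookup_mon_hpart:
  "Poly_Mapping.lookup (mon_hpart p x) w = (if word_par w = p then Poly_Mapping.lookup x w else 0)"
  by (auto simp: mon_hpart_def lookup_mapp when_def in_keys_iff)

lemma mon_hpart_add: "mon_hpart p (x + y) = mon_hpart p x + mon_hpart p y"
  by (rule poly_mapping_eqI) (simp add: lookup_mon_hpart lookup_add)

lemma mon_hpart_single: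
  "mon_hpart p (Poly_Mapping.single w c) = (if word_par w = p then Poly_Mapping.single w c else 0)"
  by (rule poly_mapping_eqI) (auto simp: lookup_mon_hpart lookup_single when_def)

lemma mon_hpart_mult:
  "mon_hpart (p + p') (mon_hpart p x * mon_hpart p' y) = mon_hpart p x * mon_hpart p' y"
proof (induction x rule: poly_mapping_additive_induct)
  case (single v c)
  show ?case
  proof (induction y rule: poly_mapping_additive_induct)
    case (single w d)
    have "mon_hpart p 0 = (0 :: 'a list \<Rightarrow>\<^sub>0 Cq)" for p
      by (rule poly_mapping_eqI) (simp add: lookup_mon_hpart)
    then show ?case
      by (simp add: mon_hpart_single mult_single word_par_add)
  qed (simp add: mon_hpart_add distrib_left)
qed (simp add: mon_hpart_add distrib_right)

lemma single_zero_central: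
  "Poly_Mapping.single 0 c * x = x * Poly_Mapping.single 0 (c::Cq)" for x :: "'g list \<Rightarrow>\<^sub>0 Cq"
  by (induction x rule: poly_mapping_additive_induct)
    (simp_all add: mult_single mult.commute distrib_left distrib_right)

lemma mult_single_zero:
  "x * (Poly_Mapping.single 0 c * y) = Poly_Mapping.single 0 (c::Cq) * (x * y)"
  for x y :: "'g list \<Rightarrow>\<^sub>0 Cq"
  unfolding mult.assoc[symmetric] single_zero_central[of c x] ..

typedef 'g free_alg = "UNIV :: ('g list \<Rightarrow>\<^sub>0 Cq) set" ..

setup_lifting type_definition_free_alg

instantiation free_alg :: (indexed_parity) superalgebra
begin

lift_definition zero_free_alg :: "'a free_alg" is 0 .
lift_definition one_free_alg :: "'a free_alg" is 1 .
lift_definition plus_free_alg :: "'a free_alg \<Rightarrow> 'a free_alg \<Rightarrow> 'a free_alg" is "(+)" .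
lift_definition minus_free_alg :: "'a free_alg \<Rightarrow> 'a free_alg \<Rightarrow> 'a free_alg" is "(-)" .
lift_definition uminus_free_alg :: "'a free_alg \<Rightarrow> 'a free_alg" is uminus .
lift_definition times_free_alg :: "'a free_alg \<Rightarrow> 'a free_alg \<Rightarrow> 'a free_alg" is "(*)" .
definition scaleq_free_alg :: "Cq \<Rightarrow> 'a free_alg \<Rightarrow> 'a free_alg" where
  "c *\<^sub>q x = Abs_free_alg (Poly_Mapping.single 0 c * Rep_free_alg x)"
lift_definition hpart_free_alg :: "bit \<Rightarrow> 'a free_alg \<Rightarrow> 'a free_alg" is mon_hpart .

lemma scaleq_free_alg_transfer [transfer_rule]:
  "rel_fun (=) (rel_fun cr_free_alg cr_free_alg) (\<lambda>c x. Poly_Mapping.single 0 c * x) (*\<^sub>q)"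
  by (simp add: rel_fun_def cr_free_alg_def scaleq_free_alg_def Abs_free_alg_inverse)

instance
proof
  fix x y z :: "'a free_alg" and c d :: Cq and p p' :: bit
  show "x + y + z = x + (y + z)" "x + y = y + x" "0 + x = x" "- x + x = 0" "x - y = x + - y"
    "x * y * z = x * (y * z)" "1 * x = x" "x * 1 = x"
    by (transfer; simp add: mult.assoc add.assoc add.commute)+
  show "(x + y) * z = x * z + y * z" "x * (y + z) = x * y + x * z"
    by (transfer; simp add: distrib_left distrib_right)+
  show "c *\<^sub>q (x + y) = c *\<^sub>q x + c *\<^sub>q y"
    by (transfer; simp add: distrib_left)
  show "(c + d) *\<^sub>q x = c *\<^sub>q x + d *\<^sub>q x"
    by (transfer; simp add: single_add distrib_right)
  show "c *\<^sub>q d *\<^sub>q x = (c * d) *\<^sub>q x"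
    by (transfer; simp add: mult_single flip: mult.assoc)
  show "1 *\<^sub>q x = x"
    by (transfer; simp)
  show "(c *\<^sub>q x) * y = c *\<^sub>q (x * y)"
    by (transfer; simp add: mult.assoc)
  show "x * (c *\<^sub>q y) = c *\<^sub>q (x * y)"
    by transfer (rule mult_single_zero)
  show "hpart p (x + y) = hpart p x + hpart p y"
    by transfer (rule mon_hpart_add)
  show "hpart p (hpart p' x) = (if p = p' then hpart p x else 0)"
    by transfer (auto intro!: poly_mapping_eqI simp: lookup_mon_hpart)
  show "hpart 0 x + hpart 1 x = x"
    by transfer (auto intro!: poly_mapping_eqI simp: lookup_mon_hpart lookup_add)
  show "hpart 0 1 = (1 :: 'a free_alg)"
    by transfer (auto intro!: poly_mapping_eqI simp: lookup_mon_hpart lookup_one when_def)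
  show "hpart (p + p') (hpart p x * hpart p' y) = hpart p x * hpart p' y"
    by transfer (rule mon_hpart_mult)
  show "hpart p (c *\<^sub>q x) = c *\<^sub>q hpart p x"
    by transfer (auto intro!: poly_mapping_eqI
        simp: lookup_mon_hpart Poly_Mapping.map.rep_eq when_def simp flip: mult_map_scale_conv_mult)
qed

end

lift_definition gen :: "'g \<Rightarrow> 'g free_alg" is "\<lambda>g. Poly_Mapping.single [g] 1" .

lemma hpart_gen [simp]: "hpart (par g) (gen g) = gen g"
  by transfer (simp add: mon_hpart_single word_par_def)

section \<open>Superalgebras given by generators and relations\<close>

text \<open>The elements of \<open>relators\<close> are the differences of the two sides of the defining relations;
  the assumption says that each of them is homogeneous, so that the two-sided ideal they generate
  is graded.\<close>

class presentation = indexed_parity +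
  fixes relators :: "'a free_alg set"
  assumes relators_homogeneous:
    "x \<in> relators \<Longrightarrow>
       \<exists>p. \<forall>w. Poly_Mapping.lookup (Rep_free_alg x) w \<noteq> 0 \<longrightarrow> sum_list (map par w) = p"

lemma homogeneous_free_alg_iff:
  "hpart p x = x \<longleftrightarrow> (\<forall>w. Poly_Mapping.lookup (Rep_free_alg x) w \<noteq> 0 \<longrightarrow> word_par w = p)"
  for x :: "'g::indexed_parity free_alg"
proof -
  have "hpart p x = x \<longleftrightarrow> mon_hpart p (Rep_free_alg x) = Rep_free_alg x"
    by transfer (rule refl)
  also have "\<dots> \<longleftrightarrow> (\<forall>w. Poly_Mapping.lookup (Rep_free_alg x) w \<noteq> 0 \<longrightarrow> word_par w = p)"
    unfolding poly_mapping_eq_iff fun_eq_iff lookup_mon_hpart by force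
  finally show ?thesis .
qed

lemma relators_hpart:
  "x \<in> (relators :: 'g::presentation free_alg set) \<Longrightarrow> \<exists>p. hpart p x = x"
  using relators_homogeneous[of x] by (simp add: homogeneous_free_alg_iff word_par_def)

inductive_set two_sided_ideal :: "'a::{ring,monoid_mult} set \<Rightarrow> 'a set" for R where
  base: "x \<in> R \<Longrightarrow> x \<in> two_sided_ideal R"
| zero: "0 \<in> two_sided_ideal R"
| add: "x \<in> two_sided_ideal R \<Longrightarrow> y \<in> two_sided_ideal R \<Longrightarrow> x + y \<in> two_sided_ideal R"
| mult: "x \<in> two_sided_ideal R \<Longrightarrow> a * x * b \<in> two_sided_ideal R"

lemma two_sided_ideal_mult_left: "x \<in> two_sided_ideal R \<Longrightarrow> a * x \<in> two_sided_ideal R"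
  using two_sided_ideal.mult[of x R a 1] by simp

lemma two_sided_ideal_mult_right: "x \<in> two_sided_ideal R \<Longrightarrow> x * b \<in> two_sided_ideal R"
  using two_sided_ideal.mult[of x R 1 b] by simp

lemma two_sided_ideal_uminus: "x \<in> two_sided_ideal R \<Longrightarrow> - x \<in> two_sided_ideal R"
  using two_sided_ideal_mult_left[of x R "- 1"] by (simp add: minus_mult_left[symmetric])

lemma two_sided_ideal_diff:
  "x \<in> two_sided_ideal R \<Longrightarrow> y \<in> two_sided_ideal R \<Longrightarrow> x - y \<in> two_sided_ideal R"
  using two_sided_ideal.add[of x R "- y"] two_sided_ideal_uminus[of y R] by simp

lemma two_sided_ideal_trans:
  assumes "x - y \<in> two_sided_ideal R" "y - z \<in> two_sided_ideal R"
  shows "x - z \<in> two_sided_ideal R"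
  using two_sided_ideal.add[OF assms] by simp

lemma two_sided_ideal_scaleq:
  fixes x :: "'a::superalgebra"
  assumes "x \<in> two_sided_ideal R"
  shows "c *\<^sub>q x \<in> two_sided_ideal R"
  using two_sided_ideal_mult_left[OF assms, of "c *\<^sub>q 1"] by (simp add: scaleq_mult_left)

lemma hpart_mult_expand:
  fixes x y :: "'a::super_ring"
  shows "hpart p (x * y) = hpart p x * hpart 0 y + hpart (p + 1) x * hpart 1 y"
proof -
  have *: "hpart r (hpart s x * hpart t y) = (if r = s + t then hpart s x * hpart t y else 0)" for r s t
    using hpart_mult[of s t x y] hpart_hpart[of r "s + t" "hpart s x * hpart t y"] by auto
  have "x * y = (hpart 0 x + hpart 1 x) * (hpart 0 y + hpart 1 y)"
    by (simp add: hpart_sum)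
  then show ?thesis
    using bit_disj[of p] by (auto simp: distrib_left distrib_right hpart_add *)
qed

lemma two_sided_ideal_hpart:
  fixes x :: "'a::super_ring"
  assumes hom: "\<And>x. x \<in> R \<Longrightarrow> \<exists>p. hpart p x = x" and x: "x \<in> two_sided_ideal R"
  shows "hpart p x \<in> two_sided_ideal R"
  using x
proof (induction arbitrary: p)
  case (base x)
  then obtain p' where "hpart p' x = x" using hom by blast
  then show ?case
    using base homogeneous_unique[of p' x p] two_sided_ideal.base[of x R] two_sided_ideal.zero[of R]
    by (cases "p = p'") auto
next
  case (mult x a b)
  then show ?case
    by (simp add: hpart_mult_expand two_sided_ideal.add two_sided_ideal.mult
        distrib_left distrib_right)
qed (auto simp: hpart_add two_sided_ideal.zero two_sided_ideal.add)

quotient_type (overloaded) 'g presented = "'g::presentation free_alg" /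
  "\<lambda>x y. x - y \<in> two_sided_ideal relators"
proof (rule equivpI)
  show "reflp (\<lambda>x y. x - y \<in> two_sided_ideal (relators :: 'g free_alg set))"
    by (simp add: reflp_def two_sided_ideal.zero)
  show "symp (\<lambda>x y. x - y \<in> two_sided_ideal (relators :: 'g free_alg set))"
    unfolding symp_def by (auto dest: two_sided_ideal_uminus)
  show "transp (\<lambda>x y. x - y \<in> two_sided_ideal (relators :: 'g free_alg set))"
    unfolding transp_def by (blast intro: two_sided_ideal_trans)
qed



lemma ideal_mult_cong:
  fixes x y :: "'a::{ring,monoid_mult}"
  assumes "x - x' \<in> two_sided_ideal R" "y - y' \<in> two_sided_ideal R"
  shows "x * y - x' * y' \<in> two_sided_ideal R"
proof -
  have "x * y - x' * y' = (x - x') * y + x' * (y - y')"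
    by (simp add: algebra_simps)
  then show ?thesis
    using assms by (simp add: two_sided_ideal.add two_sided_ideal_mult_left two_sided_ideal_mult_right)
qed

instantiation presented :: (presentation) superalgebra
begin

lift_definition zero_presented :: "'a presented" is 0 .
lift_definition one_presented :: "'a presented" is 1 .
lift_definition plus_presented :: "'a presented \<Rightarrow> 'a presented \<Rightarrow> 'a presented" is "(+)"
  by (metis two_sided_ideal.add add_diff_add)
lift_definition minus_presented :: "'a presented \<Rightarrow> 'a presented \<Rightarrow> 'a presented" is "(-)"
  by (drule (1) two_sided_ideal_diff) (simp add: algebra_simps)
lift_definition uminus_presented :: "'a presented \<Rightarrow> 'a presented" is uminus
  by (metis two_sided_ideal_uminus minus_diff_minus)
lift_definition times_presented :: "'a presented \<Rightarrow> 'a presented \<Rightarrow> 'a presented" is "(*)"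
  by (rule ideal_mult_cong)
lift_definition scaleq_presented :: "Cq \<Rightarrow> 'a presented \<Rightarrow> 'a presented" is "(*\<^sub>q)"
  by (simp add: two_sided_ideal_scaleq flip: Cq_space.scale_right_diff_distrib)
lift_definition hpart_presented :: "bit \<Rightarrow> 'a presented \<Rightarrow> 'a presented" is hpart
  by (simp add: two_sided_ideal_hpart relators_hpart flip: hpart_diff)

instance
proof
  fix x y z :: "'a presented" and c d :: Cq and p p' :: bit
  have zeroI: "x = y \<Longrightarrow> x - y \<in> two_sided_ideal relators" for x y :: "'a free_alg"
    by (simp add: two_sided_ideal.zero)
  show "x + y + z = x + (y + z)" "x + y = y + x" "0 + x = x" "- x + x = 0" "x - y = x + - y"
    "x * y * z = x * (y * z)" "1 * x = x" "x * 1 = x"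
    by (transfer; rule zeroI; simp add: mult.assoc add.assoc add.commute)+
  show "(x + y) * z = x * z + y * z" "x * (y + z) = x * y + x * z"
    by (transfer; rule zeroI; simp add: distrib_left distrib_right)+
  show "c *\<^sub>q (x + y) = c *\<^sub>q x + c *\<^sub>q y"
    by transfer (rule zeroI, rule scaleq_add_right)
  show "(c + d) *\<^sub>q x = c *\<^sub>q x + d *\<^sub>q x"
    by transfer (rule zeroI, rule scaleq_add_left)
  show "c *\<^sub>q d *\<^sub>q x = (c * d) *\<^sub>q x"
    by transfer (rule zeroI, rule scaleq_scaleq)
  show "1 *\<^sub>q x = x"
    by transfer (rule zeroI, rule scaleq_one)
  show "(c *\<^sub>q x) * y = c *\<^sub>q (x * y)"
    by transfer (rule zeroI, rule scaleq_mult_left)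
  show "x * (c *\<^sub>q y) = c *\<^sub>q (x * y)"
    by transfer (rule zeroI, rule scaleq_mult_right)
  show "hpart p (x + y) = hpart p x + hpart p y"
    by transfer (rule zeroI, rule hpart_add)
  show "hpart p (hpart p' x) = (if p = p' then hpart p x else 0)"
    by (cases "p = p'"; simp; transfer; rule zeroI; simp add: hpart_hpart)
  show "hpart 0 x + hpart 1 x = x"
    by transfer (rule zeroI, rule hpart_sum)
  show "hpart 0 1 = (1 :: 'a presented)"
    by transfer (rule zeroI, rule hpart_one)
  show "hpart (p + p') (hpart p x * hpart p' y) = hpart p x * hpart p' y"
    by transfer (rule zeroI, rule hpart_mult)
  show "hpart p (c *\<^sub>q x) = c *\<^sub>q hpart p x"
    by transfer (rule zeroI, rule hpart_scaleq)
qed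

end

lift_definition pgen :: "'g::presentation \<Rightarrow> 'g presented" is gen .

section \<open>Tensor products\<close>

text \<open>The tensor product is the free vector space on pairs modulo the span of the bilinearity
  relations.\<close>

definition fscale :: "Cq \<Rightarrow> ('a \<Rightarrow>\<^sub>0 Cq) \<Rightarrow> ('a \<Rightarrow>\<^sub>0 Cq)" where
  "fscale c = Poly_Mapping.map ((*) c)"

lemma lookup_fscale [simp]: "Poly_Mapping.lookup (fscale c x) k = c * Poly_Mapping.lookup x k"
  by (simp add: fscale_def Poly_Mapping.map.rep_eq when_def)

interpretation fspace: vector_space fscale
  by unfold_locales (auto intro!: poly_mapping_eqI simp: lookup_add algebra_simps)

inductive_set bilin_relators :: "('a::Cq_space \<times> 'b::Cq_space \<Rightarrow>\<^sub>0 Cq) set" where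
  add_left: "Poly_Mapping.single (a + a', b) 1
    - (Poly_Mapping.single (a, b) 1 + Poly_Mapping.single (a', b) 1) \<in> bilin_relators"
| add_right: "Poly_Mapping.single (a, b + b') 1
    - (Poly_Mapping.single (a, b) 1 + Poly_Mapping.single (a, b') 1) \<in> bilin_relators"
| scale_left: "Poly_Mapping.single (c *\<^sub>q a, b) 1
    - fscale c (Poly_Mapping.single (a, b) 1) \<in> bilin_relators"
| scale_right: "Poly_Mapping.single (a, c *\<^sub>q b) 1
    - fscale c (Poly_Mapping.single (a, b) 1) \<in> bilin_relators"

abbreviation bilin_null :: "('a::Cq_space \<times> 'b::Cq_space \<Rightarrow>\<^sub>0 Cq) set" where
  "bilin_null \<equiv> fspace.span bilin_relators"

quotient_type (overloaded) ('a, 'b) tensor  (infixr "\<otimes>\<^sub>q" 21) =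
  "'a::Cq_space \<times> 'b::Cq_space \<Rightarrow>\<^sub>0 Cq" / "\<lambda>x y. x - y \<in> bilin_null"
proof (rule equivpI)
  show "reflp (\<lambda>x y. x - y \<in> (bilin_null :: ('a \<times> 'b \<Rightarrow>\<^sub>0 Cq) set))"
    by (simp add: reflp_def fspace.span_zero)
  show "symp (\<lambda>x y. x - y \<in> (bilin_null :: ('a \<times> 'b \<Rightarrow>\<^sub>0 Cq) set))"
    unfolding symp_def by (auto dest: fspace.span_neg)
  show "transp (\<lambda>x y. x - y \<in> (bilin_null :: ('a \<times> 'b \<Rightarrow>\<^sub>0 Cq) set))"
    unfolding transp_def using fspace.span_add by fastforce
qed

instantiation tensor :: (Cq_space, Cq_space) Cq_space
begin

definition zero_tensor :: "('a \<otimes>\<^sub>q 'b)" where "0 = abs_tensor 0"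
definition plus_tensor :: "('a \<otimes>\<^sub>q 'b) \<Rightarrow> ('a \<otimes>\<^sub>q 'b) \<Rightarrow> ('a \<otimes>\<^sub>q 'b)" where
  "x + y = abs_tensor (rep_tensor x + rep_tensor y)"
definition minus_tensor :: "('a \<otimes>\<^sub>q 'b) \<Rightarrow> ('a \<otimes>\<^sub>q 'b) \<Rightarrow> ('a \<otimes>\<^sub>q 'b)" where
  "x - y = abs_tensor (rep_tensor x - rep_tensor y)"
definition uminus_tensor :: "('a \<otimes>\<^sub>q 'b) \<Rightarrow> ('a \<otimes>\<^sub>q 'b)" where
  "- x = abs_tensor (- rep_tensor x)"
definition scaleq_tensor :: "Cq \<Rightarrow> ('a \<otimes>\<^sub>q 'b) \<Rightarrow> ('a \<otimes>\<^sub>q 'b)" where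
  "c *\<^sub>q x = abs_tensor (fscale c (rep_tensor x))"

lemma abs_tensor_eq_iff:
  "abs_tensor x = abs_tensor y \<longleftrightarrow> x - y \<in> (bilin_null :: ('c::Cq_space \<times> 'd::Cq_space \<Rightarrow>\<^sub>0 Cq) set)"
  using tensor.abs_eq_iff by blast

lemma rep_abs_tensor:
  "rep_tensor (abs_tensor x) - x \<in> (bilin_null :: ('c::Cq_space \<times> 'd::Cq_space \<Rightarrow>\<^sub>0 Cq) set)"
  by (metis abs_tensor_eq_iff Quotient3_abs_rep[OF Quotient3_tensor])

lemma abs_rep_tensor: "abs_tensor (rep_tensor x) = x"
  by (rule Quotient3_abs_rep[OF Quotient3_tensor])

lemma plus_abs_tensor: "(abs_tensor x + abs_tensor y :: 'a \<otimes>\<^sub>q 'b) = abs_tensor (x + y)"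
  unfolding plus_tensor_def abs_tensor_eq_iff
  using fspace.span_add[OF rep_abs_tensor[of x] rep_abs_tensor[of y]] by (simp add: algebra_simps)

lemma minus_abs_tensor: "(abs_tensor x - abs_tensor y :: 'a \<otimes>\<^sub>q 'b) = abs_tensor (x - y)"
  unfolding minus_tensor_def abs_tensor_eq_iff
  using fspace.span_diff[OF rep_abs_tensor[of x] rep_abs_tensor[of y]] by (simp add: algebra_simps)

lemma uminus_abs_tensor: "(- abs_tensor x :: 'a \<otimes>\<^sub>q 'b) = abs_tensor (- x)"
  unfolding uminus_tensor_def abs_tensor_eq_iff
  using fspace.span_neg[OF rep_abs_tensor[of x]] by (simp add: algebra_simps)

lemma scaleq_abs_tensor: "(c *\<^sub>q abs_tensor x :: 'a \<otimes>\<^sub>q 'b) = abs_tensor (fscale c x)"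
  unfolding scaleq_tensor_def abs_tensor_eq_iff
  using fspace.span_scale[OF rep_abs_tensor[of x], of c] by (simp add: fspace.scale_right_diff_distrib)

instance
proof
  fix x y z :: "'a \<otimes>\<^sub>q 'b" and c d :: Cq
  obtain u v w where uvw: "x = abs_tensor u" "y = abs_tensor v" "z = abs_tensor w"
    by (metis abs_rep_tensor)
  note s = uvw zero_tensor_def plus_abs_tensor minus_abs_tensor uminus_abs_tensor scaleq_abs_tensor
  show "x + y + z = x + (y + z)" "x + y = y + x" "0 + x = x" "- x + x = 0" "x - y = x + - y"
    by (simp_all add: s ac_simps)
  show "c *\<^sub>q (x + y) = c *\<^sub>q x + c *\<^sub>q y" "(c + d) *\<^sub>q x = c *\<^sub>q x + d *\<^sub>q x"
    "c *\<^sub>q d *\<^sub>q x = (c * d) *\<^sub>q x" "1 *\<^sub>q x = x"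
    by (simp_all add: s fspace.scale_right_distrib fspace.scale_left_distrib)
qed

end

definition tensor_pure :: "'a::Cq_space \<Rightarrow> 'b::Cq_space \<Rightarrow> ('a \<otimes>\<^sub>q 'b)"  (infixr "\<otimes>" 75) where
  "a \<otimes> b = abs_tensor (Poly_Mapping.single (a, b) 1)"

text \<open>\<open>tensor_lift f\<close> is the linear map $a\otimes b\mapsto f(a,b)$; this is meaningful for bilinear
  \<open>f\<close> only, as it is computed on an arbitrary representative.\<close>

definition tensor_lift :: "('a::Cq_space \<Rightarrow> 'b::Cq_space \<Rightarrow> 'c::Cq_space) \<Rightarrow> ('a \<otimes>\<^sub>q 'b) \<Rightarrow> 'c" where
  "tensor_lift f x =
     (\<Sum>(a, b)\<in>Poly_Mapping.keys (rep_tensor x). Poly_Mapping.lookup (rep_tensor x) (a, b) *\<^sub>q f a b)"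

definition bilinear_q :: "('a::Cq_space \<Rightarrow> 'b::Cq_space \<Rightarrow> 'c::Cq_space) \<Rightarrow> bool" where
  "bilinear_q f \<longleftrightarrow> (\<forall>b. Cq_linear (\<lambda>a. f a b)) \<and> (\<forall>a. Cq_linear (f a))"

lemma Cq_linearI:
  assumes "\<And>x y. f (x + y) = f x + f y" "\<And>c x. f (c *\<^sub>q x) = c *\<^sub>q f x"
  shows "Cq_linear f"
  using assms by unfold_locales auto

lemma Cq_linear_add: "Cq_linear f \<Longrightarrow> f (x + y) = f x + f y"
  by (rule module_hom.add[OF Vector_Spaces.linear.axioms(3)])

lemma Cq_linear_scaleq: "Cq_linear f \<Longrightarrow> f (c *\<^sub>q x) = c *\<^sub>q f x"
  by (rule module_hom.scale[OF Vector_Spaces.linear.axioms(3)])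

lemma bilinear_qD:
  assumes "bilinear_q f"
  shows "f (a + a') b = f a b + f a' b" "f (c *\<^sub>q a) b = c *\<^sub>q f a b"
    "f a (b + b') = f a b + f a b'" "f a (c *\<^sub>q b) = c *\<^sub>q f a b"
  using assms Cq_linear_add[of "\<lambda>a. f a b"] Cq_linear_scaleq[of "\<lambda>a. f a b"]
    Cq_linear_add[of "f a"] Cq_linear_scaleq[of "f a"]
  by (auto simp: bilinear_q_def)

lemma bilinear_qI:
  assumes "\<And>a a' b. f (a + a') b = f a b + f a' b" "\<And>c a b. f (c *\<^sub>q a) b = c *\<^sub>q f a b"
    "\<And>a b b'. f a (b + b') = f a b + f a b'" "\<And>c a b. f a (c *\<^sub>q b) = c *\<^sub>q f a b"
  shows "bilinear_q f"
  unfolding bilinear_q_def using assms by (auto intro!: Cq_linearI)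

lemma bilinear_q_add:
  assumes "bilinear_q f" "bilinear_q g"
  shows "bilinear_q (\<lambda>a b. f a b + g a b)"
  by (rule bilinear_qI)
    (simp_all only: bilinear_qD[OF assms(1)] bilinear_qD[OF assms(2)] scaleq_add_right ac_simps)

lemma tensor_pure_bilinear: "bilinear_q ((\<otimes>) :: 'a::Cq_space \<Rightarrow> 'b::Cq_space \<Rightarrow> _)"
proof (rule bilinear_qI)
  fix a a' :: 'a and b b' :: 'b and c :: Cq
  show "(a + a') \<otimes> b = a \<otimes> b + a' \<otimes> b" "a \<otimes> (b + b') = a \<otimes> b + a \<otimes> b'"
    "(c *\<^sub>q a) \<otimes> b = c *\<^sub>q (a \<otimes> b)" "a \<otimes> (c *\<^sub>q b) = c *\<^sub>q (a \<otimes> b)"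
    unfolding tensor_pure_def plus_abs_tensor scaleq_abs_tensor abs_tensor_eq_iff
    by (rule fspace.span_base, rule bilin_relators.intros)+
qed

lemmas tensor_pure_simps = bilinear_qD[OF tensor_pure_bilinear]

definition fsum :: "('a \<times> 'b \<Rightarrow> 'c::Cq_space) \<Rightarrow> ('a \<times> 'b \<Rightarrow>\<^sub>0 Cq) \<Rightarrow> 'c" where
  "fsum g x = (\<Sum>k\<in>Poly_Mapping.keys x. Poly_Mapping.lookup x k *\<^sub>q g k)"

lemma fsum_superset:
  assumes "finite A" "Poly_Mapping.keys x \<subseteq> A"
  shows "fsum g x = (\<Sum>k\<in>A. Poly_Mapping.lookup x k *\<^sub>q g k)"
  unfolding fsum_def using assms by (intro sum.mono_neutral_left) (auto simp: in_keys_iff)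

lemma fsum_linear:
  fixes g :: "'a \<times> 'b \<Rightarrow> 'c::Cq_space"
  shows "Vector_Spaces.linear fscale (*\<^sub>q) (fsum g)"
proof unfold_locales
  fix x y :: "'a \<times> 'b \<Rightarrow>\<^sub>0 Cq" and c :: Cq
  let ?A = "Poly_Mapping.keys x \<union> Poly_Mapping.keys y"
  have "fsum g (x + y) = (\<Sum>k\<in>?A. Poly_Mapping.lookup (x + y) k *\<^sub>q g k)"
    using keys_add[of x y] by (intro fsum_superset) auto
  also have "\<dots> = fsum g x + fsum g y"
    by (simp add: fsum_superset[of ?A] lookup_add scaleq_add_left sum.distrib)
  finally show "fsum g (x + y) = fsum g x + fsum g y" .
  have "fsum g (fscale c x) = (\<Sum>k\<in>Poly_Mapping.keys x. Poly_Mapping.lookup (fscale c x) k *\<^sub>q g k)"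
    by (intro fsum_superset) (auto simp: in_keys_iff)
  also have "\<dots> = c *\<^sub>q fsum g x"
    by (simp add: fsum_def Cq_space.scale_sum_right)
  finally show "fsum g (fscale c x) = c *\<^sub>q fsum g x" .
qed

lemma fsum_single [simp]: "fsum g (Poly_Mapping.single k c) = c *\<^sub>q g k"
  by (subst fsum_superset[of "{k}"]) auto

lemma fsum_bilin_null:
  fixes f :: "'a::Cq_space \<Rightarrow> 'b::Cq_space \<Rightarrow> 'c::Cq_space"
  assumes "bilinear_q f" "x \<in> bilin_null"
  shows "fsum (\<lambda>(a, b). f a b) x = 0"
proof -
  interpret L: Vector_Spaces.linear fscale scaleq "fsum (\<lambda>(a, b). f a b)"
    by (rule fsum_linear)
  show ?thesis
    using assms(2)
  proof (rule fspace.span_induct_alt)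
    fix c and x y :: "'a \<times> 'b \<Rightarrow>\<^sub>0 Cq"
    assume "x \<in> bilin_relators" "fsum (\<lambda>(a, b). f a b) y = 0"
    then show "fsum (\<lambda>(a, b). f a b) (fscale c x + y) = 0"
      by cases (simp_all add: L.add L.diff L.scale fsum_single bilinear_qD[OF assms(1)] scaleq_one)
  qed (simp add: L.zero)
qed

lemma tensor_lift_abs:
  assumes "bilinear_q f"
  shows "tensor_lift f (abs_tensor x) = fsum (\<lambda>(a, b). f a b) x"
proof -
  interpret L: Vector_Spaces.linear fscale scaleq "fsum (\<lambda>(a, b). f a b)"
    by (rule fsum_linear)
  have "tensor_lift f (abs_tensor x) = fsum (\<lambda>(a, b). f a b) (rep_tensor (abs_tensor x))"
    unfolding tensor_lift_def fsum_def by (intro sum.cong) auto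
  then show ?thesis
    using fsum_bilin_null[OF assms rep_abs_tensor[of x]] by (simp add: L.diff)
qed

lemma tensor_lift_pure [simp]: "bilinear_q f \<Longrightarrow> tensor_lift f (a \<otimes> b) = f a b"
  by (simp add: tensor_pure_def tensor_lift_abs fsum_single)

lemma tensor_lift_linear:
  assumes "bilinear_q f"
  shows "Cq_linear (tensor_lift f)"
proof -
  interpret L: Vector_Spaces.linear fscale scaleq "fsum (\<lambda>(a, b). f a b)"
    by (rule fsum_linear)
  show ?thesis
  proof (rule Cq_linearI)
    fix x y :: "'a \<otimes>\<^sub>q 'b" and c
    obtain u v where "x = abs_tensor u" "y = abs_tensor v"
      by (metis abs_rep_tensor)
    then show "tensor_lift f (x + y) = tensor_lift f x + tensor_lift f y"
      "tensor_lift f (c *\<^sub>q x) = c *\<^sub>q tensor_lift f x"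
      by (simp_all add: plus_abs_tensor scaleq_abs_tensor tensor_lift_abs[OF assms] L.add L.scale)
  qed
qed

lemmas tensor_lift_add = Cq_linear_add[OF tensor_lift_linear]
  and tensor_lift_scaleq = Cq_linear_scaleq[OF tensor_lift_linear]

lemma tensor_induct [case_names pure add, induct type: tensor]:
  fixes x :: "'a::Cq_space \<otimes>\<^sub>q 'b::Cq_space"
  assumes pure: "\<And>a b. P (a \<otimes> b)" and add: "\<And>x y. P x \<Longrightarrow> P y \<Longrightarrow> P (x + y)"
  shows "P x"
proof -
  have "P (abs_tensor u)" for u
  proof (induction u rule: poly_mapping_additive_induct)
    case (single w c)
    have "abs_tensor (Poly_Mapping.single w c) = c *\<^sub>q (fst w \<otimes> snd w)"
      by (simp add: tensor_pure_def scaleq_abs_tensor fscale_def)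
    also have "\<dots> = (c *\<^sub>q fst w) \<otimes> snd w"
      by (simp add: tensor_pure_simps)
    finally show ?case using pure by simp
  next
    case (add u v)
    then show ?case using assms(2) by (simp flip: plus_abs_tensor)
  qed
  then show ?thesis by (metis abs_rep_tensor)
qed


lemma sgn_pow_simps [simp]: "sgn_pow 0 = 1" "sgn_pow 1 = - 1"
  by (simp_all add: sgn_pow_def)

lemma sgn_pow_add: "sgn_pow (d + e) = (sgn_pow d * sgn_pow e :: 'a::{ring,monoid_mult})"
  using bit_disj[of d] bit_disj[of e] by auto

lemma twist_add: "twist d (x + y) = twist d x + twist d y"
  by (simp add: twist_def hpart_add distrib_left)

lemma twist_scaleq: "twist d (c *\<^sub>q x) = c *\<^sub>q twist d (x :: 'a::superalgebra)"
  by (simp add: twist_def hpart_scaleq scaleq_mult_right scaleq_add_right)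

instantiation tensor :: (superspace, superspace) superspace
begin

definition hpart_tensor :: "bit \<Rightarrow> ('a \<otimes>\<^sub>q 'b) \<Rightarrow> ('a \<otimes>\<^sub>q 'b)" where
  "hpart p = tensor_lift (\<lambda>a b. hpart 0 a \<otimes> hpart p b + hpart 1 a \<otimes> hpart (p + 1) b)"

lemma hpart_tensor_bilinear:
  "bilinear_q (\<lambda>(a::'c::superspace) (b::'d::superspace).
     hpart 0 a \<otimes> hpart p b + hpart 1 a \<otimes> hpart (p + 1) b)"
  by (rule bilinear_qI)
    (simp_all add: hpart_add hpart_scaleq tensor_pure_simps scaleq_add_right algebra_simps)

lemma hpart_tensor_pure:
  "hpart p (a \<otimes> b :: 'a \<otimes>\<^sub>q 'b) = hpart 0 a \<otimes> hpart p b + hpart 1 a \<otimes> hpart (p + 1) b"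
  unfolding hpart_tensor_def by (rule tensor_lift_pure[OF hpart_tensor_bilinear])

lemma hpart_tensor_add: "hpart p (x + y :: 'a \<otimes>\<^sub>q 'b) = hpart p x + hpart p y"
  unfolding hpart_tensor_def by (rule tensor_lift_add[OF hpart_tensor_bilinear])

lemma tensor_pure_zero [simp]:
  "(0::'c::Cq_space) \<otimes> (b::'d::Cq_space) = 0" "(a::'c) \<otimes> (0::'d) = 0"
  using tensor_pure_simps(1)[of "0::'c" 0 b] tensor_pure_simps(3)[of a "0::'d" 0] by simp_all

lemma hpart_tensor_homogeneous:
  assumes "hpart p a = a" "hpart p' b = b"
  shows "hpart r (a \<otimes> b :: 'a \<otimes>\<^sub>q 'b) = (if r = p + p' then a \<otimes> b else 0)"
  using assms homogeneous_unique[OF assms(1)] homogeneous_unique[OF assms(2)]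
    bit_disj[of p] bit_disj[of p'] bit_disj[of r]
  by (auto simp: hpart_tensor_pure)

lemma tensor_homogeneous_induct [case_names pure add]:
  fixes x :: "'a \<otimes>\<^sub>q 'b"
  assumes pure: "\<And>p p' a b. hpart p a = a \<Longrightarrow> hpart p' b = b \<Longrightarrow> P (a \<otimes> b)"
    and add: "\<And>x y. P x \<Longrightarrow> P y \<Longrightarrow> P (x + y)"
  shows "P x"
proof (induction x)
  case (pure a b)
  have "P ((hpart 0 a + hpart 1 a) \<otimes> (hpart 0 b + hpart 1 b))"
    unfolding tensor_pure_simps by (intro add assms(1)) (auto simp: hpart_hpart)
  then show ?case by (simp add: hpart_sum)
qed (rule add)

instance
proof
  fix x y :: "'a \<otimes>\<^sub>q 'b" and c :: Cq and p p' :: bit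
  show "hpart p (x + y) = hpart p x + hpart p y"
    by (rule hpart_tensor_add)
  show "hpart p (c *\<^sub>q x) = c *\<^sub>q hpart p x"
    unfolding hpart_tensor_def by (rule tensor_lift_scaleq[OF hpart_tensor_bilinear])
  have zero: "hpart p 0 = (0 :: 'a \<otimes>\<^sub>q 'b)" for p
    using hpart_tensor_add[of p 0 0] by simp
  show "hpart p (hpart p' x) = (if p = p' then hpart p x else 0)"
  proof (induction x rule: tensor_homogeneous_induct)
    case (pure p p' a b)
    then show ?case by (simp add: hpart_tensor_homogeneous zero)
  qed (auto simp: hpart_tensor_add)
  show "hpart 0 x + hpart 1 x = x"
  proof (induction x rule: tensor_homogeneous_induct)
    case (pure p p' a b)
    then show ?case
      using bit_disj[of "p + p'"] by (auto simp: hpart_tensor_homogeneous)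
  next
    case (add x y)
    then show ?case by (metis (no_types, lifting) hpart_tensor_add add.assoc add.left_commute)
  qed
qed

end

text \<open>The product is $(a\otimes b)(a'\otimes b')=(-1)^{|b||a'|}\,aa'\otimes bb'$, with \<open>b\<close> split into
  its homogeneous components.\<close>

instantiation tensor :: (superalgebra, superalgebra) superalgebra
begin

definition one_tensor :: "('a \<otimes>\<^sub>q 'b)" where "1 = 1 \<otimes> 1"

definition times_tensor :: "('a \<otimes>\<^sub>q 'b) \<Rightarrow> ('a \<otimes>\<^sub>q 'b) \<Rightarrow> ('a \<otimes>\<^sub>q 'b)" where
  "x * y = tensor_lift (\<lambda>a b. tensor_lift (\<lambda>a' b'.
     (a * twist 0 a') \<otimes> (hpart 0 b * b') + (a * twist 1 a') \<otimes> (hpart 1 b * b')) y) x"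

lemma times_tensor_bilinear1:
  "bilinear_q (\<lambda>(a'::'c::superalgebra) (b'::'d::superalgebra).
     (a * twist 0 a') \<otimes> (hpart 0 b * b') + (a * twist 1 a') \<otimes> (hpart 1 b * b'))"
  by (rule bilinear_qI)
    (simp_all add: twist_add twist_scaleq distrib_left scaleq_mult_right tensor_pure_simps
       scaleq_add_right algebra_simps)

lemma times_tensor_bilinear2:
  "bilinear_q (\<lambda>(a::'c::superalgebra) (b::'d::superalgebra). tensor_lift (\<lambda>a' b'.
     (a * twist 0 a') \<otimes> (hpart 0 b * b') + (a * twist 1 a') \<otimes> (hpart 1 b * b')) y)"
proof (induction y)
  case (pure a' b')
  show ?case
    unfolding tensor_lift_pure[OF times_tensor_bilinear1]
    by (rule bilinear_qI)
      (simp_all add: hpart_add hpart_scaleq distrib_right scaleq_mult_left tensor_pure_simps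
         scaleq_add_right algebra_simps)
next
  case (add x y)
  show ?case
    unfolding tensor_lift_add[OF times_tensor_bilinear1] by (rule bilinear_q_add[OF add])
qed

lemma times_tensor_pure_left:
  "(a \<otimes> b) * (y :: 'a \<otimes>\<^sub>q 'b) = tensor_lift (\<lambda>a' b'.
     (a * twist 0 a') \<otimes> (hpart 0 b * b') + (a * twist 1 a') \<otimes> (hpart 1 b * b')) y"
  unfolding times_tensor_def by (rule tensor_lift_pure[OF times_tensor_bilinear2])

lemma times_tensor_pure:
  "(a \<otimes> b) * (a' \<otimes> b') =
     ((a * twist 0 a') \<otimes> (hpart 0 b * b') + (a * twist 1 a') \<otimes> (hpart 1 b * b') :: 'a \<otimes>\<^sub>q 'b)"
  unfolding times_tensor_pure_left by (rule tensor_lift_pure[OF times_tensor_bilinear1])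

lemma times_tensor_add_left: "(x + y) * z = x * z + y * (z :: 'a \<otimes>\<^sub>q 'b)"
  unfolding times_tensor_def by (rule tensor_lift_add[OF times_tensor_bilinear2])

lemma times_tensor_scaleq_left: "(c *\<^sub>q x) * y = c *\<^sub>q (x * (y :: 'a \<otimes>\<^sub>q 'b))"
  unfolding times_tensor_def by (rule tensor_lift_scaleq[OF times_tensor_bilinear2])

lemma times_tensor_add_right: "x * (y + z) = x * y + x * (z :: 'a \<otimes>\<^sub>q 'b)"
proof (induction x)
  case (pure a b)
  show ?case
    unfolding times_tensor_pure_left by (rule tensor_lift_add[OF times_tensor_bilinear1])
qed (simp add: times_tensor_add_left ac_simps)

lemma times_tensor_scaleq_right: "x * (c *\<^sub>q y) = c *\<^sub>q (x * (y :: 'a \<otimes>\<^sub>q 'b))"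
proof (induction x)
  case (pure a b)
  show ?case
    unfolding times_tensor_pure_left by (rule tensor_lift_scaleq[OF times_tensor_bilinear1])
qed (simp add: times_tensor_add_left scaleq_add_right)

lemma sgn_pow_scaleq: "sgn_pow d * x = sgn_pow d *\<^sub>q (x :: 'c::superalgebra)"
  using bit_disj[of d] by (auto simp: scaleq_one)

lemma times_tensor_homogeneous:
  assumes "hpart r b = b" "hpart p a' = a'"
  shows "(a \<otimes> b) * (a' \<otimes> b') = (sgn_pow (r * p) *\<^sub>q ((a * a') \<otimes> (b * b')) :: 'a \<otimes>\<^sub>q 'b)"
proof -
  have "twist d a' = sgn_pow (p * d) *\<^sub>q a'" for d
    by (simp add: twist_homogeneous[OF assms(2)] sgn_pow_scaleq)
  then show ?thesis
    using bit_disj[of r] assms(1) homogeneous_unique[OF assms(1)]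
    by (auto simp: times_tensor_pure scaleq_mult_right tensor_pure_simps scaleq_one)
qed

instance
proof
  fix x y z :: "'a \<otimes>\<^sub>q 'b" and c :: Cq and p p' :: bit
  show "(x + y) * z = x * z + y * z" "x * (y + z) = x * y + x * z"
    "(c *\<^sub>q x) * y = c *\<^sub>q (x * y)" "x * (c *\<^sub>q y) = c *\<^sub>q (x * y)"
    by (fact times_tensor_add_left times_tensor_add_right times_tensor_scaleq_left
        times_tensor_scaleq_right)+
  note add = times_tensor_add_left times_tensor_add_right hpart_add
  show "x * y * z = x * (y * z)"
  proof (induction x rule: tensor_homogeneous_induct)
    case (pure p r a b)
    note x = pure
    show ?case
    proof (induction y rule: tensor_homogeneous_induct)
      case (pure p' r' a' b')
      note y = pure
      show ?case
      proof (induction z rule: tensor_homogeneous_induct)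
        case (pure p'' r'' a'' b'')
        show ?case
          by (simp add: times_tensor_homogeneous[OF x(2) y(1)] times_tensor_homogeneous[OF y(2) pure(1)]
              times_tensor_homogeneous[OF x(2) homogeneous_mult[OF y(1) pure(1)]]
              times_tensor_homogeneous[OF homogeneous_mult[OF x(2) y(2)] pure(1)]
              times_tensor_scaleq_left times_tensor_scaleq_right scaleq_scaleq sgn_pow_add
              distrib_left distrib_right mult.assoc ac_simps)
      qed (simp add: add)
    qed (simp add: add)
  qed (simp add: add)
  have hpart_one': "hpart 0 (1::'c::super_ring) = 1" "hpart 1 (1::'c) = 0"
    using hpart_one homogeneous_unique[OF hpart_one, of 1] by simp_all
  show "1 * x = x"
    by (induction x) (simp_all add: one_tensor_def add times_tensor_pure hpart_one' twist_def hpart_sum)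
  show "x * 1 = x"
    by (induction x)
      (simp_all add: one_tensor_def add times_tensor_pure hpart_one' twist_def hpart_sum
        flip: tensor_pure_simps)
  show "hpart 0 1 = (1 :: 'a \<otimes>\<^sub>q 'b)"
    by (simp add: one_tensor_def hpart_tensor_pure hpart_one')
  show "hpart (p + p') (hpart p x * hpart p' y) = hpart p x * hpart p' y"
  proof (induction x rule: tensor_homogeneous_induct)
    case (pure s t a b)
    note x = pure
    show ?case
    proof (induction y rule: tensor_homogeneous_induct)
      case (pure s' t' a' b')
      have *: "hpart r ((a * a') \<otimes> (b * b')) =
          (if r = (s + s') + (t + t') then (a * a') \<otimes> (b * b') else 0)" for r
        by (rule hpart_tensor_homogeneous; rule homogeneous_mult; fact)
      have "(0 :: 'a \<otimes>\<^sub>q 'b) * w = 0" "w * (0 :: 'a \<otimes>\<^sub>q 'b) = 0" for w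
        using times_tensor_add_left[of 0 0 w] times_tensor_add_right[of w 0 0] by simp_all
      then show ?case
        by (auto simp: hpart_tensor_homogeneous[OF x] hpart_tensor_homogeneous[OF pure]
            times_tensor_homogeneous[OF x(2) pure(1)] hpart_scaleq * ac_simps)
    qed (simp add: add)
  qed (simp add: add)
qed

end

text \<open>There is no sign in \<open>tensor_map\<close>; it is meant for even maps.\<close>

definition tensor_map ::
  "('a::Cq_space \<Rightarrow> 'c::Cq_space) \<Rightarrow> ('b::Cq_space \<Rightarrow> 'd::Cq_space) \<Rightarrow> ('a \<otimes>\<^sub>q 'b) \<Rightarrow> ('c \<otimes>\<^sub>q 'd)" where
  "tensor_map f g = tensor_lift (\<lambda>a b. f a \<otimes> g b)"

definition mul :: "('a::superalgebra \<otimes>\<^sub>q 'a) \<Rightarrow> 'a" where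
  "mul = tensor_lift (*)"

definition assocr :: "(('a::Cq_space \<otimes>\<^sub>q 'b::Cq_space) \<otimes>\<^sub>q 'c::Cq_space) \<Rightarrow> ('a \<otimes>\<^sub>q 'b \<otimes>\<^sub>q 'c)" where
  "assocr = tensor_lift (\<lambda>x c. tensor_lift (\<lambda>a b. a \<otimes> b \<otimes> c) x)"

definition assocl :: "('a::Cq_space \<otimes>\<^sub>q 'b::Cq_space \<otimes>\<^sub>q 'c::Cq_space) \<Rightarrow> (('a \<otimes>\<^sub>q 'b) \<otimes>\<^sub>q 'c)" where
  "assocl = tensor_lift (\<lambda>a y. tensor_lift (\<lambda>b c. (a \<otimes> b) \<otimes> c) y)"

section \<open>The two algebras\<close>

definition mat2_even ::
  "('i::indexed_parity, 'j::indexed_parity, 'k::indexed_parity, 'l::indexed_parity, 'b::super_ring) mat2 \<Rightarrow> bool" where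
  "mat2_even X \<longleftrightarrow> (\<forall>i j k l. hpart (par i + par j + par k + par l) (X i j k l) = X i j k l)"

lemma mat2_even_mult:
  assumes "mat2_even X" "mat2_even Y"
  shows "mat2_even (X \<odot> Y)"
  unfolding mat2_even_def
proof (intro allI)
  fix i m k p
  have "hpart (par i + par m + par k + par p) (twist d (X i j k l) * Y j m l p) =
      twist d (X i j k l) * Y j m l p" for d j l
  proof -
    have X: "hpart (par i + par j + par k + par l) (X i j k l) = X i j k l"
      and Y: "hpart (par j + par m + par l + par p) (Y j m l p) = Y j m l p"
      using assms by (auto simp: mat2_even_def)
    have "(par i + par j + par k + par l) + (par j + par m + par l + par p) =
        par i + par m + par k + par p"
      by (simp add: ac_simps)
    then show ?thesis
      using homogeneous_mult[OF X Y] unfolding twist_homogeneous[OF X] mult.assoc hpart_sgn_pow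
      by (simp only:)
  qed
  then show "hpart (par i + par m + par k + par p) ((X \<odot> Y) i m k p) = (X \<odot> Y) i m k p"
    by (simp add: mat2_mult_def hpart_setsum hpart_sgn_pow)
qed

lemma mat2_even_slot1:
  "(\<And>i j. hpart (par i + par j) (X i j) = X i j) \<Longrightarrow> mat2_even (slot1 X)"
  by (auto simp: mat2_even_def slot1_def add.assoc)

lemma mat2_even_slot2:
  "(\<And>i j. hpart (par i + par j) (X i j) = X i j) \<Longrightarrow> mat2_even (slot2 X)"
  by (auto simp: mat2_even_def slot2_def add.assoc)

lemma mat2_even_S: "mat2_even (mat2_scalar S_mat :: (_, _, _, _, 'b::superalgebra) mat2)"
  unfolding mat2_even_def
proof (intro allI)
  fix i j k l :: "'a sidx"
  have u: "mat_unit2 i' i' j' j' i j k l = 0" "mat_unit2 j' i' i' j' i j k l = 0"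
    "mat_unit2 (- j') (- i') i' j' i j k l = 0" if "par i + par j + par k + par l \<noteq> 0" for i' j'
    using that by (auto simp: mat_unit2_def par_uminus_sidx ac_simps)
  have "S_mat i j k l = 0" if "par i + par j + par k + par l \<noteq> 0"
    by (simp add: S_mat_def u[OF that])
  then show "hpart (par i + par j + par k + par l) (mat2_scalar S_mat i j k l) =
      (mat2_scalar S_mat i j k l :: 'b)"
    by (cases "par i + par j + par k + par l = 0")
      (auto simp: mat2_scalar_def hpart_scaleq hpart_one)
qed

lemma homogeneous_diff:
  "hpart p x = x \<Longrightarrow> hpart p y = y \<Longrightarrow> hpart p (x - y) = (x - y :: 'a::graded_group)"
  by (simp add: hpart_diff)

datatype ('r, 'n) t_gen = T_gen "'r::finite sidx" "'n::finite sidx"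

instantiation t_gen :: (finite, finite) indexed_parity
begin

definition par_t_gen :: "('a, 'b) t_gen \<Rightarrow> bit" where
  "par g = (case g of T_gen i a \<Rightarrow> par i + par a)"

instance ..

end

abbreviation free_t :: "'r::finite sidx \<Rightarrow> 'n::finite sidx \<Rightarrow> ('r, 'n) t_gen free_alg" where
  "free_t i a \<equiv> gen (T_gen i a)"

instantiation t_gen :: (finite, finite) presentation
begin

definition relators_t_gen :: "('a, 'b) t_gen free_alg set" where
  "relators =
     {free_t i a - free_t (- i) (- a) | i a. True} \<union>
     {(mat2_scalar S_mat \<odot> slot1 free_t \<odot> slot2 free_t) i a j b
        - (slot2 free_t \<odot> slot1 free_t \<odot> mat2_scalar S_mat) i a j b | i a j b. True}"

lemma relators_t_gen_homogeneous:
  "x \<in> (relators :: ('a, 'b) t_gen free_alg set) \<Longrightarrow> \<exists>p. hpart p x = x"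
proof -
  have t: "hpart (par i + par a) (free_t i a) = free_t i a" for i :: "'a sidx" and a :: "'b sidx"
    using hpart_gen[of "T_gen i a"] by (simp add: par_t_gen_def)
  have t': "hpart (par i + par a) (free_t (- i) (- a)) = free_t (- i) (- a)" for i :: "'a sidx" and a :: "'b sidx"
    using t[of "- i" "- a"] by (simp add: par_uminus_sidx ac_simps)
  note ev = mat2_even_mult mat2_even_slot1[of free_t, OF t] mat2_even_slot2[of free_t, OF t] mat2_even_S
  assume "x \<in> relators"
  then consider i a where "x = free_t i a - free_t (- i) (- a)"
    | i a j b where "x = (mat2_scalar S_mat \<odot> slot1 free_t \<odot> slot2 free_t) i a j b
        - (slot2 free_t \<odot> slot1 free_t \<odot> mat2_scalar S_mat) i a j b"
    unfolding relators_t_gen_def by blast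
  then show ?thesis
  proof cases
    case 1
    then show ?thesis using homogeneous_diff[OF t t'] by blast
  next
    case 2
    have "mat2_even (mat2_scalar S_mat \<odot> slot1 free_t \<odot> slot2 (free_t :: 'a sidx \<Rightarrow> 'b sidx \<Rightarrow> _))"
      "mat2_even (slot2 free_t \<odot> slot1 (free_t :: 'a sidx \<Rightarrow> 'b sidx \<Rightarrow> _) \<odot> mat2_scalar S_mat)"
      by (intro ev)+
    then show ?thesis
      unfolding 2 mat2_even_def by (blast intro: homogeneous_diff)
  qed
qed

instance
  by standard (rule relators_t_gen_homogeneous[unfolded homogeneous_free_alg_iff word_par_def])

end

datatype ('s, 'n) tbar_gen = Tbar_gen "'s::finite sidx" "'n::finite sidx"

instantiation tbar_gen :: (finite, finite) indexed_parity
begin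

definition par_tbar_gen :: "('a, 'b) tbar_gen \<Rightarrow> bit" where
  "par g = (case g of Tbar_gen i a \<Rightarrow> par i + par a)"

instance ..

end

abbreviation free_tbar :: "'s::finite sidx \<Rightarrow> 'n::finite sidx \<Rightarrow> ('s, 'n) tbar_gen free_alg" where
  "free_tbar \<alpha> b \<equiv> gen (Tbar_gen \<alpha> b)"

text \<open>The matrix $\sum(-1)^{|b|(|\alpha|+|b|)}E_{b\alpha}\otimes x_{\alpha b}$.\<close>

definition bar_mat ::
  "('s::indexed_parity \<Rightarrow> 'n::indexed_parity \<Rightarrow> 'b::super_ring) \<Rightarrow> 'n \<Rightarrow> 's \<Rightarrow> 'b" where
  "bar_mat x b \<alpha> = sgn_pow (par b * (par \<alpha> + par b)) * x \<alpha> b"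

instantiation tbar_gen :: (finite, finite) presentation
begin

definition relators_tbar_gen :: "('a, 'b) tbar_gen free_alg set" where
  "relators =
     {free_tbar \<alpha> b - sgn_pow (par \<alpha> + par b) * free_tbar (- \<alpha>) (- b) | \<alpha> b. True} \<union>
     {(slot1 (bar_mat free_tbar) \<odot> slot2 (bar_mat free_tbar) \<odot> mat2_scalar S_mat) a \<alpha> b \<beta>
        - (mat2_scalar S_mat \<odot> slot2 (bar_mat free_tbar) \<odot> slot1 (bar_mat free_tbar)) a \<alpha> b \<beta>
       | a \<alpha> b \<beta>. True}"

lemma relators_tbar_gen_homogeneous:
  "x \<in> (relators :: ('a, 'b) tbar_gen free_alg set) \<Longrightarrow> \<exists>p. hpart p x = x"
proof -
  have t: "hpart (par i + par a) (free_tbar i a) = free_tbar i a" for i :: "'a sidx" and a :: "'b sidx"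
    using hpart_gen[of "Tbar_gen i a"] by (simp add: par_tbar_gen_def)
  have t': "hpart (par i + par a) (sgn_pow d * free_tbar (- i) (- a)) = sgn_pow d * free_tbar (- i) (- a)"
    for i :: "'a sidx" and a :: "'b sidx" and d
    using t[of "- i" "- a"] by (simp add: par_uminus_sidx hpart_sgn_pow ac_simps)
  have b: "hpart (par a + par i) (bar_mat free_tbar a i) = bar_mat free_tbar a i"
    for i :: "'a sidx" and a :: "'b sidx"
    using t[of i a] by (simp add: bar_mat_def hpart_sgn_pow add.commute)
  note ev = mat2_even_mult mat2_even_slot1[of "bar_mat free_tbar", OF b]
    mat2_even_slot2[of "bar_mat free_tbar", OF b] mat2_even_S
  assume "x \<in> relators"
  then consider i a where "x = free_tbar i a - sgn_pow (par i + par a) * free_tbar (- i) (- a)"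
    | a i b j where "x =
        (slot1 (bar_mat free_tbar) \<odot> slot2 (bar_mat free_tbar) \<odot> mat2_scalar S_mat) a i b j
        - (mat2_scalar S_mat \<odot> slot2 (bar_mat free_tbar) \<odot> slot1 (bar_mat free_tbar)) a i b j"
    unfolding relators_tbar_gen_def by blast
  then show ?thesis
  proof cases
    case 1
    then show ?thesis using homogeneous_diff[OF t t'] by blast
  next
    case 2
    have "mat2_even (slot1 (bar_mat free_tbar) \<odot>
        slot2 (bar_mat (free_tbar :: 'a sidx \<Rightarrow> 'b sidx \<Rightarrow> _)) \<odot> mat2_scalar S_mat)"
      "mat2_even (mat2_scalar S_mat \<odot> slot2 (bar_mat free_tbar) \<odot>
        slot1 (bar_mat (free_tbar :: 'a sidx \<Rightarrow> 'b sidx \<Rightarrow> _)))"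
      by (intro ev)+
    then show ?thesis
      unfolding 2 mat2_even_def by (blast intro: homogeneous_diff)
  qed
qed

instance
  by standard (rule relators_tbar_gen_homogeneous[unfolded homogeneous_free_alg_iff word_par_def])

end

text \<open>$\mathsf{A}_{r,n}$ and $\bar{\mathsf{A}}_{s,n}$ for \<open>r = CARD('r)\<close>, \<open>s = CARD('s)\<close>, \<open>n = CARD('n)\<close>.\<close>

type_synonym ('r, 'n) A = "('r, 'n) t_gen presented"
type_synonym ('s, 'n) Abar = "('s, 'n) tbar_gen presented"

definition t_elt :: "'r::finite sidx \<Rightarrow> 'n::finite sidx \<Rightarrow> ('r, 'n) A" where
  "t_elt i a = pgen (T_gen i a)"

definition tbar_elt :: "'s::finite sidx \<Rightarrow> 'n::finite sidx \<Rightarrow> ('s, 'n) Abar" where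
  "tbar_elt \<alpha> b = pgen (Tbar_gen \<alpha> b)"

text \<open>The rows of $T_+$ with negative index are kept as zero rows.\<close>

definition T_plus :: "'r::finite sidx \<Rightarrow> 'n::finite sidx \<Rightarrow> ('r, 'n) A" where
  "T_plus i a = (if sidx_pos i then t_elt i a else 0)"

definition T_bar :: "'n::finite sidx \<Rightarrow> 's::finite sidx \<Rightarrow> ('s, 'n) Abar" where
  "T_bar = bar_mat tbar_elt"

end

theory Submission
  imports Defs "HOL-Library.Function_Algebras"
begin

text \<open>The exchange of $\bar{\mathsf A}$ past $\mathsf A$ is governed by the Yang--Baxter equation.
  Since $\mathsf A$ is generated by the rows of $T$ with positive index and the defining relations
  reduce to those rows, $T_+\mapsto T_+^{2}(S^{-1})^{12}$ extends to a homomorphism from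
  $\mathsf A$ to the $n|n$ matrices over $\mathsf A$; write $\rho_{bc}(f)$ for the entries of the image
  of $f$. Let $\bar t_{\alpha b}$ act on $\mathsf A\otimes\bar{\mathsf A}$ by
  $f\otimes g\mapsto\sum_c\rho_{bc}((-1)^{|\alpha||f|}f)\otimes\bar t_{\alpha c}g$. A second instance of the
  Yang--Baxter equation, checked on the generators $f=t_{ia}$, shows that these operators satisfy the
  relations of $\bar{\mathsf A}$, so that $\bar{\mathsf A}$ acts on $\mathsf A\otimes\bar{\mathsf A}$, and
  $\Upsilon(g\otimes f)=g\cdot(f\otimes1)$. The two multiplicativity conditions say that the action
  commutes with right multiplication by $1\otimes\bar{\mathsf A}$ and that $\rho$ is multiplicative.\<close>

section \<open>Index signs and the Yang--Baxter identities\<close>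

text \<open>The coefficients of S do not change when both indices of the first tensor factor are
  negated; the second factor has no such symmetry. Hence the rule with S^{-1} is compatible with the
  symmetry of bar T, which stands in the first slot, but it can be prescribed only for the rows of T
  with positive index; for the other rows it is then forced by t_{ia} = t_{-i,-a}. This is why the
  quadratic relations have to be reduced to positive rows. Both arguments of \<Upsilon> come from
  quotients of free algebras, and a formula on words would have to be shown well defined in each of
  them. For operators on a vector space it is enough that the relators act by zero. The iterated
  coefficients \<rho>_{ac}(\<rho>_{bd}(f)) are again multiplicative in f, which is why the second
  exchange identity may be tested on generators. The Yang-Baxter identities are stated for test
  functions instead of triple tensor products. They become sums of few terms whose coefficients
  depend only on the signs of three indices and on the order of their absolute values.\<close>

lemma qvar_nonzero [simp]: "qvar \<noteq> 0"
  by (simp add: qvar_def Zero_fract_def eq_fract)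

text \<open>The relations $S^{12}T^1T^2=T^2T^1S^{12}$ in the rows $(i,k)$ with $i,k>0$ express
  $t_{ia}t_{kb}$ through \<open>braid\<close> applied to $(a,b)\mapsto t_{ka}t_{ib}$, in a form contracted with a
  test function. All signs of the super tensor product are absorbed in the coefficients.\<close>

definition braid :: "('n::finite sidx \<Rightarrow> 'n sidx \<Rightarrow> 'v::Cq_space) \<Rightarrow> 'n sidx \<Rightarrow> 'n sidx \<Rightarrow> 'v" where
  "braid F a b = (sgn_pow (par a * par b) * qvar powi phi b a) *\<^sub>q F b a
     + (if a < b then qxi *\<^sub>q F a b else 0)
     - (if a < - b then (sgn_pow (par b) * qxi) *\<^sub>q F (- a) (- b) else 0)"

text \<open>Contraction of \<open>F c a\<close> with the entries $(S^{-1})_{bc,pa}$. The row index \<open>b\<close> of the first slot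
  and the row index \<open>p\<close> of the second one are kept, so the sum over all \<open>c\<close>, \<open>a\<close> has at most three
  nonzero terms.\<close>

definition crossing :: "('n::finite sidx \<Rightarrow> 'n sidx \<Rightarrow> 'v::Cq_space) \<Rightarrow> 'n sidx \<Rightarrow> 'n sidx \<Rightarrow> 'v" where
  "crossing F b p = (sgn_pow (par b * par p) * qvar powi (- phi b p)) *\<^sub>q F b p
     - (if p < b then qxi *\<^sub>q F p b else 0)
     - (if p < - b then (sgn_pow (par p) * qxi) *\<^sub>q F (- p) (- b) else 0)"

lemma uminus_uminus_sidx [simp]: "- (- i) = (i :: 'n::finite sidx)"
  by transfer simp

lemma sidx_pos_cases:
  fixes i :: "'n::finite sidx"
  obtains x where "sidx_pos x" "i = x \<or> i = - x"
proof (cases "sidx_pos i")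
  case False
  then have "sidx_pos (- i)"
    unfolding sidx_pos_def by transfer auto
  then show ?thesis using that[of "- i"] by simp
qed (use that in blast)

lemma sidx_less_uminus: "- i < - j \<longleftrightarrow> j < (i :: 'n::finite sidx)"
  by transfer auto

lemma sidx_eq_uminus: "- i = - j \<longleftrightarrow> i = (j :: 'n::finite sidx)"
  by transfer auto

lemma sidx_pos_simps:
  fixes i j :: "'n::finite sidx"
  assumes "sidx_pos i" "sidx_pos j"
  shows "- i < j" "\<not> i < - j" "- i \<noteq> j" "i \<noteq> - j"
  using assms unfolding sidx_pos_def by (transfer, auto)+

lemma par_pos: "sidx_pos i \<Longrightarrow> par i = 0"
  unfolding sidx_pos_def by transfer simp

lemmas sidx_simps = sidx_less_uminus sidx_eq_uminus sidx_pos_simps par_pos par_uminus_sidx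

text \<open>Linear functionals separate points; this reduces identities in a space to identities in the
  field, where ring normalization is available.\<close>

lemma Cq_eqI:
  fixes u v :: "'a::Cq_space"
  assumes "\<And>\<phi> :: 'a \<Rightarrow> Cq. \<lbrakk>\<And>x y. \<phi> (x + y) = \<phi> x + \<phi> y; \<And>x y. \<phi> (x - y) = \<phi> x - \<phi> y;
      \<And>c x. \<phi> (c *\<^sub>q x) = c * \<phi> x; \<And>x. \<phi> (- x) = - \<phi> x; \<phi> 0 = 0\<rbrakk> \<Longrightarrow> \<phi> u = \<phi> v"
  shows "u = v"
proof (rule ccontr)
  interpret P: vector_space_pair "scaleq :: Cq \<Rightarrow> 'a \<Rightarrow> 'a" "(*) :: Cq \<Rightarrow> Cq \<Rightarrow> Cq"
    by unfold_locales (simp_all add: algebra_simps)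
  assume "u \<noteq> v"
  then have ind: "Cq_space.independent {u - v}"
    by (simp add: Cq_space.independent_insert)
  define \<phi> where "\<phi> = P.construct {u - v} (\<lambda>_. 1)"
  have lin: "Vector_Spaces.linear (*\<^sub>q) (*) \<phi>"
    unfolding \<phi>_def by (rule P.linear_construct[OF ind])
  interpret L: Vector_Spaces.linear "(*\<^sub>q)" "(*)" \<phi>
    by (rule lin)
  have "\<phi> u = \<phi> v"
    by (rule assms) (fact L.add L.diff L.scale L.neg L.zero)+
  moreover have "\<phi> (u - v) = 1"
    unfolding \<phi>_def by (simp add: P.construct_basis[OF ind])
  ultimately show False
    by (simp add: L.diff)
qed

section \<open>Case analysis by signs and by the order of absolute values\<close>

lemma sidx_triple_cases:
  fixes a b c :: "'n::finite sidx"
  obtains x y z where "sidx_pos x" "sidx_pos y" "sidx_pos z"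
    "a = x \<or> a = - x" "b = y \<or> b = - y" "c = z \<or> c = - z"
  using sidx_pos_cases by metis

abbreviation (input) strict :: "'a::linorder \<Rightarrow> 'a \<Rightarrow> bool" where
  "strict x y \<equiv> x < y \<and> \<not> y < x \<and> x \<noteq> y \<and> y \<noteq> x"

text \<open>The thirteen weak orders of three elements. Each case supplies its comparisons in every
  direction, so that the conditions in \<open>braid\<close> and \<open>crossing\<close> are decided
  by rewriting alone.\<close>

lemma order_cases3:
  fixes x y z :: "'a::linorder"
  obtains "strict x y" "strict y z" "strict x z" | "strict x y" "y = z"
    | "strict x y" "strict z y" "strict x z" | "strict x y" "z = x"
    | "strict x y" "strict z x" "strict z y" | "x = y" "strict y z" | "x = y" "y = z"
    | "x = y" "strict z y" | "strict y x" "strict x z" "strict y z" | "strict y x" "z = x"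
    | "strict y x" "strict z x" "strict y z" | "strict y x" "z = y"
    | "strict y x" "strict z y" "strict z x"
  by (rule linorder_cases[of x y]; rule linorder_cases[of y z]; rule linorder_cases[of x z];
      ((rule FalseE; order) | (rule that; (intro conjI)?; order)))

lemma qvar_inverse_left:
  "qvar * (inverse qvar * x) = x" "inverse qvar * (qvar * x) = x"
  by (simp_all flip: mult.assoc)

text \<open>The Yang-Baxter equation for one slot of bar T and two of T: the two T indices may be
  exchanged before or after both pass the index \<open>d\<close>. Only the values of
  \<open>F\<close> at signed copies of the three absolute values occur, which leaves 13 orders times
  8 sign patterns, each an identity in q.\<close>

lemma yang_baxter_left:
  fixes F :: "'n::finite sidx \<Rightarrow> 'n sidx \<Rightarrow> 'n sidx \<Rightarrow> 'v::Cq_space"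
  shows "braid (\<lambda>p q. crossing (\<lambda>e a. crossing (\<lambda>c b. F c a b) e q) d p) a b =
    crossing (\<lambda>e a. crossing (\<lambda>c b. braid (F c) a b) e b) d a"
proof (rule Cq_eqI)
  fix \<phi> :: "'v \<Rightarrow> Cq"
  assume lin: "\<And>x y. \<phi> (x + y) = \<phi> x + \<phi> y" "\<And>x y. \<phi> (x - y) = \<phi> x - \<phi> y"
    "\<And>c x. \<phi> (c *\<^sub>q x) = c * \<phi> x" "\<And>x. \<phi> (- x) = - \<phi> x" "\<phi> 0 = 0"
  obtain x y z where pos: "sidx_pos x" "sidx_pos y" "sidx_pos z" and
    sgn: "a = x \<or> a = - x" "b = y \<or> b = - y" "d = z \<or> d = - z"
    by (rule sidx_triple_cases)
  show "\<phi> (braid (\<lambda>p q. crossing (\<lambda>e a. crossing (\<lambda>c b. F c a b) e q) d p) a b) =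
    \<phi> (crossing (\<lambda>e a. crossing (\<lambda>c b. braid (F c) a b) e b) d a)"
    using sgn pos
  proof (cases x y z rule: order_cases3)
  qed (elim disjE;
      simp add: braid_def crossing_def sidx_simps phi_def qxi_def power_int_minus lin;
      simp add: algebra_simps qvar_inverse_left)+
qed

text \<open>The analogue of \<open>braid\<close> for $\bar{\mathsf A}$. In contrast to the rows, the columns of $S$ with
  positive indices have nonzero entries in negative positions, which accounts for the last term.\<close>

definition braid_bar :: "('n::finite sidx \<Rightarrow> 'n sidx \<Rightarrow> 'v::Cq_space) \<Rightarrow> 'n sidx \<Rightarrow> 'n sidx \<Rightarrow> 'v" where
  "braid_bar G a b = (sgn_pow (par a * par b) * qvar powi phi a b) *\<^sub>q G b a
     + (if b < a then qxi *\<^sub>q G a b else 0)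
     + (if b < - a then 0 else (sgn_pow (par a) * qxi) *\<^sub>q G (- a) (- b))"

text \<open>The companion for two slots of bar T and one of T: the indices \<open>a\<close> and
  \<open>b\<close> may be exchanged before or after the T index \<open>p\<close> has passed
  both.\<close>

lemma yang_baxter_right:
  fixes F :: "'n::finite sidx \<Rightarrow> 'n sidx \<Rightarrow> 'n sidx \<Rightarrow> 'v::Cq_space"
  shows "braid_bar (\<lambda>a b. crossing (\<lambda>c x. crossing (\<lambda>d y. F c d y) b x) a p) a b =
    crossing (\<lambda>c x. crossing (\<lambda>d y. braid_bar (\<lambda>c d. F c d y) c d) b x) a p"
proof (rule Cq_eqI)
  fix \<phi> :: "'v \<Rightarrow> Cq"
  assume lin: "\<And>x y. \<phi> (x + y) = \<phi> x + \<phi> y" "\<And>x y. \<phi> (x - y) = \<phi> x - \<phi> y"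
    "\<And>c x. \<phi> (c *\<^sub>q x) = c * \<phi> x" "\<And>x. \<phi> (- x) = - \<phi> x" "\<phi> 0 = 0"
  obtain x y z where pos: "sidx_pos x" "sidx_pos y" "sidx_pos z" and
    sgn: "a = x \<or> a = - x" "b = y \<or> b = - y" "p = z \<or> p = - z"
    by (rule sidx_triple_cases)
  show "\<phi> (braid_bar (\<lambda>a b. crossing (\<lambda>c x. crossing (\<lambda>d y. F c d y) b x) a p) a b) =
    \<phi> (crossing (\<lambda>c x. crossing (\<lambda>d y. braid_bar (\<lambda>c d. F c d y) c d) b x) a p)"
    using sgn pos
  proof (cases x y z rule: order_cases3)
  qed (elim disjE;
      simp add: braid_bar_def crossing_def sidx_simps phi_def qxi_def power_int_minus lin;
      simp add: algebra_simps qvar_inverse_left)+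
qed

section \<open>The matrix S and its inverse\<close>

text \<open>S with q replaced by a parameter. The value \<open>qvar\<close> gives S and
  \<open>inverse qvar\<close> gives its inverse, so product formulas are proved once for
  both.\<close>

definition S_form :: "Cq \<Rightarrow> ('n::finite sidx, 'n sidx, 'n sidx, 'n sidx, Cq) mat2" where
  "S_form Q i j k l = (if i = j \<and> k = l then Q powi phi i k else 0)
     + (if k < l \<and> i = l \<and> j = k then sgn_pow (par k) * (Q - inverse Q) else 0)
     + (if k < l \<and> i = - l \<and> j = - k then sgn_pow (par k) * (Q - inverse Q) else 0)"

lemma sum_delta2:
  "(\<Sum>j\<in>UNIV. \<Sum>l\<in>UNIV. if a = (j :: 'a::finite) \<and> b = (l :: 'b::finite) then c else 0) =
      (c :: 'c::comm_monoid_add)"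
proof -
  have "(\<Sum>l\<in>UNIV. if a = j \<and> b = l then c else 0) = (if a = j then c else 0)" for j
    by (cases "a = j") simp_all
  then show ?thesis by simp
qed

lemma S_mat_eq: "S_mat = S_form qvar"
proof (intro ext)
  fix i' j' k' l' :: "'n::finite sidx"
  have 1: "(\<Sum>i\<in>UNIV. \<Sum>j\<in>UNIV. qvar powi phi i j * mat_unit2 i i j j i' j' k' l') =
      (if i' = j' \<and> k' = l' then qvar powi phi i' k' else 0)"
  proof -
    have "qvar powi phi i j * mat_unit2 i i j j i' j' k' l' =
        (if k' = j then (if i' = i then (if i' = j' \<and> k' =
            l' then qvar powi phi i' k' else 0) else 0) else 0)" for i j
      by (auto simp: mat_unit2_def)
    then show ?thesis by simp
  qed
  have 2: "(\<Sum>i\<in>UNIV. \<Sum>j\<in>{j. i < j}. sgn_pow (par i) *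
        (mat_unit2 j i i j i' j' k' l' + mat_unit2 (- j) (- i) i j i' j' k' l')) =
     (if k' < l' \<and> i' = l' \<and> j' = k' then sgn_pow (par k') else 0)
     + (if k' < l' \<and> i' = - l' \<and> j' = - k' then sgn_pow (par k') else (0::Cq))" (is "_ = ?r")
  proof -
    have "(\<Sum>j\<in>{j. i < j}. sgn_pow (par i) *
        (mat_unit2 j i i j i' j' k' l' + mat_unit2 (- j) (- i) i j i' j' k' l')) =
      (\<Sum>j\<in>UNIV. if k' = i \<and> l' = j then ?r else 0)" for i
    proof -
      have "(\<Sum>j\<in>{j. i < j}. sgn_pow (par i) *
          (mat_unit2 j i i j i' j' k' l' + mat_unit2 (- j) (- i) i j i' j' k' l')) =
        (\<Sum>j\<in>UNIV. if i < j then sgn_pow (par i) *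
          (mat_unit2 j i i j i' j' k' l' + mat_unit2 (- j) (- i) i j i' j' k' l') else 0)"
        using sum.inter_filter[of UNIV _ "\<lambda>j. i < j"] by simp
      also have "\<dots> = (\<Sum>j\<in>UNIV. if k' = i \<and> l' = j then ?r else 0)"
        by (rule sum.cong) (auto simp: mat_unit2_def)
      finally show ?thesis .
    qed
    then show ?thesis by (simp only: sum_delta2)
  qed
  show "S_mat i' j' k' l' = S_form qvar i' j' k' l'"
    unfolding S_mat_def S_form_def 1 2 by (auto simp: qxi_def)
qed

lemma twist_zero [simp]: "twist 0 x = x"
  by (simp add: twist_def hpart_sum)

lemma twist_even: "hpart 0 x = x \<Longrightarrow> twist d x = x"
  by (simp add: twist_homogeneous)

lemma bit_mult_self [simp]: "(d::bit) * d = d"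
  using bit_disj[of d] by auto

text \<open>A row of S has at most three nonzero entries, hence three surviving terms. The map
  \<open>\<iota>\<close> embeds the scalars in the coefficient ring: it is the identity for scalar
  matrices, and multiplication of the unit for matrices over a superalgebra.\<close>

lemma S_form_mult_left:
  fixes \<iota> :: "Cq \<Rightarrow> 'b::super_ring"
  assumes \<iota>: "\<iota> 0 = 0" "\<And>x y. \<iota> (x + y) = \<iota> x + \<iota> y" "\<And>c. hpart 0 (\<iota> c) = \<iota> c"
    "\<And>d c. \<iota> (sgn_pow d * c) = sgn_pow d * \<iota> c"
  shows "((\<lambda>i j k l. \<iota> (S_form Q i j k l)) \<odot> X) i m k p =
     \<iota> (Q powi phi i k) * X i m k p
     + (if k < i then \<iota> (sgn_pow (par k + (par k + par i) * (par k + par m)) * (Q - inverse Q)) *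
         X k m i p else 0)
     + (if k < - i then \<iota> (sgn_pow (par k + (par k + par i + 1) * (par k + par m + 1)) * (Q -
         inverse Q)) * X (- k) m (- i) p else 0)"
proof -
  have s: "sgn_pow d * (\<iota> (sgn_pow e * c) * y) = \<iota> (sgn_pow (e + d) * c) * y" for d e c y
    by (simp add: sgn_pow_add mult.assoc \<iota>(4)) (simp add: sgn_pow_def)
  have s0: "sgn_pow d * (\<iota> c * y) = \<iota> (sgn_pow d * c) * y" for d c y
    using s[of d 0] by simp
  have split: "sgn_pow ((par k + par l) * (par j + par m)) *
        (twist (par j + par m + par l + par p) (\<iota> (S_form Q i j k l)) * X j m l p) =
     (if i = j \<and> k = l then \<iota> (Q powi phi i k) * X i m k p else 0)
     + (if k = j \<and> i = l then if k < i then \<iota> (sgn_pow (par k + (par k + par i) * (par k +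
         par m)) * (Q - inverse Q)) * X k m i p else 0 else 0)
     + (if - k = j \<and> - i = l then if k < - i then \<iota> (sgn_pow (par k + (par k + par i + 1) * (par k
         + par m + 1)) * (Q - inverse Q)) * X (- k) m (- i) p else 0 else 0)"
     for j l
  proof -
    have 1: "sgn_pow ((par k + par l) * (par j + par m)) * (\<iota> (if i = j \<and> k =
        l then Q powi phi i k else 0) * X j m l p) =
        (if i = j \<and> k = l then \<iota> (Q powi phi i k) * X i m k p else 0)"
      by (cases "i = j"; cases "k = l"; simp add: \<iota>(1))
    have 2: "sgn_pow ((par k + par l) * (par j + par m)) * (\<iota> (if k < l \<and> i = l \<and> j =
        k then sgn_pow (par k) * (Q - inverse Q) else 0) * X j m l p) =
        (if k = j \<and> i = l then if k < i then \<iota> (sgn_pow (par k + (par k + par i) * (par k +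
            par m)) * (Q - inverse Q)) * X k m i p else 0 else 0)"
      by (cases "j = k"; cases "i = l"; cases "k < l"; simp add: \<iota>(1) s)
    have 3: "sgn_pow ((par k + par l) * (par j + par m)) * (\<iota> (if k < l \<and> i = - l \<and> j =
        - k then sgn_pow (par k) * (Q - inverse Q) else 0) * X j m l p) =
        (if - k = j \<and> - i = l then if k < - i then \<iota> (sgn_pow (par k + (par k + par i + 1) *
            (par k + par m + 1)) * (Q - inverse Q)) * X (- k) m (- i) p else 0 else 0)"
      by (cases "- k = j"; cases "- i = l"; cases "k < l"; auto simp: \<iota>(1) s par_uminus_sidx ac_simps)
    show ?thesis
      unfolding twist_even[OF \<iota>(3)]
      by (simp only: S_form_def \<iota>(2) distrib_left[where 'a = 'b] distrib_right[where 'a = 'b] 1 2 3)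
  qed
  show ?thesis
    unfolding mat2_mult_def split by (simp add: sum.distrib sum_delta2)
qed

lemma mat2_mult_one_right: "X \<odot> mat2_one = X"
proof (intro ext)
  fix i m k p
  have "sgn_pow ((par k + par l) * (par j + par m)) *
      (twist (par j + par m + par l + par p) (X i j k l) * mat2_one j m l p) =
     (if m = j \<and> p = l then X i m k p else 0)" for j l
    by (cases "m = j"; cases "p = l"; simp add: mat2_one_def)
  then show "(X \<odot> mat2_one) i m k p = X i m k p"
    by (simp add: mat2_mult_def sum_delta2)
qed

lemma S_form_mult_Cq:
  "(S_form Q \<odot> X) i m k p = Q powi phi i k * X i m k p
     + (if k < i then sgn_pow (par k + (par k + par i) * (par k + par m)) * (Q - inverse Q) *
         X k m i p else 0)
     + (if k < - i then sgn_pow (par k + (par k + par i + 1) * (par k + par m + 1)) * (Q -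
         inverse Q) * X (- k) m (- i) p else 0)"
  by (rule S_form_mult_left[where \<iota> = "\<lambda>x. x"]) (simp_all add: hpart_fract_def)

text \<open>The off-diagonal coefficients change sign when \<open>Q\<close> is inverted, so the
  terms of first order cancel. The two contributions of second order both lie in the row (-i, -k)
  and cancel each other.\<close>

lemma S_form_mult_inverse:
  fixes X :: "('n::finite sidx, 'm::indexed_parity, 'n sidx, 'p::indexed_parity, Cq) mat2"
  assumes Q: "Q \<noteq> 0"
  shows "S_form Q \<odot> (S_form (inverse Q) \<odot> X) = X"
proof (intro ext)
  fix i k :: "'n sidx" and m p
  obtain x y where pos: "sidx_pos x" "sidx_pos y" and sgn: "i = x \<or> i = - x" "k = y \<or> k = - y"
    by (metis sidx_pos_cases)
  have Q': "Q * (inverse Q * u) = u" "inverse Q * (Q * u) = u" for u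
    using Q by (simp_all flip: mult.assoc)
  show "(S_form Q \<odot> (S_form (inverse Q) \<odot> X)) i m k p = X i m k p"
    using sgn pos bit_disj[of "par m"]
    by (cases rule: linorder_cases[of x y]; elim disjE;
      simp add: S_form_mult_Cq sidx_simps phi_def power_int_minus Q less_imp_neq[symmetric]
          less_imp_neq order.asym;
      simp add: algebra_simps Q Q')
qed

lemma S_inv_eq: "S_inv = S_form (inverse qvar)"
proof -
  let ?X = "S_form (inverse qvar)"
  \<comment> \<open>Cancellation against an arbitrary factor; with a competing inverse in place of
    \<open>Y\<close> it also gives uniqueness.\<close>
  have inv: "S_mat \<odot> (?X \<odot> Y) = Y" "?X \<odot> (S_mat \<odot> Y) = Y" for Y
    using S_form_mult_inverse[of qvar Y] S_form_mult_inverse[of "inverse qvar" Y]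
    by (simp_all add: S_mat_eq)
  have "S_mat \<odot> ?X = mat2_one \<and> ?X \<odot> S_mat = mat2_one"
    using inv[of mat2_one] by (simp add: mat2_mult_one_right)
  moreover have "X = ?X" if "S_mat \<odot> X = mat2_one" for X
    using inv(2)[of X] that by (simp add: mat2_mult_one_right)
  ultimately show ?thesis
    unfolding S_inv_def by (blast intro: the_equality)
qed

section \<open>Products of matrices in two tensor slots\<close>

lemma sgn_pow_left_commute: "x * (sgn_pow d * y) = sgn_pow d * (x * y :: 'b::super_ring)"
  by (simp add: sgn_pow_def)

lemma twist_zero_right [simp]: "twist d (0 :: 'b::super_ring) = 0"
  by (simp add: twist_def)

lemma twist_sgn_pow: "twist d (sgn_pow e * x) = sgn_pow e * twist d x"
  by (simp add: twist_def hpart_sgn_pow distrib_left) (simp add: sgn_pow_def)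

lemma twist_sum: "twist d (\<Sum>a\<in>A. f a) = (\<Sum>a\<in>A. twist d (f a))"
  by (simp add: twist_def hpart_setsum sum_distrib_left sum.distrib)

lemma twist_mult: "twist d (x * y) = twist d x * twist d (y :: 'b::super_ring)"
  using bit_disj[of d] hpart_mult_expand[of 0 x y] hpart_mult_expand[of 1 x y]
  by (auto simp: twist_def algebra_simps)

lemma twist_twist: "twist d (twist e x) = twist (d + e) x"
  using bit_disj[of d] bit_disj[of e]
  by (auto simp: twist_def hpart_add hpart_hpart hpart_diff hpart_uminus hpart_sum)

lemma sum_swap4:
  "(\<Sum>m\<in>A. \<Sum>p\<in>B. \<Sum>j\<in>C. \<Sum>l\<in>D. f m p j l) = (\<Sum>j\<in>C. \<Sum>l\<in>D. \<Sum>m\<in>A. \<Sum>p\<in>B. f m p j l)"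
proof -
  have "(\<Sum>m\<in>A. \<Sum>p\<in>B. \<Sum>j\<in>C. \<Sum>l\<in>D. f m p j l) = (\<Sum>m\<in>A. \<Sum>j\<in>C. \<Sum>l\<in>D. \<Sum>p\<in>B. f m p j l)"
    by (rule sum.cong[OF refl], subst sum.swap, rule sum.cong[OF refl], rule sum.swap)
  also have "\<dots> = (\<Sum>j\<in>C. \<Sum>l\<in>D. \<Sum>m\<in>A. \<Sum>p\<in>B. f m p j l)"
    by (subst sum.swap, rule sum.cong[OF refl], rule sum.swap)
  finally show ?thesis .
qed

text \<open>\<open>twist\<close> is multiplicative and successive twists add up, so the inner
  indices disappear from the twist on \<open>X\<close>. What remains is an identity of signs in the
  field with two elements.\<close>

lemma mat2_mult_assoc:
  fixes X :: "('i, 'j::{finite,indexed_parity}, 'k::indexed_parity, 'l::{finite,indexed_parity},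
      'b::super_ring) mat2"
    and Y :: "('j, 'm::{finite,indexed_parity}, 'l, 'p::{finite,indexed_parity}, 'b) mat2"
    and Z :: "('m, 'u::indexed_parity, 'p, 'v::indexed_parity, 'b) mat2"
  shows "(X \<odot> Y) \<odot> Z = X \<odot> (Y \<odot> Z)"
proof (intro ext)
  fix i :: 'i and u :: 'u and k :: 'k and v :: 'v
  have s: "sgn_pow ((par k + par p) * (par m + par u)) * (sgn_pow ((par k + par l) * (par j +
      par m)) * x) =
    sgn_pow ((par k + par l) * (par j + par u)) * (sgn_pow ((par l + par p) * (par m + par u)) *
        (x :: 'b))"
    for p :: 'p and m :: 'm and l :: 'l and j :: 'j and x
    using bit_disj[of "par k"] bit_disj[of "par p"] bit_disj[of "par m"] bit_disj[of "par u"]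
      bit_disj[of "par l"] bit_disj[of "par j"]
    by (elim disjE) simp_all
  have t: "par m + par u + par p + par v + (par j + par m + par l + par p) =
      par j + par u + par l + par v"
    for p :: 'p and m :: 'm and l :: 'l and j :: 'j
    by (simp add: ac_simps)
  have "((X \<odot> Y) \<odot> Z) i u k v = (\<Sum>m\<in>UNIV. \<Sum>p\<in>UNIV. \<Sum>j\<in>UNIV. \<Sum>l\<in>UNIV.
      sgn_pow ((par k + par p) * (par m + par u)) * (sgn_pow ((par k + par l) * (par j + par m)) *
        (twist (par j + par u + par l + par v) (X i j k l) *
          (twist (par m + par u + par p + par v) (Y j m l p) * Z m u p v))))"
    unfolding mat2_mult_def twist_sum twist_sgn_pow
    by (simp only: twist_mult twist_twist t sum_distrib_left sum_distrib_right mult.assoc)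
  also have "\<dots> = (\<Sum>j\<in>UNIV. \<Sum>l\<in>UNIV. \<Sum>m\<in>UNIV. \<Sum>p\<in>UNIV.
      sgn_pow ((par k + par l) * (par j + par u)) * (sgn_pow ((par l + par p) * (par m + par u)) *
        (twist (par j + par u + par l + par v) (X i j k l) *
          (twist (par m + par u + par p + par v) (Y j m l p) * Z m u p v))))"
    by (subst sum_swap4) (intro sum.cong refl s)
  also have "\<dots> = (X \<odot> (Y \<odot> Z)) i u k v"
    by (simp only: mat2_mult_def sum_distrib_left mult.assoc sgn_pow_left_commute[of "twist _ _"])
  finally show "((X \<odot> Y) \<odot> Z) i u k v = (X \<odot> (Y \<odot> Z)) i u k v" .
qed

lemma hpart_one_odd [simp]: "hpart 1 (1::'a::super_ring) = 0"
  using homogeneous_unique[OF hpart_one, of 1] by simp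

lemma S_form_mult_superalgebra:
  fixes X :: "('n::finite sidx, 'm::indexed_parity, 'n sidx, 'p::indexed_parity, 'b::superalgebra) mat2"
  shows "(mat2_scalar (S_form Q) \<odot> X) i m k p = (Q powi phi i k) *\<^sub>q X i m k p
     + (if k < i then (sgn_pow (par k + (par k + par i) * (par k + par m)) * (Q - inverse Q)) *\<^sub>q
         X k m i p else 0)
     + (if k < - i then (sgn_pow (par k + (par k + par i + 1) * (par k + par m + 1)) * (Q -
         inverse Q)) *\<^sub>q X (- k) m (- i) p else 0)"
proof -
  have *: "(c *\<^sub>q 1) * x = c *\<^sub>q x" for c and x :: 'b
    by (simp add: scaleq_mult_left)
  show ?thesis
    using S_form_mult_left[where \<iota> = "\<lambda>c. c *\<^sub>q (1::'b)" and Q = Q and X = X and i = i and m =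
        m and k = k and p = p]
    unfolding * mat2_scalar_def by (simp add: scaleq_add_left hpart_scaleq hpart_one
        sgn_pow_scaleq scaleq_scaleq)
qed

lemma mult_S_form_superalgebra:
  fixes X :: "('i::indexed_parity, 'n::finite sidx, 'k::indexed_parity, 'n sidx, 'b::superalgebra) mat2"
  shows "(X \<odot> mat2_scalar (S_form Q)) i m k p = (Q powi phi m p) *\<^sub>q X i m k p
     + (if m < p then (sgn_pow (par m + (par k + par m) * (par p + par m)) * (Q - inverse Q)) *\<^sub>q
         X i p k m else 0)
     + (if - m < p then (sgn_pow (par m + 1 + (par k + par m + 1) * (par p + par m + 1)) * (Q -
         inverse Q)) *\<^sub>q X i (- p) k (- m) else 0)"
proof -
  have 1: "sgn_pow d * (twist e x * (if P then c else 0) *\<^sub>q 1) =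
      (if P then (sgn_pow d * c) *\<^sub>q twist e x else 0)" for d e P c and x :: 'b
    by (simp add: sgn_pow_scaleq scaleq_mult_right scaleq_scaleq)
  \<comment> \<open>S is even: the four parities at a nonzero entry add up to zero, which makes the
    twist on \<open>X\<close> trivial.\<close>
  have 2: "par m + par m + par p + par p = 0" "par p + par m + par m + par p = 0" 
    "par (- p) + par m + par (- m) + par p = 0"
    by (simp_all add: par_uminus_sidx ac_simps)
  have split: "sgn_pow ((par k + par l) * (par j + par m)) *
        (twist (par j + par m + par l + par p) (X i j k l) * mat2_scalar (S_form Q) j m l p) =
     (if m = j \<and> p = l then (Q powi phi m p) *\<^sub>q X i m k p else 0)
     + (if p = j \<and> m = l then if m < p then (sgn_pow (par m + (par k + par m) * (par p + par m)) *
         (Q - inverse Q)) *\<^sub>q X i p k m else 0 else 0)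
     + (if - p = j \<and> - m = l then if - m < p then (sgn_pow (par m + 1 + (par k + par m + 1) *
         (par p + par m + 1)) * (Q - inverse Q)) *\<^sub>q X i (- p) k (- m) else 0 else 0)"
     for j l
  proof -
    have A: "(if j = m \<and> l = p then (sgn_pow ((par k + par l) * (par j + par m)) * Q powi phi j l) *\<^sub>q
        twist (par j + par m + par l + par p) (X i j k l) else 0) =
        (if m = j \<and> p = l then (Q powi phi m p) *\<^sub>q X i m k p else 0)"
      using 2 by auto
    have B: "(if l < p \<and> j = p \<and> m = l then (sgn_pow ((par k + par l) * (par j + par m)) *
        (sgn_pow (par l) * (Q - inverse Q))) *\<^sub>q
        twist (par j + par m + par l + par p) (X i j k l) else 0) =
        (if p = j \<and> m = l then if m < p then (sgn_pow (par m + (par k + par m) * (par p +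
            par m)) * (Q - inverse Q)) *\<^sub>q X i p k m else 0 else 0)"
      using 2 by (auto simp: sgn_pow_add)
    have C: "(if l < p \<and> j = - p \<and> m = - l then (sgn_pow ((par k + par l) * (par j + par m)) *
        (sgn_pow (par l) * (Q - inverse Q))) *\<^sub>q
        twist (par j + par m + par l + par p) (X i j k l) else 0) =
        (if - p = j \<and> - m = l then if - m < p then (sgn_pow (par m + 1 + (par k + par m + 1) *
            (par p + par m + 1)) * (Q - inverse Q)) *\<^sub>q X i (- p) k (- m) else 0 else 0)"
      using 2 by (auto simp: sgn_pow_add par_uminus_sidx ac_simps)
    show ?thesis
      unfolding mat2_scalar_def S_form_def
      by (simp only: scaleq_add_left distrib_left[where 'a = 'b] 1 A B C)
  qed
  show ?thesis
    unfolding mat2_mult_def split by (simp add: sum.distrib sum_delta2)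
qed

lemma slot1_mult_slot2:
  fixes x :: "'i::{finite,indexed_parity} \<Rightarrow> 'a::{finite,indexed_parity} \<Rightarrow> 'b::super_ring"
  assumes "\<And>i a. hpart (par i + par a) (x i a) = x i a"
  shows "(slot1 x \<odot> slot2 y) i a k b = sgn_pow ((par i + par a) * (par k + par b)) * (x i a * y k b)"
proof -
  have "sgn_pow ((par k + par l) * (par j + par a)) *
      (twist (par j + par a + par l + par b) (slot1 x i j k l) * slot2 y j a l b) =
    (if a = j \<and> k = l then sgn_pow ((par i + par a) * (par k + par b)) * (x i a *
        y k b) else 0)" for j l
    by (cases "a = j"; cases "k = l")
      (auto simp: slot1_def slot2_def twist_homogeneous[OF assms] mult.assoc ac_simps)
  then show ?thesis by (simp add: mat2_mult_def sum_delta2)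
qed

text \<open>The matrix unit in slot 2 and the entry \<open>y k b\<close> both pass the matrix unit
  of slot 1. They have the same parity, and the two signs cancel; in the other order only the entry
  moves, so a sign survives.\<close>

lemma slot2_mult_slot1:
  fixes y :: "'k::{finite,indexed_parity} \<Rightarrow> 'b::{finite,indexed_parity} \<Rightarrow> 'c::super_ring"
  assumes "\<And>k b. hpart (par k + par b) (y k b) = y k b"
  shows "(slot2 y \<odot> slot1 x) i a k b = y k b * x i a"
proof -
  have "sgn_pow ((par k + par l) * (par j + par a)) *
      (twist (par j + par a + par l + par b) (slot2 y i j k l) * slot1 x j a l b) =
    (if i = j \<and> b = l then y k b * x i a else 0)" for j l
    by (cases "i = j"; cases "b = l")
      (auto simp: slot1_def slot2_def twist_homogeneous[OF assms] mult.assoc ac_simps simp flip: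
          sgn_pow_add mult.assoc)
  then show ?thesis by (simp add: mat2_mult_def sum_delta2)
qed

section \<open>The defining relations in components\<close>

text \<open>The difference of the two sides of the defining relation in the component $(i,a,k,b)$, up to a
  common sign, with \<open>P i a k b\<close> in the role of $t_{ia}t_{kb}$. The symmetry $t_{ia}=t_{-i,-a}$ has
  been used to bring the terms with $t_{-k,a}t_{-i,b}$ to the form $t_{k,-a}t_{i,-b}$.\<close>

definition t_defect :: "('r::finite sidx \<Rightarrow> 'n::finite sidx \<Rightarrow> 'r sidx \<Rightarrow> 'n sidx \<Rightarrow> 'v::Cq_space) \<Rightarrow>
    'r sidx \<Rightarrow> 'n sidx \<Rightarrow> 'r sidx \<Rightarrow> 'n sidx \<Rightarrow> 'v" where
  "t_defect P i a k b =
     (let \<epsilon> = sgn_pow (par k * par b + par i * par k + par i * par b) * qxi; \<eta> =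
         sgn_pow (par k + par b) * \<epsilon> in
     (qvar powi phi i k) *\<^sub>q P i a k b
     + (if k < i then \<epsilon> *\<^sub>q P k a i b else 0) + (if k < - i then \<eta> *\<^sub>q P k (- a) i (- b) else 0) -
     ((sgn_pow ((par i + par a) * (par k + par b)) * qvar powi phi a b) *\<^sub>q P k b i a
     + (if a < b then \<epsilon> *\<^sub>q P k a i b else 0) + (if - a < b then \<eta> *\<^sub>q P k (- a) i (- b) else 0)))"

lemma order_cases:
  fixes x y :: "'a::linorder"
  obtains "strict x y" | "x = y" | "strict y x"
  by (rule linorder_cases[of x y]; rule that; (intro conjI)?; order)

lemmas order_cases_pair = order_cases[case_product order_cases]

lemma ex_sidx_pos:
  fixes i :: "'n::finite sidx"
  shows "\<exists>x. sidx_pos x \<and> (i = x \<or> i = - x)"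
  by (metis sidx_pos_cases)

text \<open>Negating the first pair of indices only swaps the two kinds of \<xi>-terms. Negating the
  second pair replaces inequalities by their complements and inverts the powers of q; since q -
  q^{-1} = \<xi>, the changes on the two sides of the relation balance.\<close>

lemma t_defect_uminus:
  fixes P :: "'r::finite sidx \<Rightarrow> 'n::finite sidx \<Rightarrow> 'r sidx \<Rightarrow> 'n sidx \<Rightarrow> 'v::Cq_space"
  assumes sym: "\<And>i a k b. P (- i) (- a) k b = P i a k b" "\<And>i a k b. P i a (- k) (- b) = P i a k b"
  shows "t_defect P (- i) (- a) k b = t_defect P i a k b"
    and "t_defect P i a (- k) (- b) = t_defect P i a k b"
proof -
  have sym': "P (- i) a k b = P i (- a) k b" "P i a (- k) b = P i a k (- b)" for i a k b
    using sym(1)[of i "- a"] sym(2)[of _ _ k "- b"] by simp_all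
  obtain x y z w where pos: "sidx_pos x" "sidx_pos y" "sidx_pos z" "sidx_pos w"
    and sgn: "i = x \<or> i = - x" "k = y \<or> k = - y" "a = z \<or> a = - z" "b = w \<or> b = - w"
    using ex_sidx_pos[of i] ex_sidx_pos[of k] ex_sidx_pos[of a] ex_sidx_pos[of b] by blast
  show "t_defect P (- i) (- a) k b = t_defect P i a k b"
  proof (rule Cq_eqI)
    fix \<phi> :: "'v \<Rightarrow> Cq"
    assume lin: "\<And>x y. \<phi> (x + y) = \<phi> x + \<phi> y" "\<And>x y. \<phi> (x - y) = \<phi> x - \<phi> y"
      "\<And>c x. \<phi> (c *\<^sub>q x) = c * \<phi> x" "\<And>x. \<phi> (- x) = - \<phi> x" "\<phi> 0 = 0"
    show "\<phi> (t_defect P (- i) (- a) k b) = \<phi> (t_defect P i a k b)"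
      using sgn pos
    proof (cases x y z w rule: order_cases_pair)
    qed (elim disjE; simp add: t_defect_def Let_def sidx_simps phi_def qxi_def power_int_minus lin
        sym'; simp add: algebra_simps)+
  qed
  show "t_defect P i a (- k) (- b) = t_defect P i a k b"
  proof (rule Cq_eqI)
    fix \<phi> :: "'v \<Rightarrow> Cq"
    assume lin: "\<And>x y. \<phi> (x + y) = \<phi> x + \<phi> y" "\<And>x y. \<phi> (x - y) = \<phi> x - \<phi> y"
      "\<And>c x. \<phi> (c *\<^sub>q x) = c * \<phi> x" "\<And>x. \<phi> (- x) = - \<phi> x" "\<phi> 0 = 0"
    show "\<phi> (t_defect P i a (- k) (- b)) = \<phi> (t_defect P i a k b)"
      using sgn pos
    proof (cases x y z w rule: order_cases_pair)
    qed (elim disjE; simp add: t_defect_def Let_def sidx_simps phi_def qxi_def power_int_minus lin sym';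
          simp add: algebra_simps)+
  qed
qed

lemma t_defect_zeroI:
  assumes sym: "\<And>i a k b. P (- i) (- a) k b = P i a k b" "\<And>i a k b. P i a (- k) (- b) = P i a k b"
    and pos: "\<And>i a k b. sidx_pos i \<Longrightarrow> sidx_pos k \<Longrightarrow> t_defect P i a k b = 0"
  shows "t_defect P i a k b = 0"
proof -
  obtain x y where "sidx_pos x" "sidx_pos y" "i = x \<or> i = - x" "k = y \<or> k = - y"
    using ex_sidx_pos[of i] ex_sidx_pos[of k] by blast
  then show ?thesis
    using pos[of x y a b] pos[of x y "- a" b] pos[of x y a "- b"] pos[of x y "- a" "- b"]
      t_defect_uminus[where P = P, OF sym, of x "- a" k b]
      t_defect_uminus[where P = P, OF sym, of x "- a" y b]
      t_defect_uminus[where P = P, OF sym, of x a y "- b"]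
      t_defect_uminus[where P = P, OF sym, of x "- a" y "- b"]
      t_defect_uminus[where P = P, OF sym, of x "- a" "- y" "b"]
    by auto
qed

definition t_relator :: "'r::finite sidx \<Rightarrow> 'n::finite sidx \<Rightarrow> 'r sidx \<Rightarrow> 'n sidx \<Rightarrow> ('r,
    'n) t_gen free_alg" where
  "t_relator i a k b = (mat2_scalar S_mat \<odot> slot1 free_t \<odot> slot2 free_t) i a k b
        - (slot2 free_t \<odot> slot1 free_t \<odot> mat2_scalar S_mat) i a k b"

lemma hpart_free_t: "hpart (par i + par a) (free_t i a) = free_t i a"
  using hpart_gen[of "T_gen i a"] by (simp add: par_t_gen_def)

lemma t_relator_eq: "t_relator i a k b =
  (qvar powi phi i k * sgn_pow ((par i + par a) * (par k + par b))) *\<^sub>q (free_t i a * free_t k b)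
     + (if k < i then (sgn_pow (par k + (par k + par i) * (par k + par a) + (par k + par a) *
         (par i + par b)) * qxi) *\<^sub>q (free_t k a * free_t i b) else 0)
     + (if k < - i then (sgn_pow (par k + (par k + par i + 1) * (par k + par a + 1) + (par k + 1 +
         par a) * (par i + 1 + par b)) * qxi) *\<^sub>q (free_t (- k) a * free_t (- i) b) else 0)
  - ((qvar powi phi a b) *\<^sub>q (free_t k b * free_t i a)
     + (if a < b then (sgn_pow (par a + (par k + par a) * (par b + par a)) * qxi) *\<^sub>q
         (free_t k a * free_t i b) else 0)
     + (if - a < b then (sgn_pow (par a + 1 + (par k + par a + 1) * (par b + par a + 1)) *
         qxi) *\<^sub>q (free_t k (- a) * free_t i (- b)) else 0))"
  unfolding t_relator_def mat2_mult_assoc[of "mat2_scalar S_mat"]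
  unfolding S_mat_eq S_form_mult_superalgebra
    mult_S_form_superalgebra slot1_mult_slot2[of free_t, OF hpart_free_t]
    slot2_mult_slot1[of free_t, OF hpart_free_t] qxi_def[symmetric] sgn_pow_scaleq
  by (simp add: scaleq_scaleq par_uminus_sidx sgn_pow_add ac_simps)

text \<open>The linear map \<open>L\<close> is left general for two uses: the quotient map yields
  the relations in A, and evaluation of operators at a vector yields the condition for an action.
  The sign is the one produced by \<open>slot1_mult_slot2\<close>.\<close>

lemma t_relator_linear:
  fixes L :: "('r::finite, 'n::finite) t_gen free_alg \<Rightarrow> 'v::Cq_space"
  assumes L: "Cq_linear L" and P: "\<And>i a k b. P i a k b = L (free_t i a * free_t k b)"
    and sym: "\<And>i a k b. P (- i) (- a) k b = P i a k b" "\<And>i a k b. P i a (- k) (- b) = P i a k b"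
  shows "L (t_relator i a k b) = sgn_pow ((par i + par a) * (par k + par b)) *\<^sub>q t_defect P i a k b"
proof -
  interpret L: Vector_Spaces.linear "(*\<^sub>q)" "(*\<^sub>q)" L
    by (fact L)
  have P': "P (- k) a (- i) b = P k (- a) i (- b)"
    using sym(1)[of k "- a"] sym(2)[of _ _ i "- b"] by simp
  have if_L: "L (if Q then u else v) = (if Q then L u else L v)" for Q u v
    by simp
  have if_c: "c *\<^sub>q (if Q then u else v) = (if Q then c *\<^sub>q u else c *\<^sub>q v)" for c Q and u v :: 'v
    by simp
  show ?thesis
    unfolding t_relator_eq t_defect_def Let_def L.add L.diff L.scale if_L P[symmetric] P' L.zero
      scaleq_add_right Cq_space.scale_right_diff_distrib if_c scaleq_scaleq
    using bit_disj[of "par i"] bit_disj[of "par a"] bit_disj[of "par k"] bit_disj[of "par b"]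
    by (elim disjE) simp_all
qed

text \<open>The counterpart of \<open>t_defect\<close> for bar A, with all inequalities reversed
  because S stands on the other side. The extra sign in \<open>\<eta>\<close> comes from the signed
  symmetry of the generators.\<close>

definition tbar_defect :: "('s::finite sidx \<Rightarrow> 'n::finite sidx \<Rightarrow> 's sidx \<Rightarrow> 'n sidx \<Rightarrow> 'v::Cq_space)
    \<Rightarrow> 's sidx \<Rightarrow> 'n sidx \<Rightarrow> 's sidx \<Rightarrow> 'n sidx \<Rightarrow> 'v" where
  "tbar_defect P i a k b =
     (let \<epsilon> = sgn_pow (par k * par b + par i * par k + par i * par b) * qxi; \<eta> =
         sgn_pow (1 + par k + par a) * \<epsilon> in
     (qvar powi phi i k) *\<^sub>q P i a k b
     + (if i < k then \<epsilon> *\<^sub>q P k a i b else 0) + (if - i < k then \<eta> *\<^sub>q P k (- a) i (- b) else 0) -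
     ((sgn_pow ((par i + par a) * (par k + par b)) * qvar powi phi a b) *\<^sub>q P k b i a
     + (if b < a then \<epsilon> *\<^sub>q P k a i b else 0) + (if b < - a then \<eta> *\<^sub>q P k (- a) i (- b) else 0)))"

lemma tbar_defect_uminus:
  fixes P :: "'s::finite sidx \<Rightarrow> 'n::finite sidx \<Rightarrow> 's sidx \<Rightarrow> 'n sidx \<Rightarrow> 'v::Cq_space"
  assumes sym: "\<And>i a k b. P (- i) (- a) k b = sgn_pow (par i + par a) *\<^sub>q P i a k b"
      "\<And>i a k b. P i a (- k) (- b) = sgn_pow (par k + par b) *\<^sub>q P i a k b"
  shows "tbar_defect P (- i) (- a) k b = sgn_pow (par i + par a) *\<^sub>q tbar_defect P i a k b"
    and "tbar_defect P i a (- k) (- b) = sgn_pow (par k + par b) *\<^sub>q tbar_defect P i a k b"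
proof -
  have sym': "P (- i) a k b = sgn_pow (par i + par a + 1) *\<^sub>q P i (- a) k b"
      "P i a (- k) b = sgn_pow (par k + par b + 1) *\<^sub>q P i a k (- b)" for i a k b
    using sym(1)[of i "- a"] sym(2)[of _ _ k "- b"] by (simp_all add: par_uminus_sidx ac_simps)
  obtain x y z w where pos: "sidx_pos x" "sidx_pos y" "sidx_pos z" "sidx_pos w"
    and sgn: "i = x \<or> i = - x" "k = y \<or> k = - y" "a = z \<or> a = - z" "b = w \<or> b = - w"
    using ex_sidx_pos[of i] ex_sidx_pos[of k] ex_sidx_pos[of a] ex_sidx_pos[of b] by blast
  show "tbar_defect P (- i) (- a) k b = sgn_pow (par i + par a) *\<^sub>q tbar_defect P i a k b"
  proof (rule Cq_eqI)
    fix \<phi> :: "'v \<Rightarrow> Cq"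
    assume lin: "\<And>x y. \<phi> (x + y) = \<phi> x + \<phi> y" "\<And>x y. \<phi> (x - y) = \<phi> x - \<phi> y"
      "\<And>c x. \<phi> (c *\<^sub>q x) = c * \<phi> x" "\<And>x. \<phi> (- x) = - \<phi> x" "\<phi> 0 = 0"
    show "\<phi> (tbar_defect P (- i) (- a) k b) = \<phi> (sgn_pow (par i + par a) *\<^sub>q tbar_defect P i a k b)"
      using sgn pos
    proof (cases x y z w rule: order_cases_pair)
    qed (elim disjE; simp add: tbar_defect_def Let_def sidx_simps phi_def qxi_def power_int_minus
        lin sym';
        simp add: algebra_simps)+
  qed
  show "tbar_defect P i a (- k) (- b) = sgn_pow (par k + par b) *\<^sub>q tbar_defect P i a k b"
  proof (rule Cq_eqI)
    fix \<phi> :: "'v \<Rightarrow> Cq"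
    assume lin: "\<And>x y. \<phi> (x + y) = \<phi> x + \<phi> y" "\<And>x y. \<phi> (x - y) = \<phi> x - \<phi> y"
      "\<And>c x. \<phi> (c *\<^sub>q x) = c * \<phi> x" "\<And>x. \<phi> (- x) = - \<phi> x" "\<phi> 0 = 0"
    show "\<phi> (tbar_defect P i a (- k) (- b)) = \<phi> (sgn_pow (par k + par b) *\<^sub>q tbar_defect P i a k b)"
      using sgn pos
    proof (cases x y z w rule: order_cases_pair)
    qed (elim disjE; simp add: tbar_defect_def Let_def sidx_simps phi_def qxi_def power_int_minus
        lin sym';
          simp add: algebra_simps)+
  qed
qed

lemma tbar_defect_zeroI:
  assumes sym: "\<And>i a k b. P (- i) (- a) k b = sgn_pow (par i + par a) *\<^sub>q P i a k b"
      "\<And>i a k b. P i a (- k) (- b) = sgn_pow (par k + par b) *\<^sub>q P i a k b"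
    and pos: "\<And>i a k b. sidx_pos i \<Longrightarrow> sidx_pos k \<Longrightarrow> tbar_defect P i a k b = 0"
  shows "tbar_defect P i a k b = 0"
proof -
  obtain x y where "sidx_pos x" "sidx_pos y" "i = x \<or> i = - x" "k = y \<or> k = - y"
    using ex_sidx_pos[of i] ex_sidx_pos[of k] by blast
  then show ?thesis
    using pos[of x y a b] pos[of x y "- a" b] pos[of x y a "- b"] pos[of x y "- a" "- b"]
      tbar_defect_uminus[where P = P, OF sym, of x "- a" k b]
      tbar_defect_uminus[where P = P, OF sym, of x "- a" y b]
      tbar_defect_uminus[where P = P, OF sym, of x a y "- b"]
      tbar_defect_uminus[where P = P, OF sym, of x "- a" y "- b"]
      tbar_defect_uminus[where P = P, OF sym, of x "- a" "- y" "b"]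
    by auto
qed

definition tbar_relator :: "'s::finite sidx \<Rightarrow> 'n::finite sidx \<Rightarrow> 's sidx \<Rightarrow> 'n sidx \<Rightarrow> ('s,
    'n) tbar_gen free_alg" where
  "tbar_relator i a k b = (slot1 (bar_mat free_tbar) \<odot> slot2 (bar_mat free_tbar) \<odot> mat2_scalar
      S_mat) a i b k
        - (mat2_scalar S_mat \<odot> slot2 (bar_mat free_tbar) \<odot> slot1 (bar_mat free_tbar)) a i b k"

lemma hpart_bar_mat_free_tbar: "hpart (par a + par i) (bar_mat free_tbar a i) = bar_mat free_tbar a i"
  using hpart_gen[of "Tbar_gen i a"]
  by (simp add: bar_mat_def hpart_sgn_pow par_tbar_gen_def add.commute)

lemma bar_mat_mult:
  "bar_mat x a i * bar_mat y b k = sgn_pow (par a * (par i + par a) + par b * (par k + par b)) *\<^sub>q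
      (x i a * y k b :: 'b::superalgebra)"
  by (simp add: bar_mat_def sgn_pow_scaleq scaleq_mult_left scaleq_mult_right scaleq_scaleq sgn_pow_add)

text \<open>The sign collects those of the two factors \<open>bar_mat\<close> and of
  \<open>slot1_mult_slot2\<close>. As for A, \<open>L\<close> will be the quotient map or the
  evaluation of operators.\<close>

lemma tbar_relator_linear:
  fixes L :: "('s::finite, 'n::finite) tbar_gen free_alg \<Rightarrow> 'v::Cq_space"
  assumes L: "Cq_linear L" and P: "\<And>i a k b. P i a k b = L (free_tbar i a * free_tbar k b)"
    and sym: "\<And>i a k b. P (- i) (- a) k b = sgn_pow (par i + par a) *\<^sub>q P i a k b"
      "\<And>i a k b. P i a (- k) (- b) = sgn_pow (par k + par b) *\<^sub>q P i a k b"
  shows "L (tbar_relator i a k b) =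
    sgn_pow ((par i + par a) * (par k + par b) + par a * par i + par a + par b * par k +
        par b) *\<^sub>q tbar_defect P i a k b"
proof -
  interpret L: Vector_Spaces.linear "(*\<^sub>q)" "(*\<^sub>q)" L
    by (fact L)
  have P': "P (- k) a (- i) b = sgn_pow (par k + par a + par i + par b) *\<^sub>q P k (- a) i (- b)"
    using sym(1)[of k "- a"] sym(2)[of _ _ i "- b"]
    by (simp add: par_uminus_sidx scaleq_scaleq ac_simps flip: sgn_pow_add)
  have if_L: "L (if Q then u else v) = (if Q then L u else L v)" for Q u v
    by simp
  have if_c: "c *\<^sub>q (if Q then u else v) = (if Q then c *\<^sub>q u else c *\<^sub>q v)" for c Q and u v :: 'v
    by simp
  show ?thesis
    unfolding tbar_relator_def mat2_mult_assoc[of "mat2_scalar S_mat"]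
    unfolding S_mat_eq S_form_mult_superalgebra mult_S_form_superalgebra
      slot1_mult_slot2[of "bar_mat free_tbar", OF hpart_bar_mat_free_tbar]
      slot2_mult_slot1[of "bar_mat free_tbar", OF hpart_bar_mat_free_tbar] qxi_def[symmetric]
      bar_mat_mult
    unfolding sgn_pow_scaleq[where 'c = "('s, 'n) tbar_gen free_alg"] L.add L.diff L.scale if_L
        P[symmetric] P' L.zero
      tbar_defect_def Let_def
      scaleq_add_right Cq_space.scale_right_diff_distrib if_c scaleq_scaleq par_uminus_sidx
    using bit_disj[of "par i"] bit_disj[of "par a"] bit_disj[of "par k"] bit_disj[of "par b"]
    by (elim disjE) simp_all
qed

section \<open>Actions of presented superalgebras\<close>

lemma Cq_linear_zero: "Cq_linear f \<Longrightarrow> f 0 = 0"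
  using Cq_linear_add[of f 0 0] by simp

lemma Cq_linear_sum: "Cq_linear f \<Longrightarrow> f (sum g A) = (\<Sum>x\<in>A. f (g x))"
  by (induction A rule: infinite_finite_induct) (simp_all add: Cq_linear_zero Cq_linear_add)

lemma Cq_linear_uminus: "Cq_linear f \<Longrightarrow> f (- x) = - f x"
  using Cq_linear_scaleq[of f "- 1" x] by simp

lemma Cq_linear_diff: "Cq_linear f \<Longrightarrow> f (x - y) = f x - f y"
  using Cq_linear_add[of f x "- y"] by (simp add: Cq_linear_uminus)

lemma Cq_linear_comp: "Cq_linear f \<Longrightarrow> Cq_linear g \<Longrightarrow> Cq_linear (\<lambda>x. f (g x))"
  by (rule Cq_linearI) (simp_all add: Cq_linear_add Cq_linear_scaleq)

lemma Cq_linear_mult: "Cq_linear (\<lambda>x. x * (y :: 'a::superalgebra))" "Cq_linear (\<lambda>x. (y ::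
    'a::superalgebra) * x)"
  by (rule Cq_linearI; simp add: distrib_right distrib_left scaleq_mult_left scaleq_mult_right)+

text \<open>With \<open>foldr\<close> the last letter acts first, so that concatenation of words
  becomes composition of operators.\<close>

definition word_act :: "('g \<Rightarrow> 'w \<Rightarrow> 'w) \<Rightarrow> ('g list \<Rightarrow>\<^sub>0 Cq) \<Rightarrow> 'w::Cq_space \<Rightarrow> 'w" where
  "word_act op x w = (\<Sum>v\<in>Poly_Mapping.keys x. Poly_Mapping.lookup x v *\<^sub>q foldr op v w)"

lemma word_act_superset:
  assumes "finite A" "Poly_Mapping.keys x \<subseteq> A"
  shows "word_act op x w = (\<Sum>v\<in>A. Poly_Mapping.lookup x v *\<^sub>q foldr op v w)"
  unfolding word_act_def using assms by (intro sum.mono_neutral_left) (auto simp: in_keys_iff)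

lemma word_act_add: "word_act op (x + y) w = word_act op x w + word_act op y w"
proof -
  let ?A = "Poly_Mapping.keys x \<union> Poly_Mapping.keys y"
  have "word_act op (x + y) w = (\<Sum>v\<in>?A. Poly_Mapping.lookup (x + y) v *\<^sub>q foldr op v w)"
    using keys_add[of x y] by (intro word_act_superset) auto
  then show ?thesis
    by (simp add: word_act_superset[of ?A] lookup_add scaleq_add_left sum.distrib)
qed

lemma word_act_single: "word_act op (Poly_Mapping.single v c) w = c *\<^sub>q foldr op v w"
  by (subst word_act_superset[of "{v}"]) auto

lemma foldr_linear: "(\<And>g. Cq_linear (op g)) \<Longrightarrow> Cq_linear (foldr op v)"
  by (induction v) (auto intro!: Cq_linearI simp: Cq_linear_add Cq_linear_scaleq)

lemma word_act_linear:
  assumes "\<And>g. Cq_linear (op g)"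
  shows "Cq_linear (word_act op x)"
  unfolding word_act_def
  by (rule Cq_linearI) (simp_all add: Cq_linear_add[OF foldr_linear[OF assms]]
    Cq_linear_scaleq[OF foldr_linear[OF assms]] scaleq_add_right sum.distrib
    Cq_space.scale_sum_right scaleq_scaleq mult.commute)

lemma word_act_mult:
  assumes lin: "\<And>g. Cq_linear (op g)"
  shows "word_act op (x * y) w = word_act op x (word_act op y w)"
proof (induction x rule: poly_mapping_additive_induct)
  case (single v c)
  show ?case
  proof (induction y rule: poly_mapping_additive_induct)
    case (single u d)
    show ?case
      by (simp add: mult_single word_act_single plus_list_def scaleq_scaleq
          Cq_linear_scaleq[OF foldr_linear[OF lin]])
  next
    case (add x y)
    then show ?case
      by (simp add: distrib_left word_act_add Cq_linear_add[OF word_act_linear[OF lin]])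
  qed
qed (simp add: distrib_right word_act_add)

definition free_act :: "('g::indexed_parity \<Rightarrow> 'w \<Rightarrow> 'w) \<Rightarrow> 'g free_alg \<Rightarrow> 'w::Cq_space \<Rightarrow> 'w" where
  "free_act op x = word_act op (Rep_free_alg x)"

lemma free_act_linear_left: "Cq_linear (\<lambda>x. free_act op x w)"
proof (rule Cq_linearI)
  fix x y :: "'a free_alg" and c
  show "free_act op (x + y) w = free_act op x w + free_act op y w"
    by (simp add: free_act_def plus_free_alg.rep_eq word_act_add)
  have "word_act op (Poly_Mapping.single 0 c * z) w = c *\<^sub>q word_act op z w" for z
    by (induction z rule: poly_mapping_additive_induct)
      (simp_all add: mult_single word_act_single scaleq_scaleq distrib_left word_act_add
          scaleq_add_right)
  then show "free_act op (c *\<^sub>q x) w = c *\<^sub>q free_act op x w"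
    by (simp add: free_act_def scaleq_free_alg_def Abs_free_alg_inverse)
qed

lemma free_act_gen: "free_act op (gen g) w = op g w"
  by (simp add: free_act_def gen.rep_eq word_act_single scaleq_one)

lemma free_act_one: "free_act op 1 w = w"
proof -
  have "free_act op 1 w = word_act op (Poly_Mapping.single 0 1) w"
    by (simp add: free_act_def one_free_alg.rep_eq)
  then show ?thesis
    by (simp add: word_act_single zero_list_def scaleq_one)
qed

locale presented_action =
  fixes op :: "'g::presentation \<Rightarrow> 'w::Cq_space \<Rightarrow> 'w"
  assumes linear: "Cq_linear (op g)"
    and relators: "x \<in> relators \<Longrightarrow> free_act op x w = 0"
begin

lemma free_act_mult: "free_act op (x * y) w = free_act op x (free_act op y w)"
  by (simp add: free_act_def times_free_alg.rep_eq word_act_mult linear)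

lemma free_act_linear: "Cq_linear (free_act op x)"
  unfolding free_act_def by (rule word_act_linear) (rule linear)

text \<open>The vector is kept arbitrary because in \<open>a * x * b\<close> the relator is applied
  to the image of \<open>w\<close> under \<open>b\<close>.\<close>

lemma free_act_ideal: "x \<in> two_sided_ideal relators \<Longrightarrow> free_act op x w = 0"
proof (induction arbitrary: w rule: two_sided_ideal.induct)
  case (mult x a b)
  then show ?case by (simp add: free_act_mult Cq_linear_zero[OF free_act_linear])
qed (simp_all add: relators Cq_linear_zero[OF free_act_linear_left] Cq_linear_add[OF
    free_act_linear_left])

lift_definition act :: "'g presented \<Rightarrow> 'w \<Rightarrow> 'w" is "free_act op"
proof
  fix x y :: "'g free_alg" and w
  assume "x - y \<in> two_sided_ideal relators"
  then have "free_act op (x - y) w = 0"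
    by (rule free_act_ideal)
  then show "free_act op x w = free_act op y w"
    by (simp add: Cq_linear_diff[OF free_act_linear_left])
qed

lemma act_linear_left: "Cq_linear (\<lambda>x. act x w)"
proof (rule Cq_linearI)
  show "act (x + y) w = act x w + act y w" for x y
    by transfer (rule Cq_linear_add[OF free_act_linear_left])
  show "act (c *\<^sub>q x) w = c *\<^sub>q act x w" for c x
    by transfer (rule Cq_linear_scaleq[OF free_act_linear_left])
qed

lemma act_linear: "Cq_linear (act x)"
  by transfer (rule free_act_linear)

lemma act_mult: "act (x * y) w = act x (act y w)"
  by transfer (rule free_act_mult)

lemma act_one: "act 1 w = w"
  by transfer (rule free_act_one)

lemma act_gen: "act (pgen g) w = op g w"
  by transfer (rule free_act_gen)

end

text \<open>Words are built by adding generators on the left, in step with the way a product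
  acts.\<close>

lemma presented_induct [case_names one gen add scale]:
  fixes x :: "'g::presentation presented"
  assumes one: "P 1" and gen: "\<And>g x. P x \<Longrightarrow> P (pgen g * x)"
    and add: "\<And>x y. P x \<Longrightarrow> P y \<Longrightarrow> P (x + y)" and scale: "\<And>c x. P x \<Longrightarrow> P (c *\<^sub>q x)"
  shows "P x"
proof -
  have word: "P (abs_presented (Abs_free_alg (Poly_Mapping.single v 1)))" for v
  proof (induction v)
    case Nil
    have "Poly_Mapping.single [] 1 = (1 :: 'g list \<Rightarrow>\<^sub>0 Cq)"
      by (simp add: zero_list_def[symmetric])
    then show ?case
      using one by (simp add: one_presented_def one_free_alg_def)
  next
    case (Cons g v)
    have "Abs_free_alg (Poly_Mapping.single (g # v) 1) =
        gen g * Abs_free_alg (Poly_Mapping.single v (1::Cq))"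
      by (simp add: gen_def times_free_alg_def Abs_free_alg_inverse mult_single plus_list_def)
    then show ?case
      using gen[OF Cons, of g] by (simp add: pgen.abs_eq times_presented.abs_eq)
  qed
  have "P (abs_presented (Abs_free_alg y))" for y
  proof (induction y rule: poly_mapping_additive_induct)
    case (single v c)
    have "Abs_free_alg (Poly_Mapping.single v c) =
        c *\<^sub>q Abs_free_alg (Poly_Mapping.single v 1)"
      by (simp add: scaleq_free_alg_def Abs_free_alg_inverse mult_single)
    then show ?case
      using scale[OF word, of c v] by (simp add: scaleq_presented.abs_eq)
  next
    case (add x y)
    then show ?case
      using assms(3)[OF add] by (simp add: plus_presented.abs_eq plus_free_alg.abs_eq)
  qed
  moreover obtain y where "x = abs_presented (Abs_free_alg y)"
    by (metis Quotient3_abs_rep[OF Quotient3_presented] Rep_free_alg_inverse)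
  ultimately show ?thesis by simp
qed

lemma abs_presented_relator:
  assumes "x \<in> relators"
  shows "abs_presented x = 0"
  using two_sided_ideal.base[OF assms] by (simp add: zero_presented_def presented.abs_eq_iff)

lemma abs_presented_linear: "Cq_linear abs_presented"
  by (rule Cq_linearI) (simp_all add: plus_presented.abs_eq scaleq_presented.abs_eq)

section \<open>The algebra A acting on columns\<close>

instantiation "fun" :: (type, Cq_space) Cq_space
begin

definition scaleq_fun :: "Cq \<Rightarrow> ('a \<Rightarrow> 'b) \<Rightarrow> 'a \<Rightarrow> 'b" where
  "c *\<^sub>q f = (\<lambda>x. c *\<^sub>q f x)"

instance
  by standard (simp_all add: scaleq_fun_def plus_fun_def fun_eq_iff scaleq_add_right scaleq_add_left
    scaleq_scaleq scaleq_one)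

end

lemma fun_eval_linear: "Cq_linear (\<lambda>f. f x)"
  by (rule Cq_linearI) (simp_all add: scaleq_fun_def plus_fun_def)

lemma if_hom: "f (if P then u else v) = (if P then f u else f v)"
  by simp

lemma crossing_hom: "Cq_linear L \<Longrightarrow> L (crossing F b p) = crossing (\<lambda>c a. L (F c a)) b p"
  by (simp add: crossing_def Cq_linear_diff Cq_linear_scaleq Cq_linear_zero if_hom[of L])

lemma braid_bar_hom: "Cq_linear L \<Longrightarrow> L (braid_bar F a b) = braid_bar (\<lambda>a b. L (F a b)) a b"
  by (simp add: braid_bar_def Cq_linear_diff Cq_linear_add Cq_linear_scaleq Cq_linear_zero if_hom[of L])

lemma t_defect_hom: "Cq_linear L \<Longrightarrow> L (t_defect P i a k b) = t_defect (\<lambda>i a k b. L (P i a k b)) i a k b"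
  by (simp add: t_defect_def Let_def Cq_linear_diff Cq_linear_add Cq_linear_scaleq Cq_linear_zero
      if_hom[of L])

lemma tbar_defect_hom: "Cq_linear L \<Longrightarrow> L (tbar_defect P i a k b) =
    tbar_defect (\<lambda>i a k b. L (P i a k b)) i a k b"
  by (simp add: tbar_defect_def Let_def Cq_linear_diff Cq_linear_add Cq_linear_scaleq
      Cq_linear_zero if_hom[of L])

text \<open>The kernel of \<open>crossing\<close>, that is, the entries of S^{-1} with the super
  signs included. The conditions are nested so that \<open>sum_delta2\<close> collapses double
  sums.\<close>

definition crossing_coeff :: "'n::finite sidx \<Rightarrow> 'n sidx \<Rightarrow> 'n sidx \<Rightarrow> 'n sidx \<Rightarrow> Cq" where
  "crossing_coeff b p c a = (if b = c \<and> p = a then sgn_pow (par b * par p) *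
      qvar powi (- phi b p) else 0)
     - (if p = c \<and> b = a then if p < b then qxi else 0 else 0)
     - (if - p = c \<and> - b = a then if p < - b then sgn_pow (par p) * qxi else 0 else 0)"

lemma crossing_eq_sum: "crossing F b p = (\<Sum>c\<in>UNIV. \<Sum>a\<in>UNIV. crossing_coeff b p c a *\<^sub>q F c a)"
proof -
  have "crossing_coeff b p c a *\<^sub>q F c a =
    (if b = c \<and> p = a then (sgn_pow (par b * par p) * qvar powi (- phi b p)) *\<^sub>q F b p else 0)
     - (if p = c \<and> b = a then if p < b then qxi *\<^sub>q F p b else 0 else 0)
     - (if - p = c \<and> - b = a then if p < - b then (sgn_pow (par p) * qxi) *\<^sub>q
         F (- p) (- b) else 0 else 0)" for c a
  proof -
    have if_F: "(if P then u else 0) *\<^sub>q F c a = (if P then u *\<^sub>q F c a else 0)" for P u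
      by simp
    have "(if b = c \<and> p = a then u *\<^sub>q F c a else 0) = (if b = c \<and> p = a then u *\<^sub>q F b p else 0)"
      "(if p = c \<and> b = a then (if p < b then u *\<^sub>q F c a else 0) else 0) = (if p = c \<and> b =
          a then if p < b then u *\<^sub>q F p b else 0 else 0)"
      "(if - p = c \<and> - b = a then (if p < - b then u *\<^sub>q F c a else 0) else 0) = (if - p =
          c \<and> - b = a then if p < - b then u *\<^sub>q F (- p) (- b) else 0 else 0)" for u
      by auto
    then show ?thesis
      by (simp only: crossing_coeff_def Cq_space.scale_left_diff_distrib if_F)
  qed
  then show ?thesis
    by (simp add: sum_subtractf sum_delta2 crossing_def)
qed

lemma crossing_sum: "crossing (\<lambda>c a. \<Sum>x\<in>X. F x c a) b p = (\<Sum>x\<in>X. crossing (F x) b p)"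
  by (simp add: crossing_def sum_subtractf Cq_space.scale_sum_right)

lemma braid_bar_sum: "braid_bar (\<lambda>a b. \<Sum>x\<in>X. F x a b) a b = (\<Sum>x\<in>X. braid_bar (F x) a b)"
  by (simp add: braid_bar_def sum.distrib Cq_space.scale_sum_right)

lemma t_elt_uminus: "t_elt (- i) (- a) = (t_elt i a :: ('r::finite, 'n::finite) A)"
proof -
  have "free_t i a - free_t (- i) (- a) \<in> (relators :: ('r, 'n) t_gen free_alg set)"
    unfolding relators_t_gen_def by blast
  from abs_presented_relator[OF this] show ?thesis
    by (simp add: Cq_linear_diff[OF abs_presented_linear] t_elt_def pgen.abs_eq)
qed

lemma t_relator_mem: "t_relator i a k b \<in> relators"
  unfolding relators_t_gen_def t_relator_def by blast

lemma mult_if_zero: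
  "(if P then u else 0) * v = (if P then u * v else (0 :: 'a::ring))"
  "v * (if P then u else 0) = (if P then v * u else (0 :: 'a::ring))"
  by simp_all

lemma t_defect_t_elt: "t_defect (\<lambda>i a k b. t_elt i a * t_elt k b) i a k b =
    (0 :: ('r::finite, 'n::finite) A)"
proof -
  have t: "t_elt i a * t_elt k b = abs_presented (free_t i a *
      free_t k b)" for i k :: "'r sidx" and a b :: "'n sidx"
    by (simp add: t_elt_def pgen.abs_eq times_presented.abs_eq)
  have "abs_presented (t_relator i a k b) = sgn_pow ((par i + par a) * (par k + par b)) *\<^sub>q
      (t_defect (\<lambda>i a k b. t_elt i a * t_elt k b) i a k b :: ('r, 'n) A)"
    by (rule t_relator_linear[OF abs_presented_linear t]) (simp_all add: t_elt_uminus)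
  then show ?thesis
    by (simp add: abs_presented_relator[OF t_relator_mem] sgn_pow_def split: if_splits)
qed

lemma t_defect_pos:
  assumes "sidx_pos i" "sidx_pos k"
  shows "t_defect P i a k b =
    (qvar powi phi i k) *\<^sub>q P i a k b + (if k < i then qxi *\<^sub>q P k a i b else 0) -
     ((sgn_pow (par a * par b) * qvar powi phi a b) *\<^sub>q P k b i a
     + (if a < b then qxi *\<^sub>q P k a i b else 0)
     + (if - a < b then (sgn_pow (par b) * qxi) *\<^sub>q P k (- a) i (- b) else 0))"
  using assms by (simp add: t_defect_def par_pos sidx_pos_simps)

lemma sum_uminus_sidx: "(\<Sum>a\<in>UNIV. f (- a)) = (\<Sum>a\<in>(UNIV :: 'n::finite sidx set). f a)"
  by (rule sum.reindex_bij_witness[of _ uminus uminus]) simp_all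

lemma sum_uminus_sidx2:
  "(\<Sum>a\<in>UNIV. \<Sum>b\<in>UNIV. f (- a) (- b)) =
    (\<Sum>a\<in>(UNIV :: 'n::finite sidx set). \<Sum>b\<in>(UNIV :: 'm::finite sidx set). f a b)"
  using sum_uminus_sidx[of "\<lambda>a. \<Sum>b\<in>UNIV. f a b"] by (simp only: sum_uminus_sidx)

definition t_quad :: "'r::finite sidx \<Rightarrow> 'r sidx \<Rightarrow> ('n::finite sidx \<Rightarrow> 'n sidx \<Rightarrow> ('r, 'n) A) \<Rightarrow> ('r,
    'n) A" where
  "t_quad i k G = (\<Sum>p\<in>UNIV. \<Sum>q\<in>UNIV. t_elt i p * (t_elt k q * G p q))"

text \<open>The quadratic relations of A, summed against an arbitrary array \<open>G\<close>.
  Reindexing the sums moves the coefficients from the products of generators to \<open>G\<close>,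
  where they form \<open>braid\<close>.\<close>

lemma t_quad_braid:
  assumes pos: "sidx_pos i" "sidx_pos k"
  shows "(qvar powi phi i k) *\<^sub>q t_quad i k G + (if k < i then qxi *\<^sub>q t_quad k i G else 0) =
      t_quad k i (braid G)"
proof -
  let ?P = "\<lambda>i a k b. t_elt i a * t_elt k b"
  have "0 = (\<Sum>p\<in>UNIV. \<Sum>q\<in>UNIV. t_defect ?P i p k q * G p q)"
    by (simp add: t_defect_t_elt)
  also have "\<dots> = (qvar powi phi i k) *\<^sub>q t_quad i k G + (if k < i then qxi *\<^sub>q t_quad k i G else 0) -
     ((\<Sum>p\<in>UNIV. \<Sum>q\<in>UNIV. (sgn_pow (par p * par q) * qvar powi phi p q) *\<^sub>q (t_elt k q *
         (t_elt i p * G p q)))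
     + (\<Sum>p\<in>UNIV. \<Sum>q\<in>UNIV. if p < q then qxi *\<^sub>q (t_elt k p * (t_elt i q * G p q)) else 0)
     + (\<Sum>p\<in>UNIV. \<Sum>q\<in>UNIV. if - p < q then (sgn_pow (par q) * qxi) *\<^sub>q (t_elt k (- p) *
         (t_elt i (- q) * G p q)) else 0))"
    unfolding t_defect_pos[OF pos] t_quad_def
    by (simp add: left_diff_distrib distrib_right scaleq_mult_left sum_subtractf sum.distrib
        Cq_space.scale_sum_right mult.assoc mult_if_zero cong: if_cong)
  also have "(\<Sum>p\<in>UNIV. \<Sum>q\<in>UNIV. (sgn_pow (par p * par q) * qvar powi phi p q) *\<^sub>q (t_elt k q *
      (t_elt i p * G p q))) =
    (\<Sum>p\<in>UNIV. \<Sum>q\<in>UNIV. (sgn_pow (par p * par q) * qvar powi phi q p) *\<^sub>q (t_elt k p * (t_elt i q *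
        G q p)))"
    by (subst sum.swap) (simp add: mult.commute)
  \<comment> \<open>Both summation indices are negated; the parity of \<open>q\<close> then changes
    by one, which is the minus sign of the last term of \<open>braid\<close>.\<close>
  also have "(\<Sum>p\<in>UNIV. \<Sum>q\<in>UNIV. if - p < q then (sgn_pow (par q) * qxi) *\<^sub>q (t_elt k (- p) *
      (t_elt i (- q) * G p q)) else 0) =
    (\<Sum>p\<in>UNIV. \<Sum>q\<in>UNIV. if p < - q then (sgn_pow (par q + 1) * qxi) *\<^sub>q (t_elt k p * (t_elt i q *
        G (- p) (- q))) else 0)"
    by (subst sum_uminus_sidx2[symmetric]) (simp add: par_uminus_sidx cong: if_cong)
  also have "((\<Sum>p\<in>UNIV. \<Sum>q\<in>UNIV. (sgn_pow (par p * par q) * qvar powi phi q p) *\<^sub>q (t_elt k p *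
      (t_elt i q * G q p)))
     + (\<Sum>p\<in>UNIV. \<Sum>q\<in>UNIV. if p < q then qxi *\<^sub>q (t_elt k p * (t_elt i q * G p q)) else 0)
     + (\<Sum>p\<in>UNIV. \<Sum>q\<in>UNIV. if p < - q then (sgn_pow (par q + 1) * qxi) *\<^sub>q (t_elt k p *
         (t_elt i q * G (- p) (- q))) else 0))
     = t_quad k i (braid G)"
    unfolding t_quad_def braid_def
    by (simp add: distrib_left right_diff_distrib scaleq_mult_right sum_subtractf sum.distrib
        sgn_pow_add
        mult_if_zero sum_negf[symmetric] if_hom[of uminus] cong: if_cong flip:
            Cq_space.scale_minus_left)
  finally show ?thesis by simp
qed

text \<open>The matrix by which t_{ia} acts on columns is the component (i, a) in the second slot of
  T_+^2 (S^{-1})^{12}. The indicator of \<open>y = a\<close> selects the column in that slot, and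
  \<open>w\<close> fills the column index of the first slot.\<close>

definition t_row :: "'r::finite sidx \<Rightarrow> 'n::finite sidx \<Rightarrow> ('n sidx \<Rightarrow> ('r, 'n) A) \<Rightarrow> 'n sidx \<Rightarrow> ('r,
    'n) A" where
  "t_row i a w b = (\<Sum>p\<in>UNIV. t_elt i p * crossing (\<lambda>c y. if y = a then w c else 0) b p)"

text \<open>Negative rows are routed through t_{ia} = t_{-i,-a}, so this relation holds by
  construction.\<close>

definition t_op :: "('r::finite, 'n::finite) t_gen \<Rightarrow> ('n sidx \<Rightarrow> ('r, 'n) A) \<Rightarrow> 'n sidx \<Rightarrow> ('r,
    'n) A" where
  "t_op g = (case g of T_gen i a \<Rightarrow> if sidx_pos i then t_row i a else t_row (- i) (- a))"

lemma crossing_linear: "Cq_linear (\<lambda>F. crossing F b p)"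
  unfolding crossing_def
  by (rule Cq_linearI) (simp_all add: scaleq_fun_def plus_fun_def scaleq_add_right
      Cq_space.scale_right_diff_distrib scaleq_scaleq mult.commute)

lemma t_row_linear:
  fixes i :: "'r::finite sidx" and a :: "'n::finite sidx"
  shows "Cq_linear (t_row i a)"
proof (rule Cq_linearI)
  have add: "(if P then u + v else 0) = (if P then u else 0) + (if P then v else (0 :: ('r, 'n) A))" 
    and scale: "(if P then c *\<^sub>q u else 0) = c *\<^sub>q (if P then u else (0 :: ('r, 'n) A))" for P u v c
    by simp_all
  fix v w :: "'n sidx \<Rightarrow> ('r, 'n) A" and c
  show "t_row i a (v + w) = t_row i a v + t_row i a w"
    using Cq_linear_add[OF crossing_linear, of "\<lambda>c y. if y = a then v c else 0" "\<lambda>c y. if y =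
        a then w c else 0"]
    by (simp add: t_row_def fun_eq_iff plus_fun_def add distrib_left sum.distrib)
  show "t_row i a (c *\<^sub>q v) = c *\<^sub>q t_row i a v"
    using Cq_linear_scaleq[OF crossing_linear, of c "\<lambda>c y. if y = a then v c else 0"]
    by (simp add: t_row_def fun_eq_iff scaleq_fun_def scale scaleq_mult_right Cq_space.scale_sum_right)
qed

lemma t_op_linear: "Cq_linear (t_op g)"
  by (cases g) (simp add: t_op_def t_row_linear)

lemma t_op_uminus: "t_op (T_gen (- i) (- a)) = t_op (T_gen i a)"
proof -
  have "sidx_pos (- i) \<longleftrightarrow> \<not> sidx_pos i"
    unfolding sidx_pos_def by transfer auto
  then show ?thesis by (simp add: t_op_def)
qed

lemma t_row_t_row:
  "t_row i a (t_row k b w) d =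
    t_quad i k (\<lambda>p q. crossing (\<lambda>e y. crossing (\<lambda>c z. if y = a \<and> z = b then w c else 0) e q) d p)"
proof -
  have inner: "(if y = a then t_row k b w e else 0) =
      (\<Sum>q\<in>UNIV. t_elt k q * crossing (\<lambda>c z. if y = a \<and> z = b then w c else 0) e q)" for y e
    by (cases "y = a") (simp_all add: t_row_def crossing_def cong: if_cong)
  show ?thesis
    unfolding t_row_def[of i] inner crossing_sum t_quad_def
    by (simp add: sum_distrib_left flip: crossing_hom[OF Cq_linear_mult(2)])
qed

lemma t_quad_linear: "Cq_linear (t_quad i k)"
  by (rule Cq_linearI) (simp_all add: t_quad_def scaleq_fun_def plus_fun_def distrib_left sum.distrib
      scaleq_mult_right Cq_space.scale_sum_right)

text \<open>\<open>t_quad_braid\<close> turns the row side of the relation into one braided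
  composite. The Yang-Baxter identity carries the braiding through both crossings to the column
  labels, where it produces the column side.\<close>

lemma t_defect_t_row:
  fixes i k :: "'r::finite sidx" and a b d :: "'n::finite sidx"
  assumes pos: "sidx_pos i" "sidx_pos k"
  shows "t_defect (\<lambda>i a k b. t_row i a (t_row k b w) d) i a k b = 0"
proof -
  define L where "L F = t_quad k i (\<lambda>p q. crossing (\<lambda>e y. crossing (\<lambda>c z. F c y z) e q) d p)" for
      F :: "'n sidx \<Rightarrow> 'n sidx \<Rightarrow> 'n sidx \<Rightarrow> ('r, 'n) A"
  define D where "D a b c y z = (if y = a \<and> z = b then w c else 0)" for a b c y z :: "'n sidx"
  note pointwise = Cq_linear_add[OF crossing_linear, unfolded plus_fun_def]
    Cq_linear_scaleq[OF crossing_linear, unfolded scaleq_fun_def]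
    Cq_linear_add[OF t_quad_linear, unfolded plus_fun_def]
    Cq_linear_scaleq[OF t_quad_linear, unfolded scaleq_fun_def]
  have L: "Cq_linear L"
    unfolding L_def
    by (rule Cq_linearI) (simp_all add: plus_fun_def scaleq_fun_def pointwise)
  have rows: "t_row k a (t_row i b w) d = L (D a b)" for a b
    by (simp add: t_row_t_row L_def D_def)
  have "(qvar powi phi i k) *\<^sub>q t_row i a (t_row k b w) d
      + (if k < i then qxi *\<^sub>q t_row k a (t_row i b w) d else 0) =
      t_quad k i (braid (\<lambda>p q. crossing (\<lambda>e y. crossing (\<lambda>c z. D a b c y z) e q) d p))"
    unfolding t_row_t_row D_def by (rule t_quad_braid[OF pos])
  also have "\<dots> = L (\<lambda>c. braid (D a b c))"
    unfolding L_def by (rule arg_cong[where f = "t_quad k i"]) (intro ext yang_baxter_left)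
  \<comment> \<open>\<open>D a b\<close> is supported at the arguments (a, b), so braiding the
    arguments amounts to changing the labels, up to coefficients.\<close>
  also have "(\<lambda>c. braid (D a b c)) = (sgn_pow (par a * par b) * qvar powi phi a b) *\<^sub>q D b a
     + (if a < b then qxi *\<^sub>q D a b else 0)
     + (if - a < b then (sgn_pow (par b) * qxi) *\<^sub>q D (- a) (- b) else 0)"
  proof (intro ext)
    fix c y z
    have 1: "(sgn_pow (par y * par z) * qvar powi phi z y) *\<^sub>q D a b c z y =
        (sgn_pow (par a * par b) * qvar powi phi a b) *\<^sub>q D b a c y z"
      by (cases "z = a"; cases "y = b"; simp add: D_def mult.commute)
    have 2: "(if y < z then qxi *\<^sub>q D a b c y z else 0) = (if a < b then qxi *\<^sub>q D a b c y z else 0)"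
      by (cases "y = a"; cases "z = b"; simp add: D_def)
    have 3: "(if y < - z then (sgn_pow (par z) * qxi) *\<^sub>q D a b c (- y) (- z) else 0) =
        - (if - a < b then (sgn_pow (par b) * qxi) *\<^sub>q D (- a) (- b) c y z else 0)"
    proof (cases "y = - a \<and> z = - b")
      case True
      then show ?thesis by (simp add: D_def par_uminus_sidx sgn_pow_add)
    next
      case False
      then have "\<not> (- y = a \<and> - z = b)" by auto
      with False show ?thesis by (auto simp: D_def)
    qed
    show "braid (D a b c) y z = ((sgn_pow (par a * par b) * qvar powi phi a b) *\<^sub>q D b a
     + (if a < b then qxi *\<^sub>q D a b else 0)
     + (if - a < b then (sgn_pow (par b) * qxi) *\<^sub>q D (- a) (- b) else 0)) c y z"
      unfolding braid_def 1 2 3 by (simp add: plus_fun_def scaleq_fun_def zero_fun_def)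
  qed
  finally show ?thesis
    unfolding t_defect_pos[OF pos] rows Cq_linear_add[OF L] Cq_linear_scaleq[OF L] if_hom[of L]
      Cq_linear_zero[OF L]
    by (simp add: add.assoc)
qed

lemma presented_action_t_op:
  "presented_action (t_op :: ('r::finite, 'n::finite) t_gen \<Rightarrow> ('n sidx \<Rightarrow> ('r, 'n) A) \<Rightarrow> _)"
proof (rule presented_action.intro)
  show "Cq_linear (t_op g)" for g :: "('r, 'n) t_gen"
    by (rule t_op_linear)
  fix x :: "('r, 'n) t_gen free_alg" and w :: "'n sidx \<Rightarrow> ('r, 'n) A"
  have mult: "free_act t_op (x * y) w = free_act t_op x (free_act t_op y w)" for x y :: "('r,
      'n) t_gen free_alg"
    by (simp add: free_act_def times_free_alg.rep_eq word_act_mult t_op_linear)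
  assume "x \<in> relators"
  then consider i a where "x = free_t i a - free_t (- i) (- a)"
    | i a j b where "x = t_relator i a j b"
    unfolding relators_t_gen_def t_relator_def by blast
  then show "free_act t_op x w = 0"
  proof cases
    case 1
    then show ?thesis
      by (simp add: Cq_linear_diff[OF free_act_linear_left] free_act_gen t_op_uminus)
  next
    case 2
    define P where "P i a k b = t_op (T_gen i a) (t_op (T_gen k b) w)" for i k :: "'r sidx" and a b
    have sym: "P (- i) (- a) k b = P i a k b" "P i a (- k) (- b) = P i a k b" for i a k b
      by (simp_all add: P_def t_op_uminus)
    have "t_defect P i a k b = 0" for i a k b
    proof (rule t_defect_zeroI[where P = P, OF sym])
      fix i k :: "'r sidx" and a b :: "'n sidx"
      assume pos: "sidx_pos i" "sidx_pos k"
      show "t_defect P i a k b = 0"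
      proof
        fix d
        have "t_defect P i a k b d = t_defect (\<lambda>i a k b. P i a k b d) i a k b"
          by (rule t_defect_hom[OF fun_eval_linear])
        also have "\<dots> = t_defect (\<lambda>i a k b. t_row i a (t_row k b w) d) i a k b"
          using pos by (simp add: t_defect_pos P_def t_op_def)
        finally show "t_defect P i a k b d = 0 d"
          by (simp add: t_defect_t_row[OF pos])
      qed
    qed
    then show ?thesis
      unfolding 2
      by (subst t_relator_linear[where P = P])
        (simp_all add: free_act_linear_left sym, simp add: P_def mult free_act_gen)
  qed
qed

interpretation t_action: presented_action t_op
  by (rule presented_action_t_op)

section \<open>Matrix coefficients of the action\<close>

text \<open>Applied to three right multiplications: of columns by A, of tensors by 1 \<otimes> h,
  and for the twisted product.\<close>

lemma (in presented_action) act_commute: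
  assumes T: "Cq_linear T" and comm: "\<And>g w. T (op g w) = op g (T w)"
  shows "T (act x w) = act x (T w)"
proof (induction x arbitrary: w rule: presented_induct)
  case one
  show ?case by (simp add: act_one)
next
  case (gen g x)
  then show ?case by (simp add: act_mult act_gen comm)
next
  case (add x y)
  then show ?case by (simp add: Cq_linear_add[OF act_linear_left] Cq_linear_add[OF T])
next
  case (scale c x)
  then show ?case by (simp add: Cq_linear_scaleq[OF act_linear_left] Cq_linear_scaleq[OF T])
qed

lemma A_induct [case_names one gen add scale]:
  fixes f :: "('r::finite, 'n::finite) A"
  assumes one: "P 1" and gen: "\<And>i a f. sidx_pos i \<Longrightarrow> P f \<Longrightarrow> P (t_elt i a * f)"
    and add: "\<And>f g. P f \<Longrightarrow> P g \<Longrightarrow> P (f + g)" and scale: "\<And>c f. P f \<Longrightarrow> P (c *\<^sub>q f)"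
  shows "P f"
proof (induction f rule: presented_induct)
  case (gen g f)
  obtain i a where g: "g = T_gen i a" by (cases g)
  obtain x where x: "sidx_pos x" "i = x \<or> i = - x" by (rule sidx_pos_cases)
  then have "pgen g = t_elt x a \<or> pgen g = t_elt x (- a)"
    using t_elt_uminus[of x "- a"] by (auto simp: g t_elt_def)
  then show ?case using assms(2)[OF x(1) gen] by metis
qed (fact assms)+

text \<open>The coefficients \<rho>_{bc}(f), obtained from the action on unit columns.\<close>

definition tmat :: "('r::finite, 'n::finite) A \<Rightarrow> 'n sidx \<Rightarrow> 'n sidx \<Rightarrow> ('r, 'n) A" where
  "tmat f b c = t_action.act f (\<lambda>x. if x = c then 1 else 0) b"

lemma fun_sum_apply: "(\<Sum>x\<in>X. F x) b = (\<Sum>x\<in>X. F x b)" for F :: "_ \<Rightarrow> _ \<Rightarrow> 'v::Cq_space"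
  by (rule Cq_linear_sum[OF fun_eval_linear])

lemma t_row_mult_right: "t_row i a (\<lambda>x. w x * u) b = t_row i a w b * u"
  by (simp add: t_row_def sum_distrib_right mult.assoc mult_if_zero crossing_hom[OF Cq_linear_mult(1)])

text \<open>The operators commute with right multiplication by A, so the unit columns determine
  them.\<close>

lemma act_eq_tmat: "t_action.act f w b = (\<Sum>c\<in>UNIV. tmat f b c * w c)"
proof -
  have T: "Cq_linear (\<lambda>w x. w x * u)" for u :: "('a, 'b) A"
    by (rule Cq_linearI) (simp_all add: fun_eq_iff plus_fun_def scaleq_fun_def distrib_right
        scaleq_mult_left)
  have "t_op g (\<lambda>x. w x * u) = (\<lambda>x. t_op g w x * u)" for g :: "('a, 'b) t_gen" and w u
    by (cases g) (simp add: t_op_def t_row_mult_right fun_eq_iff)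
  then have right: "t_action.act f (\<lambda>x. w x * u) = (\<lambda>x. t_action.act f w x * u)" for w u
    using t_action.act_commute[OF T, where x = f] by simp
  have "w = (\<Sum>c\<in>UNIV. (\<lambda>x. (if x = c then 1 else 0) * w c))"
    by (simp add: fun_eq_iff fun_sum_apply mult_if_zero)
  then have "t_action.act f w b = t_action.act f (\<Sum>c\<in>UNIV. (\<lambda>x. (if x = c then 1 else 0) * w c)) b"
    by simp
  also have "\<dots> = (\<Sum>c\<in>UNIV. tmat f b c * w c)"
    by (simp only: Cq_linear_sum[OF t_action.act_linear] fun_sum_apply right tmat_def)
  finally show ?thesis .
qed

lemma tmat_linear: "Cq_linear (\<lambda>f. tmat f b c)"
  unfolding tmat_def by (rule Cq_linear_comp[OF fun_eval_linear t_action.act_linear_left])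

lemma tmat_one: "tmat 1 b c = (if b = c then 1 else 0)"
  by (simp add: tmat_def t_action.act_one)

lemma tmat_mult: "tmat (f * g) b c = (\<Sum>e\<in>UNIV. tmat f b e * tmat g e c)"
  by (simp add: tmat_def[of "f * g"] t_action.act_mult act_eq_tmat[of f] flip: tmat_def)

lemma tmat_t_elt:
  assumes "sidx_pos i"
  shows "tmat (t_elt i a) b c = (\<Sum>p\<in>UNIV. crossing_coeff b p c a *\<^sub>q t_elt i p)"
proof -
  have "crossing (\<lambda>c' y. if y = a then if c' = c then 1 else 0 else 0) b p =
      crossing_coeff b p c a *\<^sub>q (1 :: ('a, 'b) A)" for p
  proof -
    have "crossing_coeff b p c' y *\<^sub>q (if y = a then if c' = c then 1 else 0 else 0) =
        (if c = c' \<and> a = y then crossing_coeff b p c a *\<^sub>q (1 :: ('a, 'b) A) else 0)" for c' y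
      by auto
    then show ?thesis
      by (simp add: crossing_eq_sum sum_delta2)
  qed
  then show ?thesis
    using assms by (simp add: tmat_def t_elt_def[of i a] t_action.act_gen t_op_def t_row_def
        scaleq_mult_right)
qed

text \<open>The symmetry of S^{-1} in its first slot: the diagonal exponent is unchanged and the two
  off-diagonal terms trade places.\<close>

lemma crossing_coeff_uminus:
  "sgn_pow (par a) * crossing_coeff (- b) p (- c) a = sgn_pow (par b + par c) * crossing_coeff b p c a"
proof -
  have phi: "phi (- b) p = phi b p"
    by (auto simp: phi_def sidx_eq_uminus)
  have *: "- b = - c \<longleftrightarrow> b = c" "p = - c \<longleftrightarrow> - p = c" "- p = - c \<longleftrightarrow> p = c"
    by (auto simp: sidx_eq_uminus)
  let ?s = "sgn_pow (par a) :: Cq" and ?t = "sgn_pow (par b + par c) :: Cq"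
  have 1: "?s * (if b = c \<and> p = a then sgn_pow (par (- b) * par p) * qvar powi (- phi b p) else 0) =
      ?t * (if b = c \<and> p = a then sgn_pow (par b * par p) * qvar powi (- phi b p) else 0)"
    using bit_disj[of "par p"] bit_disj[of "par c"] by (auto simp: par_uminus_sidx)
  have 2: "?s * (if - p = c \<and> - b = a then if p < - b then qxi else 0 else 0) =
      ?t * (if - p = c \<and> - b = a then if p < - b then sgn_pow (par p) * qxi else 0 else 0)"
    using bit_disj[of "par p"] bit_disj[of "par b"] by (auto simp: par_uminus_sidx)
  have 3: "?s * (if p = c \<and> b = a then if p < b then sgn_pow (par p) * qxi else 0 else 0) =
      ?t * (if p = c \<and> b = a then if p < b then qxi else 0 else 0)"
    using bit_disj[of "par p"] bit_disj[of "par b"] by (auto simp: par_uminus_sidx)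
  show ?thesis
    unfolding crossing_coeff_def phi * uminus_uminus_sidx right_diff_distrib 1 2 3 by simp
qed

lemma hpart_t_elt: "hpart (par i + par a) (t_elt i a) = t_elt i a"
  by (simp add: t_elt_def pgen.abs_eq hpart_presented.abs_eq hpart_free_t)

lemma twist_t_elt: "sidx_pos i \<Longrightarrow> twist d (t_elt i a) = sgn_pow (par a * d) *\<^sub>q t_elt i a"
  using twist_homogeneous[OF hpart_t_elt, of d i a] by (simp add: par_pos sgn_pow_scaleq)

lemma twist_one: "twist d 1 = 1"
  by (simp add: twist_def hpart_one)

text \<open>Passes from generators to products because the inner index of a matrix product may be
  negated. It makes the action of bar A respect the symmetry of its generators.\<close>

lemma tmat_uminus: "tmat (twist 1 f) (- b) (- c) = sgn_pow (par b + par c) *\<^sub>q tmat f b c"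
proof (induction f arbitrary: b c rule: A_induct)
  case one
  show ?case by (simp add: tmat_one twist_one sidx_eq_uminus scaleq_one)
next
  case (gen i a f)
  have t: "sgn_pow (par a) *\<^sub>q tmat (t_elt i a) (- b) (- c) =
      sgn_pow (par b + par c) *\<^sub>q tmat (t_elt i a) b c" for b c
    by (simp add: tmat_t_elt[OF gen(1)] Cq_space.scale_sum_right scaleq_scaleq crossing_coeff_uminus)
  have "tmat (twist 1 (t_elt i a * f)) (- b) (- c) =
      (\<Sum>e\<in>UNIV. (sgn_pow (par a) *\<^sub>q tmat (t_elt i a) (- b) (- e)) * tmat (twist 1 f) (- e) (- c))"
    by (subst sum_uminus_sidx) (simp add: twist_mult twist_t_elt[OF gen(1)] scaleq_mult_left
        Cq_linear_scaleq[OF tmat_linear] tmat_mult Cq_space.scale_sum_right)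
  also have "\<dots> = sgn_pow (par b + par c) *\<^sub>q tmat (t_elt i a * f) b c"
    by (simp add: t gen(2) tmat_mult Cq_space.scale_sum_right scaleq_mult_left scaleq_mult_right
        scaleq_scaleq
        ac_simps flip: sgn_pow_add)
  finally show ?case .
next
  case (add f g)
  then show ?case by (simp add: twist_add Cq_linear_add[OF tmat_linear] scaleq_add_right)
next
  case (scale k f)
  then show ?case by (simp add: twist_scaleq Cq_linear_scaleq[OF tmat_linear] scaleq_scaleq
      mult.commute)
qed

section \<open>Passing two generators of bar A in succession\<close>

lemma tensor_mult_left: "(u \<otimes> 1) * (f \<otimes> g) = (u * f) \<otimes> (g :: 'b::superalgebra)"
  for u f :: "'a::superalgebra"
  by (simp add: times_tensor_pure hpart_one)

lemma tensor_mult_right: "(f \<otimes> g) * (1 \<otimes> h) = f \<otimes> (g * (h :: 'b::superalgebra))"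
  for f :: "'a::superalgebra"
  by (simp add: times_tensor_pure twist_one hpart_sum flip: tensor_pure_simps(3) distrib_right)

lemma tensor_left_linear: "Cq_linear (\<lambda>u. (u \<otimes> 1) * (v :: 'a::superalgebra \<otimes>\<^sub>q 'b::superalgebra))"
  by (rule Cq_linearI) (simp_all add: tensor_pure_simps distrib_right scaleq_mult_left)

text \<open>The coefficients that appear when \<open>f\<close> passes two generators with column
  indices \<open>a\<close> and \<open>b\<close>. The one with index \<open>b\<close> is nearer to
  \<open>f\<close>, so its matrix is applied first.\<close>

definition tmat2 :: "('r::finite, 'n::finite) A \<Rightarrow>
    ('n sidx \<Rightarrow> 'n sidx \<Rightarrow> (('r, 'n) A \<otimes>\<^sub>q 'b::superalgebra)) \<Rightarrow> 'n sidx \<Rightarrow> 'n sidx \<Rightarrow> (('r,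
        'n) A \<otimes>\<^sub>q 'b)" where
  "tmat2 f h a b = (\<Sum>c\<in>UNIV. \<Sum>d\<in>UNIV. (tmat (tmat f b d) a c \<otimes> 1) * h c d)"

lemma tmat2_linear: "Cq_linear (\<lambda>f. tmat2 f h a b)"
  unfolding tmat2_def
  by (rule Cq_linearI) (simp_all add: Cq_linear_add[OF tmat_linear] Cq_linear_scaleq[OF tmat_linear]
      tensor_pure_simps distrib_right scaleq_mult_left sum.distrib Cq_space.scale_sum_right)

lemma tmat2_one: "tmat2 1 h a b = h a b"
proof -
  have "(tmat (tmat 1 b d) a c \<otimes> 1) * h c d = (if a = c \<and> b = d then h a b else 0)" for c d
    by (auto simp: tmat_one Cq_linear_zero[OF tmat_linear] simp flip: one_tensor_def)
  then show ?thesis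
    by (simp add: tmat2_def sum_delta2)
qed

lemma tmat2_mult: "tmat2 (f * g) h a b = tmat2 f (tmat2 g h) a b"
proof -
  have "tmat2 (f * g) h a b = (\<Sum>c\<in>UNIV. \<Sum>d\<in>UNIV. \<Sum>e\<in>UNIV. \<Sum>k\<in>UNIV.
      (tmat (tmat f b e) a k \<otimes> 1) * ((tmat (tmat g e d) k c \<otimes> 1) * h c d))"
    by (simp only: tmat2_def tmat_mult Cq_linear_sum[OF tmat_linear] Cq_linear_sum[OF
        tensor_left_linear]
      flip: mult.assoc tensor_mult_left)
  also have "\<dots> = (\<Sum>e\<in>UNIV. \<Sum>k\<in>UNIV. \<Sum>c\<in>UNIV. \<Sum>d\<in>UNIV.
      (tmat (tmat f b e) a k \<otimes> 1) * ((tmat (tmat g e d) k c \<otimes> 1) * h c d))"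
    by (rule sum_swap4)
  also have "\<dots> = tmat2 f (tmat2 g h) a b"
    by (subst sum.swap) (simp add: tmat2_def sum_distrib_left)
  finally show ?thesis .
qed

lemma tmat2_t_elt:
  assumes "sidx_pos i"
  shows "tmat2 (t_elt i x) h a b =
    (\<Sum>p\<in>UNIV. (t_elt i p \<otimes> 1) * crossing (\<lambda>c y. crossing (\<lambda>d z. if z = x then h c d else 0) b y) a p)"
proof -
  have inner: "crossing (\<lambda>d z. if z = x then h c d else 0) b y =
      (\<Sum>d\<in>UNIV. crossing_coeff b y d x *\<^sub>q h c d)" for c y
    by (simp add: crossing_eq_sum if_hom[of "\<lambda>v. _ *\<^sub>q v"] cong: if_cong)
  have "tmat2 (t_elt i x) h a b = (\<Sum>c\<in>UNIV. \<Sum>d\<in>UNIV. \<Sum>y\<in>UNIV. \<Sum>p\<in>UNIV.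
      (crossing_coeff b y d x * crossing_coeff a p c y) *\<^sub>q ((t_elt i p \<otimes> 1) * h c d))"
    by (simp add: tmat2_def tmat_t_elt[OF assms] Cq_linear_sum[OF tmat_linear] Cq_linear_scaleq[OF
        tmat_linear]
        Cq_linear_sum[OF tensor_left_linear] Cq_linear_scaleq[OF tensor_left_linear]
            Cq_space.scale_sum_right
        scaleq_scaleq)
  also have "\<dots> = (\<Sum>c\<in>UNIV. \<Sum>y\<in>UNIV. \<Sum>p\<in>UNIV. \<Sum>d\<in>UNIV.
      (crossing_coeff b y d x * crossing_coeff a p c y) *\<^sub>q ((t_elt i p \<otimes> 1) * h c d))"
    by (rule sum.cong[OF refl], subst sum.swap, rule sum.cong[OF refl], rule sum.swap)
  also have "\<dots> = (\<Sum>p\<in>UNIV. \<Sum>c\<in>UNIV. \<Sum>y\<in>UNIV. \<Sum>d\<in>UNIV.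
      (crossing_coeff b y d x * crossing_coeff a p c y) *\<^sub>q ((t_elt i p \<otimes> 1) * h c d))"
    by (subst (2) sum.swap, subst sum.swap) (rule refl)
  also have "\<dots> = (\<Sum>p\<in>UNIV. (t_elt i p \<otimes> 1) * crossing (\<lambda>c y. crossing (\<lambda>d z. if z =
      x then h c d else 0) b y) a p)"
    unfolding inner by (simp add: crossing_eq_sum sum_distrib_left Cq_space.scale_sum_right
        scaleq_mult_right scaleq_scaleq mult.commute)
  finally show ?thesis .
qed

text \<open>\<open>tmat2\<close> turns products in \<open>f\<close> into composition, so commuting
  with \<open>braid_bar\<close> need only be checked for a generator. There the coefficients are
  nested crossings and \<open>yang_baxter_right\<close> applies.\<close>

lemma braid_bar_tmat2: "braid_bar (tmat2 f h) a b = tmat2 f (braid_bar h) a b"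
proof (induction f arbitrary: h a b rule: A_induct)
  case one
  show ?case by (simp add: tmat2_one[abs_def])
next
  case (gen i x f)
  have t: "braid_bar (tmat2 (t_elt i x) h) a b = tmat2 (t_elt i x) (braid_bar h) a b" for h :: "_
      \<Rightarrow> _ \<Rightarrow> (_ \<otimes>\<^sub>q 'c)" and a b
  proof -
    have if_braid_bar: "(if z = x then braid_bar h c d else 0) = braid_bar (\<lambda>c d. if z =
        x then h c d else 0) c d" for c d z
      by (simp add: braid_bar_def cong: if_cong)
    have "braid_bar (tmat2 (t_elt i x) h) a b = (\<Sum>p\<in>UNIV. (t_elt i p \<otimes> 1) *
        braid_bar (\<lambda>a b. crossing (\<lambda>c y. crossing (\<lambda>d z. if z = x then h c d else 0) b y) a p) a b)"
      unfolding tmat2_t_elt[OF gen(1), abs_def] braid_bar_sum braid_bar_hom[OF Cq_linear_mult(2),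
          symmetric] ..
    also have "\<dots> = tmat2 (t_elt i x) (braid_bar h) a b"
      unfolding yang_baxter_right tmat2_t_elt[OF gen(1)] if_braid_bar ..
    finally show ?thesis .
  qed
  have "braid_bar (tmat2 f h) = tmat2 f (braid_bar h)"
    by (intro ext gen(2))
  then show ?case
    by (simp add: tmat2_mult[abs_def] t)
next
  case (add f g)
  have "tmat2 (f + g) h = (\<lambda>a b. tmat2 f h a b + tmat2 g h a b)"
    by (simp add: fun_eq_iff Cq_linear_add[OF tmat2_linear])
  moreover have "braid_bar (\<lambda>a b. tmat2 f h a b + tmat2 g h a b) a b =
      braid_bar (tmat2 f h) a b + braid_bar (tmat2 g h) a b"
    by (simp add: braid_bar_def scaleq_add_right)
  ultimately show ?case
    by (simp add: add Cq_linear_add[OF tmat2_linear])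
next
  case (scale k f)
  have "tmat2 (k *\<^sub>q f) h = (\<lambda>a b. k *\<^sub>q tmat2 f h a b)"
    by (simp add: fun_eq_iff Cq_linear_scaleq[OF tmat2_linear])
  moreover have "braid_bar (\<lambda>a b. k *\<^sub>q tmat2 f h a b) a b = k *\<^sub>q braid_bar (tmat2 f h) a b"
    by (simp add: braid_bar_def scaleq_add_right scaleq_scaleq mult.commute)
  ultimately show ?case
    by (simp add: scale Cq_linear_scaleq[OF tmat2_linear])
qed

section \<open>The exchange map\<close>

lemma tbar_elt_uminus:
  "tbar_elt (- i) (- a) = sgn_pow (par i + par a) *\<^sub>q (tbar_elt i a :: ('s::finite, 'n::finite) Abar)"
proof -
  have "free_tbar i a - sgn_pow (par i + par a) * free_tbar (- i) (- a) \<in> (relators :: ('s,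
      'n) tbar_gen free_alg set)"
    unfolding relators_tbar_gen_def by blast
  from abs_presented_relator[OF this] have "tbar_elt i a =
      sgn_pow (par i + par a) *\<^sub>q (tbar_elt (- i) (- a) :: ('s, 'n) Abar)"
    by (simp add: Cq_linear_diff[OF abs_presented_linear] Cq_linear_scaleq[OF abs_presented_linear]
        sgn_pow_scaleq tbar_elt_def pgen.abs_eq)
  then show ?thesis
    by (simp add: scaleq_scaleq scaleq_one flip: sgn_pow_add)
qed

lemma tbar_relator_mem: "tbar_relator i a k b \<in> relators"
  unfolding relators_tbar_gen_def tbar_relator_def by blast

lemma tbar_defect_tbar_elt:
  "tbar_defect (\<lambda>i a k b. tbar_elt i a * tbar_elt k b) i a k b = (0 :: ('s::finite, 'n::finite) Abar)"
proof -
  have t: "tbar_elt i a * tbar_elt k b = abs_presented (free_tbar i a *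
      free_tbar k b)" for i k :: "'s sidx" and a b :: "'n sidx"
    by (simp add: tbar_elt_def pgen.abs_eq times_presented.abs_eq)
  have "abs_presented (tbar_relator i a k b) =
      sgn_pow ((par i + par a) * (par k + par b) + par a * par i + par a + par b * par k + par b) *\<^sub>q
      (tbar_defect (\<lambda>i a k b. tbar_elt i a * tbar_elt k b) i a k b :: ('s, 'n) Abar)"
    by (rule tbar_relator_linear[OF abs_presented_linear t])
      (simp_all add: tbar_elt_uminus scaleq_mult_left scaleq_mult_right)
  then show ?thesis
    by (simp add: abs_presented_relator[OF tbar_relator_mem] sgn_pow_def split: if_splits)
qed

lemma tbar_defect_pos:
  assumes "sidx_pos i" "sidx_pos k"
  shows "tbar_defect P i a k b = (qvar powi phi i k) *\<^sub>q P i a k b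
    + (if i < k then qxi *\<^sub>q P k a i b else 0) - braid_bar (\<lambda>a b. P k a i b) a b"
  using assms by (simp add: tbar_defect_def braid_bar_def par_pos sidx_pos_simps sgn_pow_add
      algebra_simps)

lemma tbar_defect_add:
  "tbar_defect (\<lambda>i a k b. P i a k b + Q i a k b) i a k b =
      tbar_defect P i a k b + tbar_defect Q i a k b"
  by (simp add: tbar_defect_def Let_def scaleq_add_right)

text \<open>The twist accounts only for the row parity |\<alpha>|; the sign from the column parity
  |b| is already part of \<open>crossing\<close>.\<close>

definition tbar_op :: "('s::finite, 'n::finite) tbar_gen \<Rightarrow> (('r::finite, 'n) A \<otimes>\<^sub>q ('s, 'n) Abar)
    \<Rightarrow> (('r, 'n) A \<otimes>\<^sub>q ('s, 'n) Abar)" where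
  "tbar_op g = (case g of Tbar_gen \<alpha> b \<Rightarrow>
     tensor_lift (\<lambda>f g. \<Sum>c\<in>UNIV. tmat (twist (par \<alpha>) f) b c \<otimes> (tbar_elt \<alpha> c * g)))"

lemma tbar_op_bilinear:
  "bilinear_q (\<lambda>f g. \<Sum>c\<in>UNIV. tmat (twist (par \<alpha>) f) b c \<otimes> (tbar_elt \<alpha> c * g))"
  by (rule bilinear_qI)
    (simp_all add: twist_add twist_scaleq Cq_linear_add[OF tmat_linear] Cq_linear_scaleq[OF tmat_linear]
      distrib_left scaleq_mult_right tensor_pure_simps sum.distrib Cq_space.scale_sum_right)

lemma tbar_op_pure:
  "tbar_op (Tbar_gen \<alpha> b) (f \<otimes> g) = (\<Sum>c\<in>UNIV. tmat (twist (par \<alpha>) f) b c \<otimes> (tbar_elt \<alpha> c * g))"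
  by (simp add: tbar_op_def tensor_lift_pure[OF tbar_op_bilinear])

lemma tbar_op_linear: "Cq_linear (tbar_op g)"
  by (cases g) (simp add: tbar_op_def tensor_lift_linear[OF tbar_op_bilinear])

lemma tbar_op_uminus: "tbar_op (Tbar_gen (- \<alpha>) (- b)) v =
    sgn_pow (par \<alpha> + par b) *\<^sub>q tbar_op (Tbar_gen \<alpha> b) v"
proof (induction v)
  case (pure f g)
  have tw: "tmat (twist (par \<alpha> + 1) f) (- b) (- c) = sgn_pow (par b + par c) *\<^sub>q
      tmat (twist (par \<alpha>) f) b c" for c
    using tmat_uminus[of "twist (par \<alpha>) f"] by (simp add: twist_twist add.commute)
  have "tbar_op (Tbar_gen (- \<alpha>) (- b)) (f \<otimes> g) =
      (\<Sum>c\<in>UNIV. tmat (twist (par \<alpha> + 1) f) (- b) (- c) \<otimes> (tbar_elt (- \<alpha>) (- c) * g))"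
    by (subst sum_uminus_sidx) (simp add: tbar_op_pure par_uminus_sidx)
  also have "\<dots> = sgn_pow (par \<alpha> + par b) *\<^sub>q tbar_op (Tbar_gen \<alpha> b) (f \<otimes> g)"
    unfolding tw
    by (simp add: tbar_elt_uminus scaleq_mult_left tensor_pure_simps scaleq_scaleq tbar_op_pure
        Cq_space.scale_sum_right ac_simps flip: sgn_pow_add)
  finally show ?case .
next
  case (add x y)
  then show ?case by (simp add: Cq_linear_add[OF tbar_op_linear] scaleq_add_right)
qed

lemma tensor_one_mult: "(u \<otimes> 1) * (1 \<otimes> z) = u \<otimes> z" for u :: "'a::superalgebra" and z ::
    "'b::superalgebra"
  by (simp add: tensor_mult_left)

lemma tbar_op_tbar_op:
  assumes "sidx_pos i" "sidx_pos k"
  shows "tbar_op (Tbar_gen i a) (tbar_op (Tbar_gen k b) (f \<otimes> g)) =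
    tmat2 f (\<lambda>c d. 1 \<otimes> (tbar_elt i c * tbar_elt k d * g)) a b"
proof -
  have "tbar_op (Tbar_gen i a) (tbar_op (Tbar_gen k b) (f \<otimes> g)) =
      (\<Sum>d\<in>UNIV. \<Sum>c\<in>UNIV. tmat (tmat f b d) a c \<otimes> (tbar_elt i c * tbar_elt k d * g))"
    using assms by (simp add: tbar_op_pure Cq_linear_sum[OF tbar_op_linear] par_pos mult.assoc)
  then show ?thesis
    by (subst (asm) sum.swap) (simp add: tmat2_def tensor_one_mult)
qed

lemma tmat2_linear_right: "Cq_linear (\<lambda>h. tmat2 f h a b)"
  by (rule Cq_linearI) (simp_all add: tmat2_def plus_fun_def scaleq_fun_def distrib_left
      scaleq_mult_right
    sum.distrib Cq_space.scale_sum_right)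

text \<open>For positive rows the twists vanish and a composite of two operators is
  \<open>tmat2 f\<close> applied to products in bar A. The relation of bar A is inserted under
  \<open>tmat2 f\<close>, and \<open>braid_bar\<close> is then pulled out.\<close>

lemma tbar_defect_tbar_op:
  fixes i k :: "'s::finite sidx" and a b :: "'n::finite sidx" and v :: "('r::finite, 'n) A \<otimes>\<^sub>q
      ('s, 'n) Abar"
  assumes pos: "sidx_pos i" "sidx_pos k"
  shows "tbar_defect (\<lambda>i a k b. tbar_op (Tbar_gen i a) (tbar_op (Tbar_gen k b) v)) i a k b = 0"
proof (induction v)
  case (pure f g)
  define Y :: "'s sidx \<Rightarrow> 's sidx \<Rightarrow> 'n sidx \<Rightarrow> 'n sidx \<Rightarrow> (('r, 'n) A \<otimes>\<^sub>q ('s, 'n) Abar)"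
    where "Y i k c d = 1 \<otimes> (tbar_elt i c * tbar_elt k d * g)" for i k c d
  have op: "tbar_op (Tbar_gen i a) (tbar_op (Tbar_gen k b) (f \<otimes> g)) = tmat2 f (Y i k) a b"
    if "sidx_pos i" "sidx_pos k" for i k a b
    using tbar_op_tbar_op[OF that] by (simp add: Y_def[abs_def])
  have lin: "Cq_linear (\<lambda>z. 1 \<otimes> (z * g) :: ('r, 'n) A \<otimes>\<^sub>q ('s, 'n) Abar)"
    by (rule Cq_linearI) (simp_all add: distrib_right scaleq_mult_left tensor_pure_simps)
  \<comment> \<open>The relation of bar A for all column pairs at once, multiplied by
    \<open>g\<close> and placed in the second tensor factor.\<close>
  have "(qvar powi phi i k) *\<^sub>q Y i k c d + (if i < k then qxi *\<^sub>q Y k i c d else 0) -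
      braid_bar (Y k i) c d = 0" for c d
    using tbar_defect_hom[OF lin, of "\<lambda>i a k b. tbar_elt i a * tbar_elt k b" i c k d]
    by (cases "i < k") (simp_all add: tbar_defect_tbar_elt tbar_defect_pos[OF pos] Y_def[abs_def]
        Cq_linear_zero[OF lin])
  then have "(qvar powi phi i k) *\<^sub>q Y i k + (if i < k then qxi *\<^sub>q Y k i else 0) = braid_bar (Y k i)"
    by (auto simp: fun_eq_iff plus_fun_def scaleq_fun_def zero_fun_def)
  then have "(qvar powi phi i k) *\<^sub>q tmat2 f (Y i k) a b
      + (if i < k then qxi *\<^sub>q tmat2 f (Y k i) a b else 0) =
      tmat2 f (braid_bar (Y k i)) a b"
    by (simp add: Cq_linear_add[OF tmat2_linear_right] Cq_linear_scaleq[OF tmat2_linear_right]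
        Cq_linear_zero[OF tmat2_linear_right] if_hom[of "\<lambda>h. tmat2 f h a b"] flip: \<open>_ =
            braid_bar (Y k i)\<close>)
  then show ?case
    by (cases "i < k") (simp_all add: tbar_defect_pos[OF pos] op pos braid_bar_tmat2)
next
  case (add x y)
  then show ?case
    by (simp add: Cq_linear_add[OF tbar_op_linear] tbar_defect_add)
qed

lemma presented_action_tbar_op:
  "presented_action (tbar_op :: ('s::finite, 'n::finite) tbar_gen \<Rightarrow> (('r::finite, 'n) A \<otimes>\<^sub>q ('s,
      'n) Abar) \<Rightarrow> _)"
proof (rule presented_action.intro)
  show "Cq_linear (tbar_op g :: (('r, 'n) A \<otimes>\<^sub>q ('s, 'n) Abar) \<Rightarrow> _)" for g :: "('s, 'n) tbar_gen"
    by (rule tbar_op_linear)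
  fix x :: "('s, 'n) tbar_gen free_alg" and w :: "('r, 'n) A \<otimes>\<^sub>q ('s, 'n) Abar"
  have mult: "free_act tbar_op (x * y) w = free_act tbar_op x (free_act tbar_op y w)" for x y ::
      "('s, 'n) tbar_gen free_alg"
    by (simp add: free_act_def times_free_alg.rep_eq word_act_mult tbar_op_linear)
  assume "x \<in> relators"
  then consider i a where "x = free_tbar i a - sgn_pow (par i + par a) * free_tbar (- i) (- a)"
    | i a j b where "x = tbar_relator i a j b"
    unfolding relators_tbar_gen_def tbar_relator_def by blast
  then show "free_act tbar_op x w = 0"
  proof cases
    case 1
    then show ?thesis
      by (simp add: Cq_linear_diff[OF free_act_linear_left] Cq_linear_scaleq[OF free_act_linear_left]
          sgn_pow_scaleq free_act_gen tbar_op_uminus scaleq_scaleq scaleq_one flip: sgn_pow_add)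
  next
    case 2
    define P where "P i a k b = tbar_op (Tbar_gen i a) (tbar_op (Tbar_gen k b) w)" for i k :: "'s
        sidx" and a b
    have sym: "P (- i) (- a) k b = sgn_pow (par i + par a) *\<^sub>q P i a k b"
      "P i a (- k) (- b) = sgn_pow (par k + par b) *\<^sub>q P i a k b" for i a k b
      by (simp_all add: P_def tbar_op_uminus Cq_linear_scaleq[OF tbar_op_linear])
    have "tbar_defect P i a k b = 0" for i a k b
      by (rule tbar_defect_zeroI[where P = P, OF sym]) (simp add: P_def[abs_def] tbar_defect_tbar_op)
    then show ?thesis
      unfolding 2
      by (subst tbar_relator_linear[where P = P])
        (simp_all add: free_act_linear_left sym, simp add: P_def mult free_act_gen)
  qed
qed

interpretation tbar_action: presented_action tbar_op
  by (rule presented_action_tbar_op)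

section \<open>Compatibility of the action with products\<close>

lemma tensor_pure_linear: "Cq_linear (\<lambda>u. u \<otimes> v)" "Cq_linear (\<lambda>v. u \<otimes> v)"
  by (rule Cq_linearI; simp add: tensor_pure_simps)+

lemma act_tbar_elt: "tbar_action.act (tbar_elt \<alpha> b * g) v =
    tbar_op (Tbar_gen \<alpha> b) (tbar_action.act g v)"
  by (simp add: tbar_action.act_mult tbar_elt_def tbar_action.act_gen)

lemma tbar_action_mult_right:
  fixes x :: "('r::finite, 'n::finite) A \<otimes>\<^sub>q ('s::finite, 'n) Abar"
  shows "tbar_action.act g (x * (1 \<otimes> h)) = tbar_action.act g x * (1 \<otimes> h)"
proof -
  have "tbar_op u x * (1 \<otimes> h) = tbar_op u (x * (1 \<otimes> h))" for u and x :: "('r, 'n) A \<otimes>\<^sub>q ('s, 'n) Abar"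
  proof (induction x)
    case (pure f g)
    then show ?case
      by (cases u) (simp add: tbar_op_pure tensor_mult_right sum_distrib_right mult.assoc)
  next
    case (add x y)
    then show ?case
      by (simp add: distrib_right Cq_linear_add[OF tbar_op_linear])
  qed
  then show ?thesis
    using tbar_action.act_commute[OF Cq_linear_mult(1), of "1 \<otimes> h" g x] by simp
qed

lemma tbar_op_mult_left:
  "tbar_op (Tbar_gen \<alpha> b) ((f \<otimes> 1) * z) =
    (\<Sum>c\<in>UNIV. (tmat (twist (par \<alpha>) f) b c \<otimes> 1) * tbar_op (Tbar_gen \<alpha> c) z)"
proof (induction z)
  case (pure f' g)
  have "tbar_op (Tbar_gen \<alpha> b) ((f \<otimes> 1) * (f' \<otimes> g)) =
      (\<Sum>d\<in>UNIV. (\<Sum>c\<in>UNIV. tmat (twist (par \<alpha>) f) b c * tmat (twist (par \<alpha>) f') c d) \<otimes> (tbar_elt \<alpha>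
          d * g))"
    by (simp add: tensor_mult_left tbar_op_pure twist_mult tmat_mult)
  also have "\<dots> = (\<Sum>d\<in>UNIV. \<Sum>c\<in>UNIV.
      (tmat (twist (par \<alpha>) f) b c \<otimes> 1) * (tmat (twist (par \<alpha>) f') c d \<otimes> (tbar_elt \<alpha> d * g)))"
    by (simp add: tensor_mult_left Cq_linear_sum[OF tensor_pure_linear(1)])
  also have "\<dots> = (\<Sum>c\<in>UNIV. (tmat (twist (par \<alpha>) f) b c \<otimes> 1) * tbar_op (Tbar_gen \<alpha> c) (f' \<otimes> g))"
    by (subst sum.swap) (simp add: tbar_op_pure sum_distrib_left)
  finally show ?case .
next
  case (add x y)
  then show ?case
    by (simp add: distrib_left Cq_linear_add[OF tbar_op_linear] sum.distrib)
qed

text \<open>The product induced on A \<otimes> bar A by the exchange rule: f \<otimes> g times f'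
  \<otimes> g' is f \<Upsilon>(g \<otimes> f') g'. The first multiplicativity condition becomes the
  commutation of the action with right multiplication in this sense.\<close>

definition twisted_mult :: "(('r::finite, 'n::finite) A \<otimes>\<^sub>q ('s::finite, 'n) Abar) \<Rightarrow> (('r,
    'n) A \<otimes>\<^sub>q ('s, 'n) Abar) \<Rightarrow> (('r, 'n) A \<otimes>\<^sub>q ('s, 'n) Abar)" where
  "twisted_mult x y = tensor_lift (\<lambda>f g. (f \<otimes> 1) * tbar_action.act g y) x"

lemma twisted_mult_bilinear: "bilinear_q (\<lambda>f g. (f \<otimes> 1) * tbar_action.act g y)"
  by (rule bilinear_qI)
    (simp_all add: Cq_linear_add[OF tensor_left_linear] Cq_linear_scaleq[OF tensor_left_linear]
      Cq_linear_add[OF tbar_action.act_linear_left] Cq_linear_scaleq[OF tbar_action.act_linear_left]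
      distrib_left scaleq_mult_right)

lemma twisted_mult_pure: "twisted_mult (f \<otimes> g) y = (f \<otimes> 1) * tbar_action.act g y"
  unfolding twisted_mult_def by (rule tensor_lift_pure[OF twisted_mult_bilinear])

lemma twisted_mult_linear: "Cq_linear (\<lambda>x. twisted_mult x y)"
  unfolding twisted_mult_def by (rule tensor_lift_linear[OF twisted_mult_bilinear])

lemma tbar_op_twisted_mult: "tbar_op u (twisted_mult x y) = twisted_mult (tbar_op u x) y"
proof (induction x)
  case (pure f h)
  obtain \<alpha> b where u: "u = Tbar_gen \<alpha> b" by (cases u)
  then show ?case
    by (simp add: u act_tbar_elt twisted_mult_pure tbar_op_mult_left tbar_op_pure Cq_linear_sum[OF
        twisted_mult_linear])
next
  case (add x z)
  then show ?case
    by (simp add: Cq_linear_add[OF tbar_op_linear] Cq_linear_add[OF twisted_mult_linear])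
qed

lemma act_twisted_mult: "tbar_action.act g (twisted_mult x y) = twisted_mult (tbar_action.act g x) y"
  using tbar_action.act_commute[OF twisted_mult_linear, of y g x] by (simp add: tbar_op_twisted_mult)

lemma sum_tmat_one:
  "(\<Sum>c\<in>UNIV. tmat (1 :: ('r::finite, 'n::finite) A) b c \<otimes> z c) = 1 \<otimes> (z b :: 'v::Cq_space)"
proof -
  have "tmat (1 :: ('r, 'n) A) b c \<otimes> z c = (if b = c then 1 \<otimes> z b else 0)" for c
    by (simp add: tmat_one)
  then show ?thesis by simp
qed

lemma act_one_tensor: "tbar_action.act g (1 \<otimes> h) = 1 \<otimes> (g * h)"
proof (induction g arbitrary: h rule: presented_induct)
  case one
  show ?case by (simp add: tbar_action.act_one)
next
  case (gen u g)
  obtain \<alpha> b where u: "u = Tbar_gen \<alpha> b" by (cases u)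
  then show ?case
    by (simp add: u act_tbar_elt gen tbar_op_pure twist_one sum_tmat_one mult.assoc flip: tbar_elt_def)
next
  case (add x y)
  then show ?case
    by (simp add: Cq_linear_add[OF tbar_action.act_linear_left] distrib_right tensor_pure_simps)
next
  case (scale c x)
  then show ?case
    by (simp add: Cq_linear_scaleq[OF tbar_action.act_linear_left] scaleq_mult_left tensor_pure_simps)
qed

section \<open>Linear maps on tensor products and reassociation\<close>

lemma tensor_map_bilinear: "Cq_linear f \<Longrightarrow> Cq_linear g \<Longrightarrow> bilinear_q (\<lambda>a b. f a \<otimes> g b)"
  by (rule bilinear_qI) (simp_all add: Cq_linear_add Cq_linear_scaleq tensor_pure_simps)

lemma tensor_map_pure: "Cq_linear f \<Longrightarrow> Cq_linear g \<Longrightarrow> tensor_map f g (a \<otimes> b) = f a \<otimes> g b"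
  by (simp add: tensor_map_def tensor_map_bilinear)

lemma tensor_map_linear: "Cq_linear f \<Longrightarrow> Cq_linear g \<Longrightarrow> Cq_linear (tensor_map f g)"
  unfolding tensor_map_def by (rule tensor_lift_linear[OF tensor_map_bilinear])

lemma mul_bilinear: "bilinear_q ((*) :: 'a::superalgebra \<Rightarrow> _)"
  by (rule bilinear_qI) (simp_all add: distrib_left distrib_right scaleq_mult_left scaleq_mult_right)

lemma mul_pure: "mul (a \<otimes> b) = a * b"
  by (simp add: mul_def mul_bilinear)

lemma mul_linear: "Cq_linear mul"
  unfolding mul_def by (rule tensor_lift_linear[OF mul_bilinear])

lemma assocr_inner_bilinear: "bilinear_q (\<lambda>a b. a \<otimes> b \<otimes> c)"
  by (rule bilinear_qI) (simp_all add: tensor_pure_simps)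

text \<open>Linearity in \<open>x\<close> comes with \<open>tensor_lift\<close>; linearity in
  \<open>c\<close> is transported from pure tensors by induction on \<open>x\<close>.\<close>

lemma assocr_bilinear: "bilinear_q (\<lambda>x c. tensor_lift (\<lambda>a b. a \<otimes> b \<otimes> c) x)"
proof -
  note inner = assocr_inner_bilinear
  have "tensor_lift (\<lambda>a b. a \<otimes> b \<otimes> (c + c')) x = tensor_lift (\<lambda>a b. a \<otimes> b \<otimes> c) x +
      tensor_lift (\<lambda>a b. a \<otimes> b \<otimes> c') x"
    "tensor_lift (\<lambda>a b. a \<otimes> b \<otimes> (k *\<^sub>q c)) x = k *\<^sub>q tensor_lift (\<lambda>a b. a \<otimes> b \<otimes> c) x"
    for k c c' and x :: "'a \<otimes>\<^sub>q 'b"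
  proof (induction x)
    case (pure a b)
    { case 1 show ?case unfolding tensor_lift_pure[OF inner] by (simp add: tensor_pure_simps) }
    { case 2 show ?case unfolding tensor_lift_pure[OF inner] by (simp add: tensor_pure_simps) }
  next
    case (add x y)
    { case 1 show ?case unfolding tensor_lift_add[OF inner] add by simp }
    { case 2 show ?case unfolding tensor_lift_add[OF inner] add by (simp add: scaleq_add_right) }
  qed
  then show ?thesis
    by (intro bilinear_qI) (simp_all add: tensor_lift_add[OF inner] tensor_lift_scaleq[OF inner])
qed

lemma assocr_pure: "assocr ((a \<otimes> b) \<otimes> c) = a \<otimes> b \<otimes> c"
  unfolding assocr_def tensor_lift_pure[OF assocr_bilinear] by (rule tensor_lift_pure[OF
      assocr_inner_bilinear])

lemma assocr_linear: "Cq_linear assocr"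
  unfolding assocr_def by (rule tensor_lift_linear[OF assocr_bilinear])

lemma assocl_inner_bilinear: "bilinear_q (\<lambda>b c. (a \<otimes> b) \<otimes> c)"
  by (rule bilinear_qI) (simp_all add: tensor_pure_simps)

lemma assocl_bilinear: "bilinear_q (\<lambda>a y. tensor_lift (\<lambda>b c. (a \<otimes> b) \<otimes> c) y)"
proof -
  note inner = assocl_inner_bilinear
  have "tensor_lift (\<lambda>b c. ((a + a') \<otimes> b) \<otimes> c) y = tensor_lift (\<lambda>b c. (a \<otimes> b) \<otimes> c) y +
      tensor_lift (\<lambda>b c. (a' \<otimes> b) \<otimes> c) y"
    "tensor_lift (\<lambda>b c. ((k *\<^sub>q a) \<otimes> b) \<otimes> c) y = k *\<^sub>q tensor_lift (\<lambda>b c. (a \<otimes> b) \<otimes> c) y"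
    for k a a' and y :: "'b \<otimes>\<^sub>q 'c"
  proof (induction y)
    case (pure b c)
    { case 1 show ?case unfolding tensor_lift_pure[OF inner] by (simp add: tensor_pure_simps) }
    { case 2 show ?case unfolding tensor_lift_pure[OF inner] by (simp add: tensor_pure_simps) }
  next
    case (add x y)
    { case 1 show ?case unfolding tensor_lift_add[OF inner] add by simp }
    { case 2 show ?case unfolding tensor_lift_add[OF inner] add by (simp add: scaleq_add_right) }
  qed
  then show ?thesis
    by (intro bilinear_qI) (simp_all add: tensor_lift_add[OF inner] tensor_lift_scaleq[OF inner])
qed

lemma assocl_pure: "assocl (a \<otimes> b \<otimes> c) = (a \<otimes> b) \<otimes> c"
  unfolding assocl_def tensor_lift_pure[OF assocl_bilinear] by (rule tensor_lift_pure[OF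
      assocl_inner_bilinear])

lemma assocl_linear: "Cq_linear assocl"
  unfolding assocl_def by (rule tensor_lift_linear[OF assocl_bilinear])

lemma tensor_linear_ext:
  assumes "Cq_linear L" "Cq_linear M" "\<And>a b. L (a \<otimes> b) = M (a \<otimes> b)"
  shows "L x = M x"
  by (induction x) (simp_all add: assms Cq_linear_add)

lemma id_linear: "Cq_linear id"
  by (rule Cq_linearI) simp_all

lemma linear_comp: "Cq_linear f \<Longrightarrow> Cq_linear g \<Longrightarrow> Cq_linear (f \<circ> g)"
  unfolding comp_def by (rule Cq_linear_comp)

lemma tensor3_linear_ext:
  assumes L: "Cq_linear L" and M: "Cq_linear M" and eq: "\<And>a b c. L ((a \<otimes> b) \<otimes> c) = M ((a \<otimes> b) \<otimes> c)"
  shows "L = M"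
proof
  fix x
  have "L (y \<otimes> c) = M (y \<otimes> c)" for y c
  proof (rule tensor_linear_ext[where L = "\<lambda>y. L (y \<otimes> c)" and M = "\<lambda>y. M (y \<otimes> c)"])
    show "Cq_linear (\<lambda>y. L (y \<otimes> c))" "Cq_linear (\<lambda>y. M (y \<otimes> c))"
      by (rule Cq_linear_comp[OF L tensor_pure_linear(1)],
          rule Cq_linear_comp[OF M tensor_pure_linear(1)])
  qed (rule eq)
  then show "L x = M x"
    by (rule tensor_linear_ext[OF L M])
qed

section \<open>The exchange map and its two multiplicativity conditions\<close>

definition Upsilon :: "(('s::finite, 'n::finite) Abar \<otimes>\<^sub>q ('r::finite, 'n) A) \<Rightarrow> (('r, 'n) A \<otimes>\<^sub>q
    ('s, 'n) Abar)" where
  "Upsilon = tensor_lift (\<lambda>g f. tbar_action.act g (f \<otimes> 1))"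

lemma Upsilon_bilinear: "bilinear_q (\<lambda>g f. tbar_action.act g (f \<otimes> 1))"
  by (rule bilinear_qI)
    (simp_all add: tensor_pure_simps Cq_linear_add[OF tbar_action.act_linear_left]
        Cq_linear_scaleq[OF tbar_action.act_linear_left]
      Cq_linear_add[OF tbar_action.act_linear] Cq_linear_scaleq[OF tbar_action.act_linear])

lemma Upsilon_pure: "Upsilon (g \<otimes> f) = tbar_action.act g (f \<otimes> 1)"
  unfolding Upsilon_def by (rule tensor_lift_pure[OF Upsilon_bilinear])

lemma Upsilon_linear: "Cq_linear Upsilon"
  unfolding Upsilon_def by (rule tensor_lift_linear[OF Upsilon_bilinear])

lemmas tensor_linear_intros = linear_comp tensor_map_linear Upsilon_linear id_linear mul_linear
  assocr_linear assocl_linear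

lemmas tensor_map_simps = tensor_map_pure Upsilon_linear id_linear mul_linear mul_pure assocr_pure
  assocl_pure Upsilon_pure

lemma mul_left_pure: "tensor_map mul id (assocl (f \<otimes> z)) = (f \<otimes> 1) * z"
proof -
  have "Cq_linear (\<lambda>z. tensor_map mul id (assocl (f \<otimes> z)))"
    by (intro Cq_linear_comp[OF tensor_map_linear[OF mul_linear id_linear]] Cq_linear_comp[OF
        assocl_linear]
        Cq_linearI) (simp_all add: tensor_pure_simps)
  then show ?thesis
    by (rule tensor_linear_ext[OF _ Cq_linear_mult(2)]) (simp add: tensor_map_simps tensor_mult_left)
qed

lemma mul_right_pure: "tensor_map id mul (assocr (z \<otimes> h)) = z * (1 \<otimes> h)"
proof -
  have "Cq_linear (\<lambda>z. tensor_map id mul (assocr (z \<otimes> h)))"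
    by (intro Cq_linear_comp[OF tensor_map_linear[OF id_linear mul_linear]] Cq_linear_comp[OF
        assocr_linear]
        Cq_linearI) (simp_all add: tensor_pure_simps)
  then show ?thesis
    by (rule tensor_linear_ext[OF _ Cq_linear_mult(1)]) (simp add: tensor_map_simps tensor_mult_right)
qed

lemma Upsilon_mul_right:
  "(Upsilon :: (('s::finite, 'n::finite) Abar \<otimes>\<^sub>q ('r::finite, 'n) A) \<Rightarrow>
      _) \<circ> tensor_map id mul \<circ> assocr =
    tensor_map mul id \<circ> assocl \<circ> tensor_map id Upsilon \<circ> assocr \<circ> tensor_map Upsilon id"
proof (rule tensor3_linear_ext)
  fix g :: "('s, 'n) Abar" and f f' :: "('r, 'n) A"
  \<comment> \<open>Once \<open>g\<close> has passed \<open>f\<close>, exchanging with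
    \<open>f'\<close> and multiplying in A is right twisted multiplication by f' \<otimes>
    1.\<close>
  have "tensor_map mul id (assocl (tensor_map id Upsilon (assocr (x \<otimes> f')))) = twisted_mult x (f' \<otimes> 1)"
    for x :: "('r, 'n) A \<otimes>\<^sub>q ('s, 'n) Abar"
  proof -
    have "Cq_linear (\<lambda>x. tensor_map mul id (assocl (tensor_map id Upsilon (assocr (x \<otimes> f')))))"
      by (intro Cq_linear_comp[OF tensor_map_linear] Cq_linear_comp[OF assocl_linear]
          Cq_linear_comp[OF assocr_linear]
          mul_linear id_linear Upsilon_linear Cq_linearI) (simp_all add: tensor_pure_simps)
    then show ?thesis
      by (rule tensor_linear_ext[OF _ twisted_mult_linear])
        (simp add: tensor_map_simps mul_left_pure twisted_mult_pure)
  qed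
  then show "(Upsilon \<circ> tensor_map id mul \<circ> assocr) ((g \<otimes> f) \<otimes> f') =
      (tensor_map mul id \<circ> assocl \<circ> tensor_map id Upsilon \<circ> assocr \<circ> tensor_map Upsilon id) ((g \<otimes>
          f) \<otimes> f')"
    by (simp add: tensor_map_simps tbar_action.act_one tensor_mult_left twisted_mult_pure flip:
        act_twisted_mult)
qed (intro tensor_linear_intros)+

lemma Upsilon_mul_left:
  "(Upsilon :: (('s::finite, 'n::finite) Abar \<otimes>\<^sub>q ('r::finite, 'n) A) \<Rightarrow> _) \<circ> tensor_map mul id =
    tensor_map id mul \<circ> assocr \<circ> tensor_map Upsilon id \<circ> assocl \<circ> tensor_map id Upsilon \<circ> assocr"
proof (rule tensor3_linear_ext)
  fix g g' :: "('s, 'n) Abar" and f :: "('r, 'n) A"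
  \<comment> \<open>On f' \<otimes> h the left side is the action of \<open>g\<close> on f'
    \<otimes> 1 followed by right multiplication with 1 \<otimes> h, and these commute.\<close>
  have "tensor_map id mul (assocr (tensor_map Upsilon id (assocl (g \<otimes> x)))) = tbar_action.act g x"
    for x :: "('r, 'n) A \<otimes>\<^sub>q ('s, 'n) Abar"
  proof -
    have "Cq_linear (\<lambda>x. tensor_map id mul (assocr (tensor_map Upsilon id (assocl (g \<otimes> x)))))"
      by (intro Cq_linear_comp[OF tensor_map_linear] Cq_linear_comp[OF assocl_linear]
          Cq_linear_comp[OF assocr_linear]
          mul_linear id_linear Upsilon_linear Cq_linearI) (simp_all add: tensor_pure_simps)
    then show ?thesis
      by (rule tensor_linear_ext[OF _ tbar_action.act_linear])
        (simp add: tensor_map_simps mul_right_pure tensor_mult_right flip: tbar_action_mult_right)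
  qed
  then show "(Upsilon \<circ> tensor_map mul id) ((g \<otimes> g') \<otimes> f) =
    (tensor_map id mul \<circ> assocr \<circ> tensor_map Upsilon id \<circ> assocl \<circ> tensor_map id Upsilon \<circ> assocr)
        ((g \<otimes> g') \<otimes> f)"
    by (simp add: tensor_map_simps tbar_action.act_mult)
qed (intro tensor_linear_intros)+

section \<open>Values on generators and the matrix condition\<close>

lemma Upsilon_tbar_elt_t_elt:
  assumes "sidx_pos i"
  shows "Upsilon (tbar_elt \<alpha> b \<otimes> t_elt i a) =
    sgn_pow (par a * par \<alpha>) *\<^sub>q (\<Sum>p\<in>UNIV. crossing (\<lambda>c y. if y =
        a then t_elt i p \<otimes> tbar_elt \<alpha> c else 0) b p)"
proof -
  have crossing: "crossing (\<lambda>c y. if y = a then t_elt i p \<otimes> tbar_elt \<alpha> c else 0) b p =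
      (\<Sum>c\<in>UNIV. crossing_coeff b p c a *\<^sub>q (t_elt i p \<otimes> tbar_elt \<alpha> c))" for p
    by (simp add: crossing_eq_sum if_hom[of "\<lambda>v. _ *\<^sub>q v"] cong: if_cong)
  have "Upsilon (tbar_elt \<alpha> b \<otimes> t_elt i a) = tbar_op (Tbar_gen \<alpha> b) (t_elt i a \<otimes> 1)"
    using act_tbar_elt[of \<alpha> b 1] by (simp add: Upsilon_pure tbar_action.act_one)
  also have "\<dots> = sgn_pow (par a * par \<alpha>) *\<^sub>q
      (\<Sum>c\<in>UNIV. \<Sum>p\<in>UNIV. crossing_coeff b p c a *\<^sub>q (t_elt i p \<otimes> tbar_elt \<alpha> c))"
    by (simp add: tbar_op_pure twist_t_elt[OF assms] Cq_linear_scaleq[OF tmat_linear]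
        tmat_t_elt[OF assms]
        Cq_linear_sum[OF tensor_pure_linear(1)] tensor_pure_simps Cq_space.scale_sum_right)
  finally show ?thesis
    unfolding crossing by (subst sum.swap)
qed

lemma slot2_mult:
  fixes Y :: "('i::{finite,indexed_parity}, 'm::indexed_parity, 'l::{finite,indexed_parity},
      'p::indexed_parity, 'b::super_ring) mat2"
  shows "(slot2 x \<odot> Y) i m k p = (\<Sum>l\<in>UNIV. sgn_pow ((par k + par l) * (par i + par m)) *
    (twist (par i + par m + par l + par p) (x k l) * Y i m l p))"
proof -
  have "(\<Sum>l\<in>UNIV. sgn_pow ((par k + par l) * (par j + par m)) *
      (twist (par j + par m + par l + par p) (slot2 x i j k l) * Y j m l p)) =
    (if i = j then \<Sum>l\<in>UNIV. sgn_pow ((par k + par l) * (par i + par m)) *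
      (twist (par i + par m + par l + par p) (x k l) * Y i m l p) else 0)" for j
    by (simp add: slot2_def)
  then show ?thesis
    by (simp add: mat2_mult_def)
qed

lemma hpart_tbar_elt: "hpart (par i + par a) (tbar_elt i a) = tbar_elt i a"
  using hpart_gen[of "Tbar_gen i a"]
  by (simp add: tbar_elt_def pgen.abs_eq hpart_presented.abs_eq par_tbar_gen_def)

lemma hpart_tensor_one:
  fixes x :: "'a::superspace"
  assumes "hpart p x = x"
  shows "hpart p (x \<otimes> (1 :: 'b::superalgebra)) = x \<otimes> 1" "hpart p ((1 :: 'b) \<otimes> x) = 1 \<otimes> x"
  by (simp_all add: hpart_tensor_homogeneous[OF assms hpart_one] hpart_tensor_homogeneous[OF
      hpart_one assms])

lemma Upsilon_T_bar_T_plus: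
  "mat2_map Upsilon (slot1 (\<lambda>b \<alpha>. T_bar b \<alpha> \<otimes> 1) \<odot> slot2 (\<lambda>i a. 1 \<otimes> T_plus i a)) =
    slot2 (\<lambda>i a. T_plus i a \<otimes> 1) \<odot> mat2_scalar S_inv \<odot>
      slot1 (\<lambda>b \<alpha>. 1 \<otimes> (T_bar :: 'n::finite sidx \<Rightarrow> 's::finite sidx \<Rightarrow> _) b \<alpha>)"
proof (intro ext)
  fix b a :: "'n sidx" and \<alpha> :: "'s sidx" and i :: "'r::finite sidx"
  let ?T = "T_plus :: 'r sidx \<Rightarrow> 'n sidx \<Rightarrow> _" and ?B = "T_bar :: 'n sidx \<Rightarrow> 's sidx \<Rightarrow> _"
  have B: "hpart (par b + par \<alpha>) (T_bar b \<alpha>) = T_bar b \<alpha>" for b :: "'n sidx" and \<alpha> :: "'s sidx"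
    using hpart_tbar_elt[of \<alpha> b] by (simp add: T_bar_def bar_mat_def hpart_sgn_pow add.commute)
  have T_bar: "T_bar b \<alpha> = sgn_pow (par b * (par \<alpha> + par b)) *\<^sub>q tbar_elt \<alpha> b" for b :: "'n sidx"
    by (simp add: T_bar_def bar_mat_def sgn_pow_scaleq)
  have lhs: "mat2_map Upsilon (slot1 (\<lambda>b \<alpha>. ?B b \<alpha> \<otimes> 1) \<odot> slot2 (\<lambda>i a. 1 \<otimes> ?T i a)) b \<alpha> i a =
      (sgn_pow ((par b + par \<alpha>) * (par i + par a)) * sgn_pow (par b * (par \<alpha> + par b))) *\<^sub>q
      Upsilon (tbar_elt \<alpha> b \<otimes> ?T i a)"
    by (simp add: mat2_map_def slot1_mult_slot2[OF hpart_tensor_one(1)[OF B]] sgn_pow_scaleq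
        tensor_one_mult
        Cq_linear_scaleq[OF Upsilon_linear] T_bar tensor_pure_simps scaleq_scaleq scaleq_mult_left)
  show "mat2_map Upsilon (slot1 (\<lambda>b \<alpha>. ?B b \<alpha> \<otimes> 1) \<odot> slot2 (\<lambda>i a. 1 \<otimes> ?T i a)) b \<alpha> i a =
    (slot2 (\<lambda>i a. ?T i a \<otimes> 1) \<odot> mat2_scalar S_inv \<odot> slot1 (\<lambda>b \<alpha>. 1 \<otimes> ?B b \<alpha>)) b \<alpha> i a"
  proof (cases "sidx_pos i")
    \<comment> \<open>Rows of \<open>T_plus\<close> with negative index are zero, so both sides
      vanish.\<close>
    case False
    then have "slot2 (\<lambda>i a. ?T i a \<otimes> 1 :: ('r, 'n) A \<otimes>\<^sub>q ('s, 'n) Abar) j j i l = 0" for j l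
      by (simp add: slot2_def T_plus_def)
    with False show ?thesis
      unfolding lhs mat2_mult_assoc slot2_mult
      by (simp add: T_plus_def Cq_linear_zero[OF Upsilon_linear])
  next
    case True
    have tw: "twist d (t_elt i l \<otimes> 1 :: ('r, 'n) A \<otimes>\<^sub>q ('s, 'n) Abar) =
        sgn_pow (par l * d) *\<^sub>q (t_elt i l \<otimes> 1)" for d l
      using twist_homogeneous[OF hpart_tensor_one(1)[OF hpart_t_elt], of d i l] True
      by (simp add: par_pos sgn_pow_scaleq)
    let ?V = "\<lambda>p \<beta>. (t_elt i p \<otimes> tbar_elt \<alpha> \<beta> :: ('r, 'n) A \<otimes>\<^sub>q ('s, 'n) Abar)"
    let ?X = "slot1 (\<lambda>b \<alpha>. 1 \<otimes> ?B b \<alpha>) :: (_, _, _, _, ('r, 'n) A \<otimes>\<^sub>q ('s, 'n) Abar) mat2"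
    have X: "(t_elt i p \<otimes> 1) * (c *\<^sub>q ?X \<beta> \<alpha> l a) =
        (if l = a then (c * sgn_pow (par \<beta> * (par \<alpha> + par \<beta>))) *\<^sub>q ?V p \<beta> else 0)" for p c \<beta> l
      by (simp add: slot1_def T_bar tensor_pure_simps scaleq_mult_right tensor_one_mult scaleq_scaleq)
    \<comment> \<open>The summand \<open>p\<close>: the three terms of \<open>crossing\<close> are
      matched with the row (b, p) of S^{-1}, and \<open>slot1\<close> keeps only the column
      \<open>a\<close> of the second slot. The off-diagonal coefficient
      \<open>inverse qvar - qvar\<close> is -\<xi>, hence the minus signs in the second and third
      comparisons.\<close>
    have entry: "(sgn_pow ((par b + par \<alpha>) * par a) * sgn_pow (par b * (par \<alpha> + par b)) *
        sgn_pow (par a * par \<alpha>)) *\<^sub>q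
        crossing (\<lambda>c y. if y = a then ?V p c else 0) b p =
      (sgn_pow (par p * (par b + par \<alpha>)) * sgn_pow (par p * (par b + par \<alpha> + par p + par a))) *\<^sub>q
        ((t_elt i p \<otimes> 1) * (inverse qvar powi phi b p *\<^sub>q ?X b \<alpha> p a
          + (if p < b then (sgn_pow (par p + (par p + par b) * (par p + par \<alpha>)) * (inverse qvar -
              qvar)) *\<^sub>q ?X p \<alpha> b a else 0)
          + (if p < - b then (sgn_pow (par p + (par p + par b + 1) * (par p + par \<alpha> + 1)) *
              (inverse qvar - qvar)) *\<^sub>q ?X (- p) \<alpha> (- b) a else 0)))"
      (is "?C *\<^sub>q _ = ?D *\<^sub>q _") for p
    proof -
      have 1: "?C *\<^sub>q ((sgn_pow (par b * par p) * qvar powi - phi b p) *\<^sub>q (if p =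
          a then ?V p b else 0)) =
          ?D *\<^sub>q ((t_elt i p \<otimes> 1) * (inverse qvar powi phi b p *\<^sub>q ?X b \<alpha> p a))"
      proof (cases "p = a")
        case True
        have "?C * sgn_pow (par b * par p) = ?D * sgn_pow (par b * (par \<alpha> + par b))"
          unfolding True using bit_disj[of "par a"] bit_disj[of "par b"] bit_disj[of "par \<alpha>"]
          by (elim disjE) simp_all
        then show ?thesis
          by (simp add: X True scaleq_scaleq power_int_minus power_int_inverse)
      qed (simp add: X)
      have 2: "?C *\<^sub>q (if p < b then qxi *\<^sub>q (if b = a then ?V p p else 0) else 0) =
          - ?D *\<^sub>q ((t_elt i p \<otimes> 1) * (if p < b then (sgn_pow (par p + (par p + par b) * (par p +
              par \<alpha>)) * (inverse qvar - qvar)) *\<^sub>q ?X p \<alpha> b a else 0))"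
      proof (cases "b = a")
        case True
        have "?C * qxi = - ?D * (sgn_pow (par p + (par p + par b) * (par p + par \<alpha>)) *
            (inverse qvar - qvar) * sgn_pow (par p * (par \<alpha> + par p)))"
          unfolding True qxi_def using bit_disj[of "par a"] bit_disj[of "par p"] bit_disj[of "par \<alpha>"]
          by (elim disjE) simp_all
        then show ?thesis
          using True by (cases "p < b") (simp_all add: X scaleq_scaleq)
      qed (simp add: X mult_if_zero cong: if_cong)
      have 3: "?C *\<^sub>q (if p < - b then (sgn_pow (par p) * qxi) *\<^sub>q (if - b =
          a then ?V p (- p) else 0) else 0) =
          - ?D *\<^sub>q ((t_elt i p \<otimes> 1) * (if p < - b then (sgn_pow (par p + (par p + par b + 1) *
              (par p + par \<alpha> + 1)) * (inverse qvar - qvar)) *\<^sub>q ?X (- p) \<alpha> (- b) a else 0))"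
      proof (cases "- b = a")
        case True
        have a: "par a = par b + 1"
          using True by (auto simp: par_uminus_sidx)
        have "?C * (sgn_pow (par p) * qxi) = - ?D * (sgn_pow (par p + (par p + par b + 1) * (par p
            + par \<alpha> + 1)) * (inverse qvar - qvar) * sgn_pow (par (- p) * (par \<alpha> + par (- p))))"
          unfolding a qxi_def par_uminus_sidx using bit_disj[of "par b"] bit_disj[of "par p"]
              bit_disj[of "par \<alpha>"]
          by (elim disjE) simp_all
        then show ?thesis
          using True by (cases "p < - b") (simp_all add: X scaleq_scaleq)
      qed (simp add: X mult_if_zero cong: if_cong)
      show ?thesis
        unfolding crossing_def Cq_space.scale_right_diff_distrib 1 2 3
        by (simp only: distrib_left scaleq_add_right Cq_space.scale_minus_left diff_minus_eq_add)
    qed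
    show ?thesis
      unfolding lhs mat2_mult_assoc slot2_mult S_inv_eq S_form_mult_superalgebra
      using True
      by (simp only: T_plus_def if_True Upsilon_tbar_elt_t_elt tw par_pos sgn_pow_scaleq scaleq_scaleq
         Cq_space.scale_sum_right add_0 entry scaleq_mult_left inverse_inverse_eq)
  qed
qed

theorem proposition3p3:
  shows "\<exists>\<Upsilon> :: (('s::finite, 'n::finite) Abar \<otimes>\<^sub>q ('r::finite, 'n) A) \<Rightarrow> (('r, 'n) A \<otimes>\<^sub>q ('s, 'n) Abar).
    Cq_linear \<Upsilon> \<and>
    \<Upsilon> \<circ> tensor_map id mul \<circ> assocr =
      tensor_map mul id \<circ> assocl \<circ> tensor_map id \<Upsilon> \<circ> assocr \<circ> tensor_map \<Upsilon> id \<and>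
    \<Upsilon> \<circ> tensor_map mul id =
      tensor_map id mul \<circ> assocr \<circ> tensor_map \<Upsilon> id \<circ> assocl \<circ> tensor_map id \<Upsilon> \<circ> assocr \<and>
    (\<forall>f. \<Upsilon> (1 \<otimes> f) = f \<otimes> 1) \<and>
    (\<forall>g. \<Upsilon> (g \<otimes> 1) = 1 \<otimes> g) \<and>
    mat2_map \<Upsilon> (slot1 (\<lambda>b \<alpha>. T_bar b \<alpha> \<otimes> 1) \<odot> slot2 (\<lambda>i a. 1 \<otimes> T_plus i a)) =
      slot2 (\<lambda>i a. T_plus i a \<otimes> 1) \<odot> mat2_scalar S_inv \<odot> slot1 (\<lambda>b \<alpha>. 1 \<otimes> T_bar b \<alpha>)"
proof (intro exI[of _ Upsilon] conjI allI)
  show "Upsilon (1 \<otimes> f) = f \<otimes> 1" for f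
    by (simp add: Upsilon_pure tbar_action.act_one)
  show "Upsilon (g \<otimes> 1) = 1 \<otimes> g" for g
    using act_one_tensor[of g 1] by (simp add: Upsilon_pure)
qed (rule Upsilon_linear Upsilon_mul_right Upsilon_mul_left Upsilon_T_bar_T_plus)+

end
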